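(* Let $0<q<1$ and let $A$ be the C$^*$-algebra of the quantum $az+b$-group with real deformation parameter $q$, with $^*$-subalgebra $A_0$, as defined in the context. There exists a lower semi-continuous, densely defined, faithful KMS-weight $\psi$ on $A$ given by $$\psi(x)=\sum_{i,j\in\mathbb Z}f_{0,0}(q^i,q^j)q^{2j}$$ when $x$ (positive) has the form $x=\sum_{k,\ell}f_{k,\ell}(|a|,|b|)v^ku^\ell\in A_0$.
   Context: Let $0<q<1$. An admissible pair $(a,b)$ consists of normal operators on a Hilbert space $\mathcal H$ with trivial kernels, with polar decompositions $a=u|a|$, $b=v|b|$ ($u,v$ unitary), such that: (i) the spectra of $|a|$ and $|b|$ are contained in $\{q^j\mid j\in\mathbb Z\}\cup\{0\}$; (ii) $|a|v=qv|a|$ and $|b|u=q^{-1}u|b|$; (iii) $uv=vu$; (iv) $|a|$ and $|b|$ strongly commute. Fix such a pair. $A_0$ is the $^*$-algebra of bounded operators $\sum_{k,\ell\in\mathbb Z}f_{k,\ell}(|a|,|b|)v^ku^\ell$ (finite sums), where the $f_{k,\ell}$ are complex functions with finite support on $\{q^j\mid j\in\mathbb Z\}^2$. $A$ is the C$^*$-algebra 'generated' by $a$, $a^{-1}$ and $b$; it is bigger than the norm closure of $A_0$, since functions with a non-zero limit as the second variable tends to $0$ are allowed. Explicitly, with $\Gamma=\{zq^j\mid j\in\mathbb Z,\ z\in\mathbb C,\ |z|=1\}$ and $\overline\Gamma=\Gamma\cup\{0\}$, $A$ is the norm closed linear span of the operators $g(b)h(a)$ with $g\in C_0(\overline\Gamma)$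 and $h\in C_0(\Gamma)$. A weight on $A$ is a map $A^+\to[0,\infty]$, additive and positively homogeneous. It is a KMS-weight if there is a strongly continuous one-parameter group $\sigma$ of $^*$-automorphisms of $A$ with $\psi\circ\sigma_t=\psi$ and $\psi(x^*x)=\psi(\sigma_{i/2}(x)\sigma_{i/2}(x)^* )$ for all $x$ in the domain of $\sigma_{i/2}$. *)

theory Defs
  imports "HOL-Analysis.Analysis"
begin

section \<open>Complex Hilbert spaces and bounded operators\<close>

text \<open>The inner product is conjugate linear in its first argument.\<close>

class chilbert = banach +
  fixes scaleC :: "complex \<Rightarrow> 'a \<Rightarrow> 'a" (infixr "*\<^sub>C" 75)
    and cinner :: "'a \<Rightarrow> 'a \<Rightarrow> complex"
  assumes scaleC_add_right: "c *\<^sub>C (x + y) = c *\<^sub>C x + c *\<^sub>C y"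
    and scaleC_add_left: "(c + d) *\<^sub>C x = c *\<^sub>C x + d *\<^sub>C x"
    and scaleC_scaleC: "c *\<^sub>C (d *\<^sub>C x) = (c * d) *\<^sub>C x"
    and scaleC_of_real: "complex_of_real r *\<^sub>C x = r *\<^sub>R x"
    and cinner_commute: "cinner x y = cnj (cinner y x)"
    and cinner_add_right: "cinner x (y + z) = cinner x y + cinner x z"
    and cinner_scaleC_right: "cinner x (c *\<^sub>C y) = c * cinner x y"
    and norm_eq_sqrt_cinner: "norm x = sqrt (Re (cinner x x))"

lemma Re_cinner_self: "Re (cinner x x) = (norm (x :: 'a::chilbert))\<^sup>2"
proof -
  have "0 \<le> sqrt (Re (cinner x x))"
    using norm_eq_sqrt_cinner[of x] norm_ge_zero[of x] by linarith
  then show ?thesis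
    by (simp add: norm_eq_sqrt_cinner)
qed

lemma cinner_self: "cinner x x = complex_of_real ((norm (x :: 'a::chilbert))\<^sup>2)"
proof (rule complex_eqI)
  have "Im (cinner x x) = - Im (cinner x x)"
    using arg_cong[OF cinner_commute[of x x], of Im] by simp
  then show "Im (cinner x x) = Im (complex_of_real ((norm x)\<^sup>2))"
    by simp
qed (simp add: Re_cinner_self)

lemma cinner_scaleC_left: "cinner (c *\<^sub>C x) y = cnj c * cinner (x :: 'a::chilbert) y"
proof -
  have "cinner (c *\<^sub>C x) y = cnj (cinner y (c *\<^sub>C x))" by (rule cinner_commute)
  also have "\<dots> = cnj c * cnj (cinner y x)" by (simp add: cinner_scaleC_right)
  also have "cnj (cinner y x) = cinner x y" by (rule cinner_commute[symmetric])
  finally show ?thesis .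
qed

lemma norm_scaleC: "norm (c *\<^sub>C x) = cmod c * norm (x :: 'a::chilbert)"
proof -
  have "cinner (c *\<^sub>C x) (c *\<^sub>C x) = (c * cnj c) * cinner x x"
    by (simp add: cinner_scaleC_right cinner_scaleC_left)
  also have "\<dots> = complex_of_real ((cmod c)\<^sup>2 * (norm x)\<^sup>2)"
    by (simp add: cinner_self complex_norm_square[symmetric])
  finally have "(norm (c *\<^sub>C x))\<^sup>2 = (cmod c * norm x)\<^sup>2"
    by (simp add: Re_cinner_self[symmetric] power_mult_distrib)
  then show ?thesis
    by (simp add: power2_eq_iff_nonneg)
qed

text \<open>Bounded operators live in the Banach space of bounded real linear maps; complex linearity
  is recorded by \<open>bclinear\<close>.\<close>

definition bclinear :: "('h::chilbert \<Rightarrow>\<^sub>L 'h) \<Rightarrow> bool" where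
  "bclinear X \<longleftrightarrow> (\<forall>c x. X (c *\<^sub>C x) = c *\<^sub>C X x)"

lift_definition cscale :: "complex \<Rightarrow> ('h::chilbert \<Rightarrow>\<^sub>L 'h) \<Rightarrow> ('h \<Rightarrow>\<^sub>L 'h)" is
  "\<lambda>c X x. c *\<^sub>C X x"
proof -
  fix c :: complex and X :: "'h \<Rightarrow> 'h"
  assume X: "bounded_linear X"
  have "bounded_linear (\<lambda>x::'h. c *\<^sub>C x)"
  proof (rule bounded_linear_intro[where K = "cmod c"])
    show "c *\<^sub>C (r *\<^sub>R x) = r *\<^sub>R (c *\<^sub>C x)" for r and x :: 'h
      by (simp add: scaleC_of_real[symmetric] scaleC_scaleC mult.commute)
  qed (simp_all add: scaleC_add_right norm_scaleC mult.commute)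
  from bounded_linear_compose[OF this X] show "bounded_linear (\<lambda>x. c *\<^sub>C X x)" .
qed

definition badj :: "('h::chilbert \<Rightarrow>\<^sub>L 'h) \<Rightarrow> ('h \<Rightarrow>\<^sub>L 'h)" where
  "badj X = (THE Y :: 'h \<Rightarrow>\<^sub>L 'h. \<forall>x y. cinner (X x) y = cinner x (Y y))"

definition unitary_op :: "('h::chilbert \<Rightarrow>\<^sub>L 'h) \<Rightarrow> bool" where
  "unitary_op U \<longleftrightarrow> bclinear U \<and> surj (blinfun_apply U) \<and> (\<forall>x y. cinner (U x) (U y) = cinner x y)"

definition orth_projection :: "('h::chilbert \<Rightarrow>\<^sub>L 'h) \<Rightarrow> bool" where
  "orth_projection E \<longleftrightarrow> bclinear E \<and> E o\<^sub>L E = E \<and> (\<forall>x y. cinner (E x) y = cinner x (E y))"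

definition positive_op :: "('h::chilbert \<Rightarrow>\<^sub>L 'h) \<Rightarrow> bool" where
  "positive_op X \<longleftrightarrow> bclinear X \<and> (\<forall>x. Im (cinner x (X x)) = 0 \<and> 0 \<le> Re (cinner x (X x)))"

definition unitary_powi :: "('h::chilbert \<Rightarrow>\<^sub>L 'h) \<Rightarrow> int \<Rightarrow> ('h \<Rightarrow>\<^sub>L 'h)" where
  "unitary_powi U k =
     (if 0 \<le> k then ((o\<^sub>L) U ^^ nat k) id_blinfun else ((o\<^sub>L) (badj U) ^^ nat (- k)) id_blinfun)"

definition cspan :: "('h::chilbert \<Rightarrow>\<^sub>L 'h) set \<Rightarrow> ('h \<Rightarrow>\<^sub>L 'h) set" where
  "cspan S = {\<Sum>X\<in>F. cscale (c X) X |F c. finite F \<and> F \<subseteq> S}"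


section \<open>Unbounded operators\<close>

text \<open>An unbounded operator is represented by its graph, so that \<open>Domain T\<close> is its domain and
  equality of operators includes equality of the domains.\<close>

definition lin_op :: "('h::chilbert \<times> 'h) set \<Rightarrow> bool" where
  "lin_op T \<longleftrightarrow> single_valued T \<and> (0, 0) \<in> T
     \<and> (\<forall>x y x' y'. (x, y) \<in> T \<longrightarrow> (x', y') \<in> T \<longrightarrow> (x + x', y + y') \<in> T)
     \<and> (\<forall>c x y. (x, y) \<in> T \<longrightarrow> (c *\<^sub>C x, c *\<^sub>C y) \<in> T)"

definition graph :: "('h::chilbert \<Rightarrow>\<^sub>L 'h) \<Rightarrow> ('h \<times> 'h) set" where
  "graph X = {(x, X x) |x. True}"

definition op_scale :: "complex \<Rightarrow> ('h::chilbert \<times> 'h) set \<Rightarrow> ('h \<times> 'h) set" where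
  "op_scale c T = {(x, c *\<^sub>C y) |x y. (x, y) \<in> T}"

text \<open>Relation composition applies its left argument first; the product \<open>S T\<close> of operators
  applies \<open>T\<close> first.\<close>

definition op_mult :: "('h \<times> 'h) set \<Rightarrow> ('h \<times> 'h) set \<Rightarrow> ('h \<times> 'h) set" (infixl "\<odot>" 70) where
  "S \<odot> T = T O S"

definition adjoint_op :: "('h::chilbert \<times> 'h) set \<Rightarrow> ('h \<times> 'h) set" where
  "adjoint_op T = {(x, y). \<forall>s t. (s, t) \<in> T \<longrightarrow> cinner t x = cinner s y}"

definition normal_op :: "('h::chilbert \<times> 'h) set \<Rightarrow> bool" where
  "normal_op T \<longleftrightarrow> lin_op T \<and> closed T \<and> closure (Domain T) = UNIV
     \<and> adjoint_op T \<odot> T = T \<odot> adjoint_op T"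

definition pos_selfadjoint :: "('h::chilbert \<times> 'h) set \<Rightarrow> bool" where
  "pos_selfadjoint P \<longleftrightarrow> lin_op P \<and> closure (Domain P) = UNIV \<and> adjoint_op P = P
     \<and> (\<forall>x y. (x, y) \<in> P \<longrightarrow> 0 \<le> Re (cinner x y))"

definition trivial_kernel :: "('h::chilbert \<times> 'h) set \<Rightarrow> bool" where
  "trivial_kernel T \<longleftrightarrow> (\<forall>x. (x, 0) \<in> T \<longrightarrow> x = 0)"

text \<open>\<open>P\<close> is the modulus of \<open>T\<close>, i.e. the positive square root of \<open>T\<^sup>* T\<close>.\<close>

definition is_modulus :: "('h::chilbert \<times> 'h) set \<Rightarrow> ('h \<times> 'h) set \<Rightarrow> bool" where
  "is_modulus T P \<longleftrightarrow> pos_selfadjoint P \<and> P \<odot> P = adjoint_op T \<odot> T"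

text \<open>Polar decomposition with unitary phase, as is the case for normal operators with trivial
  kernel.\<close>

definition polar_decomposition ::
  "('h::chilbert \<times> 'h) set \<Rightarrow> ('h \<Rightarrow>\<^sub>L 'h) \<Rightarrow> ('h \<times> 'h) set \<Rightarrow> bool" where
  "polar_decomposition T U P \<longleftrightarrow> unitary_op U \<and> is_modulus T P \<and> T = graph U \<odot> P"

text \<open>A point belongs to the resolvent set iff the inverse of \<open>T - z\<close> is an everywhere
  defined bounded operator.\<close>

definition op_spectrum :: "('h::chilbert \<times> 'h) set \<Rightarrow> complex set" where
  "op_spectrum T = {z. \<not> (\<exists>R. {(y - z *\<^sub>C x, x) |x y. (x, y) \<in> T} = graph R)}"


section \<open>Spectral measures and functional calculus\<close>

definition spectral_measure :: "(complex set \<Rightarrow> ('h::chilbert \<Rightarrow>\<^sub>L 'h)) \<Rightarrow> bool" where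
  "spectral_measure E \<longleftrightarrow>
     (\<forall>M\<in>sets borel. orth_projection (E M)) \<and> E UNIV = id_blinfun
     \<and> (\<forall>M\<in>sets borel. \<forall>N\<in>sets borel. E (M \<inter> N) = E M o\<^sub>L E N)
     \<and> (\<forall>M :: nat \<Rightarrow> complex set. range M \<subseteq> sets borel \<longrightarrow> disjoint_family M \<longrightarrow>
          (\<forall>x. (\<lambda>n. E (M n) x) sums E (\<Union>n. M n) x))"

text \<open>The scalar measure \<open>M \<mapsto> \<langle>x, E(M) x\<rangle>\<close>.\<close>

definition scalar_measure ::
  "(complex set \<Rightarrow> ('h::chilbert \<Rightarrow>\<^sub>L 'h)) \<Rightarrow> 'h \<Rightarrow> complex measure" where
  "scalar_measure E x = measure_of UNIV (sets borel) (\<lambda>M. ennreal (Re (cinner x (E M x))))"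

text \<open>\<open>T\<close> is the (possibly unbounded) operator given by integrating \<open>\<phi>\<close> against \<open>E\<close>.\<close>

definition is_spectral_integral ::
  "(complex set \<Rightarrow> ('h::chilbert \<Rightarrow>\<^sub>L 'h)) \<Rightarrow> (complex \<Rightarrow> complex) \<Rightarrow> ('h \<times> 'h) set \<Rightarrow> bool" where
  "is_spectral_integral E \<phi> T \<longleftrightarrow>
     \<phi> \<in> borel_measurable borel \<and> lin_op T
     \<and> Domain T = {x. (\<integral>\<^sup>+ z. ennreal ((cmod (\<phi> z))\<^sup>2) \<partial>scalar_measure E x) < \<infinity>}
     \<and> (\<forall>x y. (x, y) \<in> T \<longrightarrow> cinner x y = (\<integral> z. \<phi> z \<partial>scalar_measure E x))"

definition spectral_measure_of ::
  "('h::chilbert \<times> 'h) set \<Rightarrow> (complex set \<Rightarrow> ('h \<Rightarrow>\<^sub>L 'h)) \<Rightarrow> bool" where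
  "spectral_measure_of T E \<longleftrightarrow> spectral_measure E \<and> is_spectral_integral E (\<lambda>z. z) T"

text \<open>\<open>X = \<phi>(T)\<close>. The functional calculus is stated as a relation; by the spectral theorem every
  normal operator has exactly one spectral measure (on Borel sets).\<close>

definition is_fcalc ::
  "('h::chilbert \<times> 'h) set \<Rightarrow> (complex \<Rightarrow> complex) \<Rightarrow> ('h \<Rightarrow>\<^sub>L 'h) \<Rightarrow> bool" where
  "is_fcalc T \<phi> X \<longleftrightarrow> (\<exists>E. spectral_measure_of T E \<and> is_spectral_integral E \<phi> (graph X))"

definition strongly_commute :: "('h::chilbert \<times> 'h) set \<Rightarrow> ('h \<times> 'h) set \<Rightarrow> bool" where
  "strongly_commute S T \<longleftrightarrow> (\<exists>E F. spectral_measure_of S E \<and> spectral_measure_of T F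
     \<and> (\<forall>M\<in>sets borel. \<forall>N\<in>sets borel. E M o\<^sub>L F N = F N o\<^sub>L E M))"

text \<open>\<open>X = f(P, R)\<close> for strongly commuting self-adjoint \<open>P\<close>, \<open>R\<close> and finitely supported \<open>f\<close>: the
  joint spectral measure of the point \<open>(s, t)\<close> is the product of the two spectral projections.\<close>

definition is_joint_fcalc ::
  "('h::chilbert \<times> 'h) set \<Rightarrow> ('h \<times> 'h) set \<Rightarrow> (real \<Rightarrow> real \<Rightarrow> complex) \<Rightarrow> ('h \<Rightarrow>\<^sub>L 'h) \<Rightarrow> bool" where
  "is_joint_fcalc P R f X \<longleftrightarrow> (\<exists>E F. spectral_measure_of P E \<and> spectral_measure_of R F
     \<and> X = (\<Sum>(s, t)\<in>{(s, t). f s t \<noteq> 0}.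
              cscale (f s t) (E {complex_of_real s} o\<^sub>L F {complex_of_real t})))"


section \<open>The algebra of the quantum az+b-group\<close>

definition q_powers :: "real \<Rightarrow> real set" where
  "q_powers q = range (\<lambda>j::int. q powi j)"

definition q_Gamma :: "real \<Rightarrow> complex set" where
  "q_Gamma q = {z * complex_of_real (q powi j) |z (j::int). cmod z = 1}"

text \<open>\<open>a = u |a|\<close>, \<open>b = v |b|\<close> with \<open>p = |a|\<close> and \<open>r = |b|\<close>.\<close>

definition admissible_pair :: "real \<Rightarrow> ('h::chilbert \<times> 'h) set \<Rightarrow> ('h \<times> 'h) set \<Rightarrow>
    ('h \<Rightarrow>\<^sub>L 'h) \<Rightarrow> ('h \<times> 'h) set \<Rightarrow> ('h \<Rightarrow>\<^sub>L 'h) \<Rightarrow> ('h \<times> 'h) set \<Rightarrow> bool" where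
  "admissible_pair q a b u p v r \<longleftrightarrow>
     normal_op a \<and> normal_op b \<and> trivial_kernel a \<and> trivial_kernel b
     \<and> polar_decomposition a u p \<and> polar_decomposition b v r
     \<and> op_spectrum p \<subseteq> complex_of_real ` (q_powers q \<union> {0})
     \<and> op_spectrum r \<subseteq> complex_of_real ` (q_powers q \<union> {0})
     \<and> p \<odot> graph v = op_scale (complex_of_real q) (graph v \<odot> p)
     \<and> r \<odot> graph u = op_scale (complex_of_real (inverse q)) (graph u \<odot> r)
     \<and> u o\<^sub>L v = v o\<^sub>L u
     \<and> strongly_commute p r"

text \<open>\<open>x\<close> is the element of \<open>A\<^sub>0\<close> given by the coefficient functions \<open>f k l\<close>, which are supported
  in \<open>q_powers q \<times> q_powers q\<close>.\<close>

definition A0_expansion :: "real \<Rightarrow> ('h::chilbert \<Rightarrow>\<^sub>L 'h) \<Rightarrow> ('h \<times> 'h) set \<Rightarrow> ('h \<Rightarrow>\<^sub>L 'h) \<Rightarrow>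
    ('h \<times> 'h) set \<Rightarrow> (int \<Rightarrow> int \<Rightarrow> real \<Rightarrow> real \<Rightarrow> complex) \<Rightarrow> ('h \<Rightarrow>\<^sub>L 'h) \<Rightarrow> bool" where
  "A0_expansion q u p v r f x \<longleftrightarrow>
     finite {(k, l). f k l \<noteq> (\<lambda>s t. 0)}
     \<and> (\<forall>k l. finite {(s, t). f k l s t \<noteq> 0}
           \<and> {(s, t). f k l s t \<noteq> 0} \<subseteq> q_powers q \<times> q_powers q)
     \<and> (\<exists>X. (\<forall>k l. is_joint_fcalc p r (f k l) (X k l))
           \<and> x = (\<Sum>(k, l)\<in>{(k, l). f k l \<noteq> (\<lambda>s t. 0)}.
                    X k l o\<^sub>L unitary_powi v k o\<^sub>L unitary_powi u l))"

text \<open>Continuous functions on \<open>S\<close> vanishing at infinity (only the values on \<open>S\<close> matter).\<close>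

definition C0 :: "complex set \<Rightarrow> (complex \<Rightarrow> complex) set" where
  "C0 S = {g. continuous_on S g \<and>
     (\<forall>\<epsilon>>0. \<exists>K. compact K \<and> K \<subseteq> S \<and> (\<forall>z\<in>S - K. cmod (g z) < \<epsilon>))}"

definition extend0 :: "complex set \<Rightarrow> (complex \<Rightarrow> complex) \<Rightarrow> complex \<Rightarrow> complex" where
  "extend0 S g z = (if z \<in> S then g z else 0)"

definition azb_algebra ::
  "real \<Rightarrow> ('h::chilbert \<times> 'h) set \<Rightarrow> ('h \<times> 'h) set \<Rightarrow> ('h \<Rightarrow>\<^sub>L 'h) set" where
  "azb_algebra q a b = closure (cspan {G o\<^sub>L H |G H g h.
     g \<in> C0 (q_Gamma q \<union> {0}) \<and> is_fcalc b (extend0 (q_Gamma q \<union> {0}) g) G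
     \<and> h \<in> C0 (q_Gamma q) \<and> is_fcalc a (extend0 (q_Gamma q) h) H})"


section \<open>Weights on concrete C*-algebras\<close>

definition pos_part :: "('h::chilbert \<Rightarrow>\<^sub>L 'h) set \<Rightarrow> ('h \<Rightarrow>\<^sub>L 'h) set" where
  "pos_part A = {x \<in> A. positive_op x}"

definition is_weight :: "('h::chilbert \<Rightarrow>\<^sub>L 'h) set \<Rightarrow> (('h \<Rightarrow>\<^sub>L 'h) \<Rightarrow> ennreal) \<Rightarrow> bool" where
  "is_weight A \<psi> \<longleftrightarrow> (\<forall>x\<in>pos_part A. \<forall>y\<in>pos_part A. \<psi> (x + y) = \<psi> x + \<psi> y)
     \<and> (\<forall>x\<in>pos_part A. \<forall>c\<ge>0. \<psi> (c *\<^sub>R x) = ennreal c * \<psi> x)"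

definition lsc_weight :: "('h::chilbert \<Rightarrow>\<^sub>L 'h) set \<Rightarrow> (('h \<Rightarrow>\<^sub>L 'h) \<Rightarrow> ennreal) \<Rightarrow> bool" where
  "lsc_weight A \<psi> \<longleftrightarrow> (\<forall>c. closedin (top_of_set (pos_part A)) {x \<in> pos_part A. \<psi> x \<le> c})"

definition densely_defined_weight ::
  "('h::chilbert \<Rightarrow>\<^sub>L 'h) set \<Rightarrow> (('h \<Rightarrow>\<^sub>L 'h) \<Rightarrow> ennreal) \<Rightarrow> bool" where
  "densely_defined_weight A \<psi> \<longleftrightarrow> pos_part A \<subseteq> closure {x \<in> pos_part A. \<psi> x < \<infinity>}"

definition faithful_weight :: "('h::chilbert \<Rightarrow>\<^sub>L 'h) set \<Rightarrow> (('h \<Rightarrow>\<^sub>L 'h) \<Rightarrow> ennreal) \<Rightarrow> bool" where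
  "faithful_weight A \<psi> \<longleftrightarrow> (\<forall>x\<in>pos_part A. \<psi> x = 0 \<longrightarrow> x = 0)"

definition star_automorphism ::
  "('h::chilbert \<Rightarrow>\<^sub>L 'h) set \<Rightarrow> (('h \<Rightarrow>\<^sub>L 'h) \<Rightarrow> ('h \<Rightarrow>\<^sub>L 'h)) \<Rightarrow> bool" where
  "star_automorphism A \<tau> \<longleftrightarrow> bij_betw \<tau> A A
     \<and> (\<forall>x\<in>A. \<forall>y\<in>A. \<tau> (x + y) = \<tau> x + \<tau> y \<and> \<tau> (x o\<^sub>L y) = \<tau> x o\<^sub>L \<tau> y)
     \<and> (\<forall>x\<in>A. \<tau> (badj x) = badj (\<tau> x) \<and> (\<forall>c. \<tau> (cscale c x) = cscale c (\<tau> x)))"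

definition automorphism_group ::
  "('h::chilbert \<Rightarrow>\<^sub>L 'h) set \<Rightarrow> (real \<Rightarrow> ('h \<Rightarrow>\<^sub>L 'h) \<Rightarrow> ('h \<Rightarrow>\<^sub>L 'h)) \<Rightarrow> bool" where
  "automorphism_group A \<sigma> \<longleftrightarrow> (\<forall>t. star_automorphism A (\<sigma> t))
     \<and> (\<forall>x\<in>A. \<sigma> 0 x = x \<and> (\<forall>s t. \<sigma> (s + t) x = \<sigma> s (\<sigma> t x))
           \<and> continuous_on UNIV (\<lambda>t. \<sigma> t x))"

text \<open>\<open>x\<close> lies in the domain of \<open>\<sigma>\<^sub>i\<^sub>s\<close> (where \<open>s > 0\<close>) and is mapped to \<open>y\<close>: the orbit of \<open>x\<close> extends
  to a norm continuous function on the closed strip \<open>0 \<le> Im w \<le> s\<close> that is analytic (complex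
  differentiable) inside, with value \<open>y\<close> at \<open>i s\<close>.\<close>

definition analytic_generator :: "('h::chilbert \<Rightarrow>\<^sub>L 'h) set \<Rightarrow>
    (real \<Rightarrow> ('h \<Rightarrow>\<^sub>L 'h) \<Rightarrow> ('h \<Rightarrow>\<^sub>L 'h)) \<Rightarrow> real \<Rightarrow> ('h \<Rightarrow>\<^sub>L 'h) \<Rightarrow> ('h \<Rightarrow>\<^sub>L 'h) \<Rightarrow> bool" where
  "analytic_generator A \<sigma> s x y \<longleftrightarrow> x \<in> A \<and>
     (\<exists>\<Phi> :: complex \<Rightarrow> ('h \<Rightarrow>\<^sub>L 'h).
        (\<forall>w. 0 \<le> Im w \<and> Im w \<le> s \<longrightarrow> \<Phi> w \<in> A)
        \<and> continuous_on {w. 0 \<le> Im w \<and> Im w \<le> s} \<Phi>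
        \<and> (\<forall>w. 0 < Im w \<and> Im w < s \<longrightarrow> (\<exists>D. (\<Phi> has_derivative (\<lambda>h. cscale h D)) (at w)))
        \<and> (\<forall>t. \<Phi> (complex_of_real t) = \<sigma> t x)
        \<and> \<Phi> (\<i> * complex_of_real s) = y)"

definition KMS_weight :: "('h::chilbert \<Rightarrow>\<^sub>L 'h) set \<Rightarrow> (('h \<Rightarrow>\<^sub>L 'h) \<Rightarrow> ennreal) \<Rightarrow> bool" where
  "KMS_weight A \<psi> \<longleftrightarrow> is_weight A \<psi> \<and>
     (\<exists>\<sigma>. automorphism_group A \<sigma>
        \<and> (\<forall>t. \<forall>x\<in>pos_part A. \<psi> (\<sigma> t x) = \<psi> x)
        \<and> (\<forall>x y. analytic_generator A \<sigma> (1/2) x y \<longrightarrow> \<psi> (badj x o\<^sub>L x) = \<psi> (y o\<^sub>L badj y)))"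

end

theory Submission
  imports Defs "HOL-Complex_Analysis.Complex_Analysis"
begin

text \<open>Since \<open>v\<close> raises the eigenspaces of \<open>|a|\<close> and \<open>u\<close> lowers those of \<open>|b|\<close>, the Hilbert
  space decomposes as \<open>\<ell>\<^sup>2(\<int>\<^sup>2) \<otimes> K\<close>, where \<open>K\<close> is the joint eigenspace for \<open>|a| = |b| = 1\<close> and
  \<open>e(m, n) = v\<^sup>m u\<^sup>-\<^sup>n\<close> maps \<open>K\<close> onto the joint eigenspace for \<open>|a| = q\<^sup>m\<close>, \<open>|b| = q\<^sup>n\<close>. By the
  Stone-Weierstrass theorem on circles, \<open>A\<close> is the closed span of weighted shifts \<open>x \<otimes> 1\<close>. For a
  unit vector \<open>\<xi>\<close> of \<open>K\<close> the weight is \<open>\<psi>(x) = \<Sum> q\<^sup>2\<^sup>n \<langle>e(m, n) \<xi>, x e(m, n) \<xi>\<rangle>\<close>, a sum of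
  positive functionals, and \<open>\<sigma>\<^sub>t\<close> is conjugation by the unitary \<open>|b|\<close> to the power \<open>2it\<close>. At \<open>i/2\<close>
  it multiplies the matrix entry \<open>x\<^sub>i\<^sub>j\<close> by \<open>q\<close> to the power \<open>n\<^sub>j - n\<^sub>i\<close>, which turns both sides of the
  KMS condition into the same double sum.\<close>

section \<open>Inner products and adjoints\<close>

text \<open>The data are weak: a spectral integral is given only by its domain and its quadratic
  form, the functional calculus is a relation, and the spectral measures of \<open>a\<close>,
  \<open>b\<close> and of their moduli are unrelated objects. Facts about operators are therefore
  recovered by polarization, first on bounded Borel sets. A normal \<open>T\<close> with modulus
  \<open>P\<close> is tied to \<open>P\<close> by \<open>T* T = P P\<close>, which makes the circle
  of radius q^n for the one correspond to the point q^n for the other. Uniqueness of spectral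
  measures is replaced by the fact that eigenvectors determine the projections onto points, which is
  enough because the moduli have discrete spectrum. A plain trace on the Hilbert space would count
  the dimension of \<open>K\<close>. As the elements of the algebra act trivially on
  \<open>K\<close>, one unit vector \<xi> reads them off. Formally the weight is then the trace of
  |b|^2 x on the remaining factor, and conjugation by |b|^(2it) is the modular group belonging to
  the density |b|^2.\<close>

lemma cinner_add_left: "cinner (x + y) z = cinner x z + cinner (y :: 'a::chilbert) z"
  by (metis cinner_add_right cinner_commute complex_cnj_add)

lemma scaleR_scaleC: "r *\<^sub>R x = complex_of_real r *\<^sub>C (x :: 'a::chilbert)"
  by (simp add: scaleC_of_real)

lemma scaleC_zero_left [simp]: "0 *\<^sub>C (x :: 'a::chilbert) = 0"
  using scaleC_of_real[of 0 x] by simp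

lemma scaleC_one [simp]: "1 *\<^sub>C (x :: 'a::chilbert) = x"
  using scaleC_of_real[of 1 x] by simp

lemma bounded_bilinear_scaleC: "bounded_bilinear (\<lambda>c (x :: 'a::chilbert). c *\<^sub>C x)"
proof
  show "\<exists>K. \<forall>c (x::'a). norm (c *\<^sub>C x) \<le> norm c * norm x * K"
    by (rule exI[of _ 1]) (simp add: norm_scaleC)
  show "(r *\<^sub>R c) *\<^sub>C x = r *\<^sub>R (c *\<^sub>C x)" "c *\<^sub>C (r *\<^sub>R x) = r *\<^sub>R (c *\<^sub>C x)" for r c and x :: 'a
    by (simp_all add: scaleR_scaleC scaleC_scaleC scaleR_conv_of_real mult.commute)
qed (simp_all add: scaleC_add_left scaleC_add_right)

interpretation scaleC: bounded_bilinear "\<lambda>c (x :: 'a::chilbert). c *\<^sub>C x"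
  by (rule bounded_bilinear_scaleC)

lemma cinner_zero_left [simp]: "cinner 0 (x :: 'a::chilbert) = 0"
  using cinner_scaleC_left[of 0 0 x] by simp

lemma cinner_zero_right [simp]: "cinner (x :: 'a::chilbert) 0 = 0"
  using cinner_scaleC_right[of x 0 0] by simp

lemma cauchy_schwarz: "cmod (cinner x y) \<le> norm x * norm (y :: 'a::chilbert)"
proof (cases "y = 0")
  case False
  \<comment> \<open>The coefficient of the orthogonal projection of \<open>x\<close> onto
    \<open>y\<close>; \<open>?z\<close> below is the remainder, and its norm square is
    nonnegative.\<close>
  define c where "c = cinner y x / complex_of_real ((norm y)\<^sup>2)"
  have N: "complex_of_real ((norm y)\<^sup>2) \<noteq> 0" using False by simp
  have cc: "cinner y x * cinner x y = complex_of_real ((cmod (cinner x y))\<^sup>2)"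
    by (metis cinner_commute complex_norm_square mult.commute)
  have "x = (x + (- c) *\<^sub>C y) + c *\<^sub>C y"
    by (simp add: scaleC.minus_left)
  let ?z = "x + (- c) *\<^sub>C y"
  have "cinner ?z ?z = cinner x x - c * cinner x y - cnj c * (cinner y x - c * cinner y y)"
    by (simp add: cinner_add_left cinner_add_right cinner_scaleC_left cinner_scaleC_right algebra_simps)
  also have "cinner y x - c * cinner y y = 0"
    using N by (simp add: c_def cinner_self)
  also have "c * cinner x y = complex_of_real ((cmod (cinner x y))\<^sup>2 / (norm y)\<^sup>2)"
    using cc by (simp add: c_def)
  finally have "Re (cinner ?z ?z) = (norm x)\<^sup>2 - (cmod (cinner x y))\<^sup>2 / (norm y)\<^sup>2"
    by (simp add: cinner_self)
  then have "(cmod (cinner x y))\<^sup>2 / (norm y)\<^sup>2 \<le> (norm x)\<^sup>2"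
    using Re_cinner_self[of ?z] by (metis diff_ge_0_iff_ge zero_le_power2)
  then have "(cmod (cinner x y))\<^sup>2 \<le> (norm x * norm y)\<^sup>2"
    using False by (simp add: divide_le_eq power_mult_distrib)
  then show ?thesis
    by (rule power2_le_imp_le) simp
qed simp

interpretation cinner: bounded_bilinear "cinner :: 'a::chilbert \<Rightarrow> 'a \<Rightarrow> complex"
proof
  show "\<exists>K. \<forall>x (y::'a). norm (cinner x y) \<le> norm x * norm y * K"
    by (rule exI[of _ 1]) (simp add: cauchy_schwarz)
qed (simp_all add: cinner_add_left cinner_add_right scaleR_scaleC cinner_scaleC_left
    cinner_scaleC_right scaleR_conv_of_real)

lemma cinner_eqI: "(\<And>z. cinner z x = cinner z y) \<Longrightarrow> x = (y :: 'a::chilbert)"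
proof -
  assume *: "\<And>z. cinner z x = cinner z y"
  have "cinner (x - y) (x - y) = 0"
    using *[of "x - y"] by (simp add: cinner.diff_right)
  then show ?thesis
    using Re_cinner_self[of "x - y"] by simp
qed

lemma cinner_ext_left: "(\<And>z. cinner x z = cinner y z) \<Longrightarrow> x = (y :: 'a::chilbert)"
  by (rule cinner_eqI) (metis cinner_commute)

lemma bclinearD: "bclinear X \<Longrightarrow> X (c *\<^sub>C x) = c *\<^sub>C X x"
  by (simp add: bclinear_def)

lemma bclinear_simps [intro]:
  "bclinear 0" "bclinear id_blinfun"
  "bclinear X \<Longrightarrow> bclinear Y \<Longrightarrow> bclinear (X + Y)"
  "bclinear X \<Longrightarrow> bclinear Y \<Longrightarrow> bclinear (X - Y)"
  "bclinear X \<Longrightarrow> bclinear Y \<Longrightarrow> bclinear (X o\<^sub>L Y)"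
  "bclinear X \<Longrightarrow> bclinear (cscale c X)"
  by (auto simp: bclinear_def scaleC.zero_right blinfun.add_left blinfun.diff_left scaleC_add_right
      scaleC.diff_right cscale.rep_eq scaleC_scaleC mult.commute)

lemma norm_cscale: "norm (cscale c X) = cmod c * norm X"
proof (rule antisym)
  have le: "norm (cscale c X) \<le> cmod c * norm X" for c and X :: "'a::chilbert \<Rightarrow>\<^sub>L 'a"
  proof (rule norm_blinfun_bound)
    show "norm (cscale c X x) \<le> cmod c * norm X * norm x" for x
      using norm_blinfun[of X x] by (simp add: cscale.rep_eq norm_scaleC mult_left_mono mult.assoc)
  qed simp
  show "norm (cscale c X) \<le> cmod c * norm X" by (rule le)
  show "cmod c * norm X \<le> norm (cscale c X)"
  proof (cases "c = 0")
    case False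
    have "cscale (inverse c) (cscale c X) = X"
      by (rule blinfun_eqI) (simp add: cscale.rep_eq scaleC_scaleC False)
    then have "norm X \<le> cmod (inverse c) * norm (cscale c X)"
      using le[of "inverse c" "cscale c X"] by simp
    then have "cmod c * norm X \<le> cmod c * (cmod (inverse c) * norm (cscale c X))"
      by (rule mult_left_mono) simp
    also have "\<dots> = norm (cscale c X)"
      using False by (simp add: norm_inverse)
    finally show ?thesis .
  qed simp
qed

interpretation cscale: bounded_bilinear "cscale :: complex \<Rightarrow> ('a::chilbert \<Rightarrow>\<^sub>L 'a) \<Rightarrow> _"
proof
  show "\<exists>K. \<forall>c (X :: 'a \<Rightarrow>\<^sub>L 'a). norm (cscale c X) \<le> norm c * norm X * K"
    by (rule exI[of _ 1]) (simp add: norm_cscale)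
qed (auto intro!: blinfun_eqI simp: cscale.rep_eq blinfun.add_left blinfun.scaleR_left
    scaleC_add_left scaleC_add_right scaleR_scaleC scaleC_scaleC scaleR_conv_of_real mult.commute)

lemma cscale_cscale: "cscale c (cscale d X) = cscale (c * d) X"
  by (rule blinfun_eqI) (simp add: cscale.rep_eq scaleC_scaleC)

lemma cscale_one [simp]: "cscale 1 X = X"
  by (rule blinfun_eqI) (simp add: cscale.rep_eq)

lemma cscale_compose_left: "cscale c X o\<^sub>L Y = cscale c (X o\<^sub>L Y)"
  by (rule blinfun_eqI) (simp add: cscale.rep_eq)

lemma cscale_compose_right: "bclinear X \<Longrightarrow> X o\<^sub>L cscale c Y = cscale c (X o\<^sub>L Y)"
  by (rule blinfun_eqI) (simp add: cscale.rep_eq bclinearD)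

lemma blinfun_compose_add_left: "(X + Y) o\<^sub>L Z = (X o\<^sub>L Z) + (Y o\<^sub>L Z)"
  by (rule blinfun_eqI) (simp add: blinfun.add_left)

lemma blinfun_compose_add_right: "Z o\<^sub>L (X + Y) = (Z o\<^sub>L X) + (Z o\<^sub>L Y)"
  by (rule blinfun_eqI) (simp add: blinfun.add_left blinfun.add_right)

lemma blinfun_compose_assoc: "(X o\<^sub>L Y) o\<^sub>L Z = X o\<^sub>L (Y o\<^sub>L Z)"
  by (rule blinfun_eqI) simp

lemma blinfun_compose_id [simp]: "X o\<^sub>L id_blinfun = X" "id_blinfun o\<^sub>L X = X"
  by (rule blinfun_eqI, simp)+

section \<open>Quadratic forms and operator norms\<close>

lemma polarization:
  assumes Z: "bclinear Z"
  shows "4 * cinner y (Z x) = (cinner (x + y) (Z (x + y)) - cinner (x - y) (Z (x - y)))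
    + \<i> * (cinner (x + \<i> *\<^sub>C y) (Z (x + \<i> *\<^sub>C y)) - cinner (x - \<i> *\<^sub>C y) (Z (x - \<i> *\<^sub>C y)))"
  by (simp add: bclinearD[OF Z] blinfun.add_right blinfun.diff_right cinner_add_left cinner_add_right
      cinner.diff_left cinner.diff_right cinner_scaleC_left cinner_scaleC_right algebra_simps)

lemma parallelogram:
  "(norm (x + y))\<^sup>2 + (norm (x - y))\<^sup>2 = 2 * (norm x)\<^sup>2 + 2 * (norm (y :: 'a::chilbert))\<^sup>2"
  by (simp add: Re_cinner_self[symmetric] cinner_add_left cinner_add_right
      cinner.diff_left cinner.diff_right)

text \<open>Spectral integrals are controlled only through their quadratic forms, and polarization
  converts such control into a norm bound. The factor 2 is what this gives for operators that need
  not be self-adjoint; it recurs in the later norm estimates for spectral integrals.\<close>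

lemma numerical_radius_bound:
  assumes Z: "bclinear Z" and c: "0 \<le> c" and b: "\<And>x. cmod (cinner x (Z x)) \<le> c * (norm x)\<^sup>2"
  shows "norm Z \<le> 2 * c"
proof (rule norm_blinfun_bound)
  have bound: "cmod (cinner y (Z x)) \<le> c * ((norm x)\<^sup>2 + (norm y)\<^sup>2)" for x y
  proof -
    have "cmod (4 * cinner y (Z x)) \<le> (c * (norm (x + y))\<^sup>2 + c * (norm (x - y))\<^sup>2)
      + (c * (norm (x + \<i> *\<^sub>C y))\<^sup>2 + c * (norm (x - \<i> *\<^sub>C y))\<^sup>2)"
      unfolding polarization[OF Z]
      by (intro norm_triangle_mono order_trans[OF norm_triangle_ineq4] add_mono)
         (simp_all add: norm_mult, (intro order_trans[OF norm_triangle_ineq4] add_mono b)+)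
    also have "\<dots> = c * ((norm (x + y))\<^sup>2 + (norm (x - y))\<^sup>2)
        + c * ((norm (x + \<i> *\<^sub>C y))\<^sup>2 + (norm (x - \<i> *\<^sub>C y))\<^sup>2)"
      by (simp add: algebra_simps)
    also have "\<dots> = 4 * (c * ((norm x)\<^sup>2 + (norm y)\<^sup>2))"
      unfolding parallelogram by (simp add: norm_scaleC algebra_simps)
    finally show ?thesis by simp
  qed
  show "norm (Z x) \<le> 2 * c * norm x" for x
  proof (cases "Z x = 0 \<or> x = 0")
    case True
    then show ?thesis using c by auto
  next
    case False
    \<comment> \<open>Rescales \<open>Z x\<close> to the length of \<open>x\<close>, which balances
      the two terms of \<open>bound\<close>.\<close>
    define s where "s = norm x / norm (Z x)"
    have s: "s > 0" using False by (simp add: s_def)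
    have "cinner (s *\<^sub>R Z x) (Z x) = complex_of_real (s * (norm (Z x))\<^sup>2)"
      by (simp add: cinner.scaleR_left cinner_self scaleR_conv_of_real)
    then have "s * (norm (Z x))\<^sup>2 \<le> c * ((norm x)\<^sup>2 + (norm (s *\<^sub>R Z x))\<^sup>2)"
      using bound[of "s *\<^sub>R Z x" x] s by (simp add: norm_mult norm_power)
    also have "norm (s *\<^sub>R Z x) = norm x"
      using False by (simp add: s_def)
    finally have "norm x * norm (Z x) \<le> norm x * (2 * c * norm x)"
      using False by (simp add: s_def power2_eq_square algebra_simps)
    then show ?thesis using False by simp
  qed
qed (use c in simp)

text \<open>\<open>badj\<close> is a definite description, meaningful only when an adjoint exists.
  This relation carries an explicit adjoint along instead.\<close>

definition adj_pair :: "('h::chilbert \<Rightarrow>\<^sub>L 'h) \<Rightarrow> ('h \<Rightarrow>\<^sub>L 'h) \<Rightarrow> bool" where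
  "adj_pair X Y \<longleftrightarrow> (\<forall>x y. cinner (X x) y = cinner x (Y y))"

lemma adj_pairD: "adj_pair X Y \<Longrightarrow> cinner (X x) y = cinner x (Y y)"
  by (simp add: adj_pair_def)

lemma badj_eqI:
  assumes "adj_pair X Y"
  shows "badj X = Y"
  unfolding badj_def
proof (rule the_equality)
  show "\<forall>x y. cinner (X x) y = cinner x (Y y)"
    using assms by (simp add: adj_pair_def)
  show "Z = Y" if "\<forall>x y. cinner (X x) y = cinner x (Z y)" for Z :: "'a \<Rightarrow>\<^sub>L 'a"
    using that assms by (intro blinfun_eqI cinner_eqI) (simp add: adj_pair_def)
qed

lemma adj_pair_sym: "adj_pair X Y \<Longrightarrow> adj_pair Y X"
  unfolding adj_pair_def by (metis cinner_commute)

lemma adj_pair_simps: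
  "adj_pair 0 0" "adj_pair id_blinfun id_blinfun"
  "adj_pair X X' \<Longrightarrow> adj_pair Y Y' \<Longrightarrow> adj_pair (X + Y) (X' + Y')"
  "adj_pair X X' \<Longrightarrow> adj_pair Y Y' \<Longrightarrow> adj_pair (X - Y) (X' - Y')"
  "adj_pair X X' \<Longrightarrow> adj_pair Y Y' \<Longrightarrow> adj_pair (X o\<^sub>L Y) (Y' o\<^sub>L X')"
  "adj_pair X X' \<Longrightarrow> adj_pair (cscale c X) (cscale (cnj c) X')"
  by (auto simp: adj_pair_def blinfun.add_left blinfun.diff_left cinner_add_left cinner_add_right
      cinner.diff_left cinner.diff_right cscale.rep_eq cinner_scaleC_left cinner_scaleC_right)

lemma adj_pair_bclinear:
  assumes "adj_pair X Y"
  shows "bclinear X"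
  unfolding bclinear_def
  by (intro allI cinner_ext_left) (simp add: adj_pairD[OF assms] cinner_scaleC_left)

lemma adj_pair_norm_le:
  assumes "adj_pair X Y"
  shows "norm Y \<le> norm X"
proof (rule norm_blinfun_bound)
  fix y
  have "(norm (Y y))\<^sup>2 = cmod (cinner (X (Y y)) y)"
    by (simp add: adj_pairD[OF assms] cinner_self norm_power)
  also have "\<dots> \<le> norm (X (Y y)) * norm y" by (rule cauchy_schwarz)
  also have "\<dots> \<le> norm X * norm (Y y) * norm y"
    by (intro mult_right_mono norm_blinfun) simp
  finally show "norm (Y y) \<le> norm X * norm y"
    by (cases "Y y = 0") (simp_all add: power2_eq_square mult.assoc mult.left_commute)
qed simp

text \<open>Passing to the adjoint does not increase norms, so the adjoints of a convergent sequence
  are Cauchy. Thus the adjointable operators form a closed set, which gives every element of the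
  norm closed algebra its adjoint.\<close>

lemma adj_pair_limit:
  assumes lim: "X \<longlonglongrightarrow> L" and adj: "\<And>n. adj_pair (X n) (Y n)"
  shows "\<exists>M. Y \<longlonglongrightarrow> M \<and> adj_pair L M"
proof -
  have le: "norm (Y m - Y n) \<le> norm (X m - X n)" for m n
    by (rule adj_pair_norm_le) (intro adj_pair_simps adj)
  have "Cauchy X" using lim by (rule LIMSEQ_imp_Cauchy)
  then have "Cauchy Y"
    unfolding Cauchy_def dist_norm using le by (meson order_le_less_trans)
  then obtain M where M: "Y \<longlonglongrightarrow> M"
    using Cauchy_convergent convergent_def by blast
  have "cinner (L x) y = cinner x (M y)" for x y
  proof (rule LIMSEQ_unique)
    show "(\<lambda>n. cinner (X n x) y) \<longlonglongrightarrow> cinner (L x) y"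
      by (intro cinner.tendsto blinfun.tendsto lim tendsto_const)
    show "(\<lambda>n. cinner (X n x) y) \<longlonglongrightarrow> cinner x (M y)"
      unfolding adj_pairD[OF adj] by (intro cinner.tendsto blinfun.tendsto M tendsto_const)
  qed
  with M show ?thesis by (auto simp: adj_pair_def)
qed

lemma positive_op_norm_sq: "adj_pair X Y \<Longrightarrow> cinner x ((Y o\<^sub>L X) x) = complex_of_real ((norm (X x))\<^sup>2)"
  by (simp add: adj_pairD[symmetric] cinner_self)

lemma orth_projection_adj: "orth_projection E \<Longrightarrow> adj_pair E E"
  by (simp add: orth_projection_def adj_pair_def)

lemma orth_projection_idem: "orth_projection E \<Longrightarrow> E (E x) = E x"
  unfolding orth_projection_def by (metis blinfun_apply_blinfun_compose)

lemma orth_projection_bclinear: "orth_projection E \<Longrightarrow> bclinear E"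
  by (simp add: orth_projection_def)

lemma orth_projection_cinner: "orth_projection E \<Longrightarrow> cinner x (E x) = complex_of_real ((norm (E x))\<^sup>2)"
  by (metis adj_pairD cinner_self orth_projection_adj orth_projection_idem)

text \<open>The fixed spaces coincide, so \<open>E F = F\<close> and \<open>F E = E\<close>; moving
  both projections across the inner product turns this into equality. It identifies projections from
  different spectral measures by means of their eigenvectors.\<close>

lemma orth_projection_eqI:
  assumes "orth_projection E" "orth_projection F" "\<And>x. E x = x \<longleftrightarrow> F x = x"
  shows "E = F"
proof (rule blinfun_eqI)
  fix x
  have 1: "E (F y) = F y" "F (E y) = E y" for y
    using assms(3)[of "F y"] assms(3)[of "E y"] assms(1,2)[THEN orth_projection_idem] by simp_all
  have "cinner z (E x) = cinner z (F x)" for z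
  proof -
    have "cinner z (E x) = cinner z (F (E x))" by (simp add: 1)
    also have "\<dots> = cinner (E (F z)) x"
      by (simp only: assms(1,2)[THEN orth_projection_adj, THEN adj_pairD])
    also have "\<dots> = cinner z (F x)"
      by (simp add: 1 assms(2)[THEN orth_projection_adj, THEN adj_pairD])
    finally show ?thesis .
  qed
  then show "E x = F x" by (rule cinner_eqI)
qed

section \<open>Unitary operators and their integer powers\<close>

lemma unitary_op_inverse:
  assumes "unitary_op U"
  shows "adj_pair U (badj U)" "U o\<^sub>L badj U = id_blinfun" "badj U o\<^sub>L U = id_blinfun"
    "unitary_op (badj U)"
proof -
  have U: "bclinear U" "surj (blinfun_apply U)" and iso: "cinner (U x) (U y) = cinner x y" for x y
    using assms by (auto simp: unitary_op_def)
  have nU: "norm (U x) = norm x" for x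
    using iso[of x x] by (simp add: norm_eq_sqrt_cinner)
  have inj: "inj (blinfun_apply U)"
    by (rule injI) (metis blinfun.diff_right eq_iff_diff_eq_0 nU norm_eq_zero)
  define V where "V = inv (blinfun_apply U)"
  have UV: "U (V y) = y" and VU: "V (U x) = x" for x y
    using U(2) inj by (simp_all add: V_def surj_f_inv_f)
  have "bounded_linear V"
  proof (rule bounded_linear_intro[where K=1])
    show "V (x + y) = V x + V y" for x y
      by (metis UV VU blinfun.add_right)
    show "V (r *\<^sub>R x) = r *\<^sub>R V x" for r x
      by (metis UV VU blinfun.scaleR_right)
    show "norm (V x) \<le> norm x * 1" for x
      by (metis UV nU mult_1_right order_refl)
  qed
  then have V: "blinfun_apply (Blinfun V) = V" by (rule bounded_linear_Blinfun_apply)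
  have ap: "adj_pair U (Blinfun V)"
    unfolding adj_pair_def V by (metis UV iso)
  then have b: "badj U = Blinfun V" by (rule badj_eqI)
  show "adj_pair U (badj U)" using ap b by simp
  show 1: "U o\<^sub>L badj U = id_blinfun" "badj U o\<^sub>L U = id_blinfun"
    by (auto intro!: blinfun_eqI simp: b V UV VU)
  show "unitary_op (badj U)"
    unfolding unitary_op_def
  proof (intro conjI allI)
    show "bclinear (badj U)" using ap b adj_pair_bclinear adj_pair_sym by metis
    show "surj (blinfun_apply (badj U))" unfolding b V by (metis VU surjI)
    show "cinner (badj U x) (badj U y) = cinner x y" for x y
      unfolding b V by (metis UV iso)
  qed
qed

lemma unitary_op_compose: "unitary_op U \<Longrightarrow> unitary_op V \<Longrightarrow> unitary_op (U o\<^sub>L V)"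
  using comp_surj[of "blinfun_apply V" "blinfun_apply U"] by (auto simp: unitary_op_def comp_def)

lemma unitary_powi_0 [simp]: "unitary_powi U 0 = id_blinfun"
  by (simp add: unitary_powi_def)

lemma unitary_powi_1 [simp]: "unitary_powi U 1 = U"
  by (rule blinfun_eqI) (simp add: unitary_powi_def)

lemma unitary_powi_add1:
  assumes "unitary_op U"
  shows "unitary_powi U (k + 1) = U o\<^sub>L unitary_powi U k"
proof (cases "0 \<le> k")
  case True
  then show ?thesis by (simp add: unitary_powi_def nat_add_distrib)
next
  case False
  then obtain n where n: "- k = int (Suc n)"
    by (metis int_cases linorder_not_le negD neg_equal_iff_equal add.inverse_inverse)
  then have k: "nat (- k) = Suc n" "nat (- (k + 1)) = n" "\<not> 0 \<le> k" by auto
  have "U o\<^sub>L unitary_powi U k = ((o\<^sub>L) (badj U) ^^ n) id_blinfun"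
    using k unitary_op_inverse(2)[OF assms]
    by (simp add: unitary_powi_def blinfun_compose_assoc[symmetric])
  also have "\<dots> = unitary_powi U (k + 1)"
  proof (cases "n = 0")
    case True
    with n have "k + 1 = 0" by simp
    with True show ?thesis by (simp add: unitary_powi_def)
  next
    case False
    with n have "\<not> 0 \<le> k + 1" by simp
    with k show ?thesis by (simp add: unitary_powi_def)
  qed
  finally show ?thesis ..
qed

lemma unitary_powi_diff1:
  assumes "unitary_op U"
  shows "unitary_powi U (k - 1) = badj U o\<^sub>L unitary_powi U k"
proof -
  have "unitary_powi U k = U o\<^sub>L unitary_powi U (k - 1)"
    using unitary_powi_add1[OF assms, of "k - 1"] by simp
  then show ?thesis
    using unitary_op_inverse(3)[OF assms] by (simp add: blinfun_compose_assoc[symmetric])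
qed

lemma unitary_op_powi:
  assumes "unitary_op U"
  shows "unitary_op (unitary_powi U k)"
proof (induction k rule: int_induct[where k=0])
  case base
  show ?case by (auto simp: unitary_op_def)
next
  case (step1 i)
  then show ?case using assms by (simp add: unitary_powi_add1 unitary_op_compose)
next
  case (step2 i)
  then show ?case
    using assms by (simp add: unitary_powi_diff1 unitary_op_compose unitary_op_inverse)
qed

lemma unitary_powi_add:
  assumes "unitary_op U"
  shows "unitary_powi U (k + l) = unitary_powi U k o\<^sub>L unitary_powi U l"
proof (induction k rule: int_induct[where k=0])
  case base
  show ?case by simp
next
  case (step1 i)
  have "i + 1 + l = (i + l) + 1" by simp
  then show ?case
    by (simp only: unitary_powi_add1[OF assms] step1 blinfun_compose_assoc)
next
  case (step2 i)
  have "i - 1 + l = (i + l) - 1" by simp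
  then show ?case
    by (simp only: unitary_powi_diff1[OF assms] step2 blinfun_compose_assoc)
qed

lemma badj_intertwine:
  assumes "unitary_op U" "U o\<^sub>L X = Y o\<^sub>L U"
  shows "badj U o\<^sub>L Y = X o\<^sub>L badj U"
proof -
  have "badj U o\<^sub>L Y = badj U o\<^sub>L (Y o\<^sub>L U) o\<^sub>L badj U"
    using unitary_op_inverse(2)[OF assms(1)] by (simp add: blinfun_compose_assoc)
  also have "\<dots> = X o\<^sub>L badj U"
    using unitary_op_inverse(3)[OF assms(1)]
    by (simp add: assms(2)[symmetric] blinfun_compose_assoc[symmetric])
  finally show ?thesis .
qed

text \<open>One statement for two uses: with \<open>d = 1\<close> or \<open>d = -1\<close> it moves
  spectral projections along the shifts, and with \<open>d = 0\<close> it says that powers inherit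
  commutation.\<close>

lemma unitary_powi_intertwine:
  assumes U: "unitary_op U" and shift: "\<And>m. U o\<^sub>L P m = P (m + d) o\<^sub>L U"
  shows "unitary_powi U k o\<^sub>L P (m :: int) = P (m + k * d) o\<^sub>L unitary_powi U k"
proof (induction k arbitrary: m rule: int_induct[where k=0])
  case base
  show ?case by simp
next
  case (step1 i)
  have "unitary_powi U (i + 1) o\<^sub>L P m = U o\<^sub>L (unitary_powi U i o\<^sub>L P m)"
    by (simp add: unitary_powi_add1[OF U] blinfun_compose_assoc)
  also have "\<dots> = (U o\<^sub>L P (m + i * d)) o\<^sub>L unitary_powi U i"
    unfolding step1 by (simp add: blinfun_compose_assoc)
  also have "\<dots> = P (m + i * d + d) o\<^sub>L unitary_powi U (i + 1)"
    unfolding shift by (simp only: unitary_powi_add1[OF U] blinfun_compose_assoc)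
  finally show ?case by (simp add: algebra_simps)
next
  case (step2 i)
  have b: "badj U o\<^sub>L P n = P (n - d) o\<^sub>L badj U" for n
    using badj_intertwine[OF U, of "P (n - d)" "P n"] shift[of "n - d"] by simp
  have "unitary_powi U (i - 1) o\<^sub>L P m = badj U o\<^sub>L (unitary_powi U i o\<^sub>L P m)"
    by (simp add: unitary_powi_diff1[OF U] blinfun_compose_assoc)
  also have "\<dots> = (badj U o\<^sub>L P (m + i * d)) o\<^sub>L unitary_powi U i"
    unfolding step2 by (simp add: blinfun_compose_assoc)
  also have "\<dots> = P (m + i * d - d) o\<^sub>L unitary_powi U (i - 1)"
    unfolding b by (simp only: unitary_powi_diff1[OF U] blinfun_compose_assoc)
  finally show ?case by (simp add: algebra_simps)
qed

section \<open>Bounded functional calculus of a spectral measure\<close>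

lemma sets_scalar_measure [measurable_cong, simp]: "sets (scalar_measure E x) = sets borel"
  using sets.sigma_sets_eq[of "borel :: complex measure"]
  by (simp add: scalar_measure_def)

lemma space_scalar_measure [simp]: "space (scalar_measure E x) = UNIV"
  by (simp add: scalar_measure_def space_measure_of_conv)

lemma measurable_scalar_measure [simp]:
  "borel_measurable (scalar_measure E x) = (borel_measurable borel :: (complex \<Rightarrow> 'a::topological_space) set)"
  by (rule measurable_cong_sets) simp_all

text \<open>The bounded counterpart of \<open>is_spectral_integral\<close>. Prescribing the
  quadratic form is enough, since on a complex space it determines the operator.\<close>

definition spectral_int ::
  "(complex set \<Rightarrow> ('h::chilbert \<Rightarrow>\<^sub>L 'h)) \<Rightarrow> (complex \<Rightarrow> complex) \<Rightarrow> ('h \<Rightarrow>\<^sub>L 'h) \<Rightarrow> bool" where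
  "spectral_int E \<phi> G \<longleftrightarrow> \<phi> \<in> borel_measurable borel \<and> bounded (range \<phi>) \<and> bclinear G
     \<and> (\<forall>x. cinner x (G x) = (\<integral>z. \<phi> z \<partial>scalar_measure E x))"

text \<open>A step function together with the operator built from the same data. This form lets
  products and adjoints be computed by rule induction on the way the step function was
  built.\<close>

inductive spectral_step ::
  "(complex set \<Rightarrow> ('h::chilbert \<Rightarrow>\<^sub>L 'h)) \<Rightarrow> (complex \<Rightarrow> complex) \<Rightarrow> ('h \<Rightarrow>\<^sub>L 'h) \<Rightarrow> bool"
  for E :: "complex set \<Rightarrow> ('h::chilbert \<Rightarrow>\<^sub>L 'h)" where
  zero: "spectral_step E (\<lambda>z. 0) 0"
| add: "spectral_step E \<psi> S \<Longrightarrow> M \<in> sets borel \<Longrightarrow>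
    spectral_step E (\<lambda>z. \<psi> z + c * indicator M z) (S + cscale c (E M))"

locale spectral =
  fixes E :: "complex set \<Rightarrow> ('h::chilbert \<Rightarrow>\<^sub>L 'h)"
  assumes spectral_measure: "spectral_measure E"
begin

lemma proj: "M \<in> sets borel \<Longrightarrow> orth_projection (E M)"
  using spectral_measure by (simp add: spectral_measure_def)

lemma E_UNIV: "E UNIV = id_blinfun"
  using spectral_measure by (simp add: spectral_measure_def)

lemma E_Int: "M \<in> sets borel \<Longrightarrow> N \<in> sets borel \<Longrightarrow> E M o\<^sub>L E N = E (M \<inter> N)"
  using spectral_measure by (simp add: spectral_measure_def)

lemma E_Int_apply: "M \<in> sets borel \<Longrightarrow> N \<in> sets borel \<Longrightarrow> E M (E N x) = E (M \<inter> N) x"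
  using E_Int[of M N] by (metis blinfun_apply_blinfun_compose)

lemma E_sums:
  "range M \<subseteq> sets borel \<Longrightarrow> disjoint_family M \<Longrightarrow> (\<lambda>n. E (M n) x) sums E (\<Union>n. M n) x"
  using spectral_measure by (simp add: spectral_measure_def)

lemma E_empty: "E {} = 0"
proof (rule blinfun_eqI)
  fix x
  have "(\<lambda>n::nat. E {} x) sums E (\<Union>n::nat. {}) x"
    by (rule E_sums) (auto simp: disjoint_family_on_def)
  then have "(\<lambda>n::nat. E {} x) \<longlonglongrightarrow> 0"
    by (intro summable_LIMSEQ_zero) (rule sums_summable)
  then show "E {} x = blinfun_apply 0 x" by (simp add: LIMSEQ_const_iff)
qed

lemma emeasure_scalar_measure:
  assumes "M \<in> sets borel"
  shows "emeasure (scalar_measure E x) M = ennreal ((norm (E M x))\<^sup>2)"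
proof -
  have eq: "Re (cinner x (E N x)) = (norm (E N x))\<^sup>2" if "N \<in> sets borel" for N
    using orth_projection_cinner[OF proj[OF that]] by simp
  have "emeasure (scalar_measure E x) M = ennreal (Re (cinner x (E M x)))"
  proof (rule emeasure_measure_of[OF scalar_measure_def])
    show "M \<in> sets (scalar_measure E x)" using assms by simp
    show "positive (sets (scalar_measure E x)) (\<lambda>M. ennreal (Re (cinner x (E M x))))"
      by (simp add: positive_def E_empty)
    show "countably_additive (sets (scalar_measure E x)) (\<lambda>M. ennreal (Re (cinner x (E M x))))"
    proof (rule countably_additiveI)
      fix N :: "nat \<Rightarrow> complex set"
      assume N: "range N \<subseteq> sets (scalar_measure E x)" "disjoint_family N"
      then have "(\<lambda>n. cinner x (E (N n) x)) sums cinner x (E (\<Union>n. N n) x)"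
        by (intro bounded_linear.sums[OF cinner.bounded_linear_right] E_sums) simp_all
      then have "(\<lambda>n. Re (cinner x (E (N n) x))) sums Re (cinner x (E (\<Union>n. N n) x))"
        by (rule sums_Re)
      moreover have "0 \<le> Re (cinner x (E (N n) x))" for n
        using N(1) eq[of "N n"] by (simp add: range_subsetD)
      ultimately show "(\<Sum>n. ennreal (Re (cinner x (E (N n) x)))) = ennreal (Re (cinner x (E (\<Union>n. N n) x)))"
        by (intro suminf_ennreal_eq)
    qed
  qed simp
  then show ?thesis using eq[OF assms] by simp
qed

lemma finite_scalar_measure: "finite_measure (scalar_measure E x)"
  by (rule finite_measureI) (simp add: emeasure_scalar_measure)

lemma measure_scalar_measure:
  "M \<in> sets borel \<Longrightarrow> measure (scalar_measure E x) M = (norm (E M x))\<^sup>2"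
  by (simp add: measure_def emeasure_scalar_measure)

lemma null_sets_scalar_measure:
  "M \<in> null_sets (scalar_measure E x) \<longleftrightarrow> M \<in> sets borel \<and> E M x = 0"
  by (auto simp: null_sets_def emeasure_scalar_measure)

text \<open>The additivity of \<open>E\<close> concerns disjoint unions only; arbitrary countable
  unions are handled through the null sets of the scalar measure.\<close>

lemma E_UN_null:
  assumes "countable I" "\<And>i. i \<in> I \<Longrightarrow> M i \<in> sets borel" "\<And>i. i \<in> I \<Longrightarrow> E (M i) x = 0"
  shows "E (\<Union>i\<in>I. M i) x = 0"
proof -
  have "(\<Union>i\<in>I. M i) \<in> null_sets (scalar_measure E x)"
    by (rule null_sets_UN') (use assms in \<open>auto simp: null_sets_scalar_measure\<close>)
  then show ?thesis by (simp add: null_sets_scalar_measure)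
qed

lemma integrable_bounded:
  assumes "\<phi> \<in> borel_measurable borel" "bounded (range \<phi>)"
  shows "integrable (scalar_measure E x) (\<phi> :: complex \<Rightarrow> complex)"
proof -
  interpret finite_measure "scalar_measure E x" by (rule finite_scalar_measure)
  obtain c where "\<And>z. norm (\<phi> z) \<le> c" using assms(2) by (auto simp: bounded_iff)
  then show ?thesis
    by (intro integrable_const_bound[of _ c]) (use assms(1) in auto)
qed

lemma spectral_intD:
  assumes "spectral_int E \<phi> G"
  shows "\<phi> \<in> borel_measurable borel" "bounded (range \<phi>)" "bclinear G"
    "cinner x (G x) = (\<integral>z. \<phi> z \<partial>scalar_measure E x)" "integrable (scalar_measure E x) \<phi>"
proof -
  show "\<phi> \<in> borel_measurable borel" "bounded (range \<phi>)"
    using assms by (simp_all add: spectral_int_def)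
  then show "integrable (scalar_measure E x) \<phi>" by (rule integrable_bounded)
qed (use assms in \<open>simp_all add: spectral_int_def\<close>)

lemma spectral_int_indicator:
  assumes M: "M \<in> sets borel"
  shows "spectral_int E (indicator M) (E M)"
  unfolding spectral_int_def
proof (intro conjI allI)
  show "bounded (range (indicator M :: complex \<Rightarrow> complex))"
    by (rule boundedI[of _ 1]) (auto split: split_indicator)
  fix x
  have "(\<integral>z. indicator M z \<partial>scalar_measure E x) = (\<integral>z. complex_of_real (indicator M z) \<partial>scalar_measure E x)"
    by (intro Bochner_Integration.integral_cong) (auto split: split_indicator)
  also have "\<dots> = complex_of_real ((norm (E M x))\<^sup>2)"
    using M by (simp add: measure_scalar_measure)
  finally show "cinner x (E M x) = (\<integral>z. indicator M z \<partial>scalar_measure E x)"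
    using orth_projection_cinner[OF proj[OF M]] by simp
qed (use M orth_projection_bclinear[OF proj] in auto)

lemma spectral_int_zero: "spectral_int E (\<lambda>z. 0) 0"
  by (auto simp: spectral_int_def)

lemma spectral_int_add:
  assumes "spectral_int E \<phi> G" "spectral_int E \<psi> H"
  shows "spectral_int E (\<lambda>z. \<phi> z + \<psi> z) (G + H)"
  unfolding spectral_int_def
  using spectral_intD[OF assms(1)] spectral_intD[OF assms(2)]
  by (auto simp: blinfun.add_left cinner_add_right intro: bounded_plus_comp)

lemma spectral_int_cscale:
  assumes "spectral_int E \<phi> G"
  shows "spectral_int E (\<lambda>z. c * \<phi> z) (cscale c G)"
  unfolding spectral_int_def
proof (intro conjI allI)
  obtain b where "\<And>z. cmod (\<phi> z) \<le> b" 
    using spectral_intD(2)[OF assms] by (auto simp: bounded_iff)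
  then show "bounded (range (\<lambda>z. c * \<phi> z))"
    by (intro boundedI[of _ "cmod c * b"]) (auto simp: norm_mult mult_left_mono)
qed (use spectral_intD[OF assms] in \<open>auto simp: cscale.rep_eq cinner_scaleC_right\<close>)

lemma spectral_int_diff:
  assumes "spectral_int E \<phi> G" "spectral_int E \<psi> H"
  shows "spectral_int E (\<lambda>z. \<phi> z - \<psi> z) (G - H)"
proof -
  have "G + cscale (-1) H = G - H"
    by (rule blinfun_eqI)
       (simp add: blinfun.add_left blinfun.diff_left cscale.rep_eq scaleC.minus_left)
  then show ?thesis
    using spectral_int_add[OF assms(1) spectral_int_cscale[OF assms(2), of "-1"]] by simp
qed

lemma spectral_int_sum:
  assumes "\<And>i. i \<in> I \<Longrightarrow> spectral_int E (\<phi> i) (G i)"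
  shows "spectral_int E (\<lambda>z. \<Sum>i\<in>I. \<phi> i z) (\<Sum>i\<in>I. G i)"
  using assms by (induction I rule: infinite_finite_induct)
    (auto intro!: spectral_int_add spectral_int_zero)

text \<open>The exceptional set \<open>N\<close> allows functions to be compared only where
  \<open>E\<close> lives; in the applications it is empty or the complement of the circles.\<close>

lemma spectral_int_norm_le:
  assumes "spectral_int E \<phi> G" "0 \<le> c" and N: "N \<in> sets borel" "E N = 0"
    and le: "\<And>z. z \<notin> N \<Longrightarrow> cmod (\<phi> z) \<le> c"
  shows "norm G \<le> 2 * c"
proof (rule numerical_radius_bound)
  fix x
  interpret finite_measure "scalar_measure E x" by (rule finite_scalar_measure)
  have "N \<in> null_sets (scalar_measure E x)" using N by (simp add: null_sets_scalar_measure)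
  then have ae: "AE z in scalar_measure E x. cmod (\<phi> z) \<le> c"
    by (rule AE_I') (use le in auto)
  have "cmod (cinner x (G x)) \<le> (\<integral>z. cmod (\<phi> z) \<partial>scalar_measure E x)"
    unfolding spectral_intD(4)[OF assms(1)] by (rule integral_norm_bound)
  also have "\<dots> \<le> (\<integral>z. c \<partial>scalar_measure E x)"
    by (rule integral_mono_AE) (use spectral_intD(5)[OF assms(1)] ae in auto)
  also have "\<dots> = c * (norm x)\<^sup>2"
    by (simp add: measure_scalar_measure E_UNIV)
  finally show "cmod (cinner x (G x)) \<le> c * (norm x)\<^sup>2" .
qed (use assms spectral_intD(3) in auto)

lemma spectral_int_unique_off:
  assumes "spectral_int E \<phi> G" "spectral_int E \<psi> H" "N \<in> sets borel" "E N = 0"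
    and "\<And>z. z \<notin> N \<Longrightarrow> \<phi> z = \<psi> z"
  shows "G = H"
proof -
  have "norm (G - H) \<le> 2 * 0"
    by (rule spectral_int_norm_le[OF spectral_int_diff[OF assms(1,2)] _ assms(3,4)])
       (use assms(5) in auto)
  then show ?thesis by simp
qed

lemma spectral_int_unique: "spectral_int E \<phi> G \<Longrightarrow> spectral_int E \<phi> H \<Longrightarrow> G = H"
  by (rule spectral_int_unique_off[where N="{}"]) (auto simp: E_empty)

lemma spectral_int_limit:
  assumes int: "\<And>n. spectral_int E (\<phi> n) (G n)"
    and unif: "uniform_limit UNIV \<phi> \<psi> sequentially" and lim: "G \<longlonglongrightarrow> H"
  shows "spectral_int E \<psi> H"
proof -
  have pointwise: "(\<lambda>n. \<phi> n z) \<longlonglongrightarrow> \<psi> z" for z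
    using tendsto_uniform_limitI[OF unif] by simp
  have meas: "\<psi> \<in> borel_measurable borel"
    by (rule borel_measurable_LIMSEQ_metric[OF spectral_intD(1)[OF int] pointwise])
  obtain n where n: "\<And>z. dist (\<phi> n z) (\<psi> z) < 1"
    using uniform_limitD[OF unif, of 1] by (auto simp: eventually_sequentially)
  obtain b where b: "\<And>z. norm (\<phi> n z) \<le> b"
    using spectral_intD(2)[OF int[of n]] by (auto simp: bounded_iff)
  have bdd: "bounded (range \<psi>)"
  proof (rule boundedI[of _ "b + 1"])
    show "norm y \<le> b + 1" if "y \<in> range \<psi>" for y
    proof -
      obtain z where y: "y = \<psi> z" using \<open>y \<in> range \<psi>\<close> by auto
      have "norm (\<psi> z) \<le> norm (\<phi> n z) + norm (\<psi> z - \<phi> n z)"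
        by (metis norm_triangle_sub)
      with b[of z] n[of z] y show ?thesis by (simp add: dist_norm norm_minus_commute)
    qed
  qed
  have lin: "bclinear H"
    unfolding bclinear_def
  proof (intro allI LIMSEQ_unique)
    fix c x
    show "(\<lambda>n. G n (c *\<^sub>C x)) \<longlonglongrightarrow> H (c *\<^sub>C x)"
      by (intro blinfun.tendsto lim tendsto_const)
    show "(\<lambda>n. G n (c *\<^sub>C x)) \<longlonglongrightarrow> c *\<^sub>C H x"
      unfolding bclinearD[OF spectral_intD(3)[OF int]]
      by (intro scaleC.tendsto blinfun.tendsto lim tendsto_const)
  qed
  have "cinner x (H x) = (\<integral>z. \<psi> z \<partial>scalar_measure E x)" for x
  proof (rule LIMSEQ_unique)
    interpret finite_measure "scalar_measure E x" by (rule finite_scalar_measure)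
    show "(\<lambda>n. cinner x (G n x)) \<longlonglongrightarrow> cinner x (H x)"
      by (intro cinner.tendsto blinfun.tendsto lim tendsto_const)
    have "(\<lambda>n. \<integral>z. \<phi> n z \<partial>scalar_measure E x) \<longlonglongrightarrow> (\<integral>z. \<psi> z \<partial>scalar_measure E x)"
    proof (rule LIMSEQ_I)
      fix e :: real
      assume e: "0 < e"
      \<comment> \<open>The total mass is \<open>(norm x)\<^sup>2\<close>; adding 1 keeps the
        division safe at \<open>x = 0\<close>.\<close>
      define d where "d = e / (1 + (norm x)\<^sup>2)"
      have p: "0 < 1 + (norm x)\<^sup>2" by (simp add: add_pos_nonneg)
      have d: "0 < d" using e p by (simp add: d_def)
      obtain n0 where n0: "\<And>n z. n \<ge> n0 \<Longrightarrow> dist (\<phi> n z) (\<psi> z) < d"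
        using uniform_limitD[OF unif d] by (auto simp: eventually_sequentially)
      have "norm ((\<integral>z. \<phi> n z \<partial>scalar_measure E x) - (\<integral>z. \<psi> z \<partial>scalar_measure E x)) < e"
        if "n \<ge> n0" for n
      proof -
        have i: "integrable (scalar_measure E x) (\<phi> n)" "integrable (scalar_measure E x) \<psi>"
          using spectral_intD(5)[OF int] integrable_bounded[OF meas bdd] by auto
        have "norm ((\<integral>z. \<phi> n z \<partial>scalar_measure E x) - (\<integral>z. \<psi> z \<partial>scalar_measure E x))
          \<le> (\<integral>z. norm (\<phi> n z - \<psi> z) \<partial>scalar_measure E x)"
          unfolding Bochner_Integration.integral_diff[OF i, symmetric] by (rule integral_norm_bound)
        also have "\<dots> \<le> (\<integral>z. d \<partial>scalar_measure E x)"
        proof (rule integral_mono)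
          show "integrable (scalar_measure E x) (\<lambda>z. norm (\<phi> n z - \<psi> z))"
            by (intro integrable_norm Bochner_Integration.integrable_diff i)
          show "norm (\<phi> n z - \<psi> z) \<le> d" for z
            using n0[OF that, of z] by (simp add: dist_norm)
        qed simp
        also have "\<dots> = d * (norm x)\<^sup>2" by (simp add: measure_scalar_measure E_UNIV)
        also have "\<dots> < d * (1 + (norm x)\<^sup>2)" using d by (intro mult_strict_left_mono) simp_all
        also have "\<dots> = e" using p by (simp add: d_def)
        finally show ?thesis .
      qed
      then show "\<exists>n0. \<forall>n\<ge>n0. norm ((\<integral>z. \<phi> n z \<partial>scalar_measure E x) - (\<integral>z. \<psi> z \<partial>scalar_measure E x)) < e"
        by blast
    qed
    then show "(\<lambda>n. cinner x (G n x)) \<longlonglongrightarrow> (\<integral>z. \<psi> z \<partial>scalar_measure E x)"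
      unfolding spectral_intD(4)[OF int] .
  qed
  with meas bdd lin show ?thesis by (simp add: spectral_int_def)
qed

section \<open>Step functions: existence, products and adjoints of spectral integrals\<close>

lemma spectral_int_step: "spectral_step E \<psi> S \<Longrightarrow> spectral_int E \<psi> S"
  by (induction rule: spectral_step.induct)
     (auto intro!: spectral_int_zero spectral_int_add spectral_int_cscale spectral_int_indicator)

lemma spectral_step_sum:
  assumes "finite I" "\<And>i. i \<in> I \<Longrightarrow> M i \<in> sets borel"
  shows "\<exists>S. spectral_step E (\<lambda>z. \<Sum>i\<in>I. c i * indicator (M i) z) S"
  using assms
proof (induction I rule: finite_induct)
  case empty
  show ?case using spectral_step.zero by auto
next
  case (insert i I)
  then obtain S where "spectral_step E (\<lambda>z. \<Sum>i\<in>I. c i * indicator (M i) z) S" by auto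
  moreover have "(\<lambda>z. \<Sum>j\<in>insert i I. c j * indicator (M j) z)
    = (\<lambda>z. (\<Sum>j\<in>I. c j * indicator (M j) z) + c i * indicator (M i) z)"
    using insert.hyps by (simp only: sum.insert add.commute simp_thms)
  ultimately show ?case
    using spectral_step.add[of E "\<lambda>z. \<Sum>j\<in>I. c j * indicator (M j) z" S "M i" "c i"] insert.prems by auto
qed

text \<open>Real and imaginary part are rounded down to multiples of \<open>d / 2\<close>, so the
  two errors add up to at most \<open>d\<close>. Boundedness leaves finitely many grid cells,
  indexed by \<open>F\<close>.\<close>

lemma step_approximation:
  assumes meas: "\<phi> \<in> borel_measurable borel" and bdd: "bounded (range \<phi>)" and d: "0 < d"
  shows "\<exists>\<psi> S. spectral_step E \<psi> S \<and> (\<forall>z. cmod (\<psi> z - \<phi> z) \<le> d)"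
proof -
  define k where "k z = (\<lfloor>2 * Re (\<phi> z) / d\<rfloor>, \<lfloor>2 * Im (\<phi> z) / d\<rfloor>)" for z
  obtain b where b: "\<And>z. cmod (\<phi> z) \<le> b" using bdd by (auto simp: bounded_iff)
  \<comment> \<open>The extra 1 accounts for the floor of a negative number.\<close>
  define L where "L = \<lceil>2 * b / d\<rceil> + 1"
  define F where "F = {-L..L} \<times> {-L..L}"
  define g where "g = (\<lambda>(i, j). Complex (d / 2 * of_int i) (d / 2 * of_int j))"
  have "- L \<le> \<lfloor>2 * s / d\<rfloor> \<and> \<lfloor>2 * s / d\<rfloor> \<le> L" if "\<bar>s\<bar> \<le> b" for s
  proof -
    have "\<bar>2 * s / d\<bar> \<le> 2 * b / d" using that d by (simp add: abs_mult divide_right_mono)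
    then show ?thesis unfolding L_def by linarith
  qed
  then have kF: "k z \<in> F" for z
    using b[of z] abs_Re_le_cmod[of "\<phi> z"] abs_Im_le_cmod[of "\<phi> z"]
    by (auto simp: k_def F_def)
  have M: "{z. k z = t} \<in> sets borel" for t
  proof -
    have "{z \<in> space borel. \<lfloor>2 * Re (\<phi> z) / d\<rfloor> = fst t \<and> \<lfloor>2 * Im (\<phi> z) / d\<rfloor> = snd t} \<in> sets borel"
      using meas by measurable
    then show ?thesis by (simp add: k_def prod_eq_iff)
  qed
  have "finite F" by (simp add: F_def)
  then obtain S where S: "spectral_step E (\<lambda>z. \<Sum>t\<in>F. g t * indicator {z. k z = t} z) S"
    using spectral_step_sum[of F "\<lambda>t. {z. k z = t}" g] M by blast
  have eq: "(\<Sum>t\<in>F. g t * indicator {z. k z = t} z) = g (k z)" for z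
  proof -
    have "(\<Sum>t\<in>F. g t * indicator {z. k z = t} z) = (\<Sum>t\<in>F. if k z = t then g t else 0)"
      by (intro sum.cong) auto
    also have "\<dots> = g (k z)" using kF[of z] \<open>finite F\<close> by simp
    finally show ?thesis .
  qed
  have fl: "\<bar>d / 2 * of_int \<lfloor>2 * s / d\<rfloor> - s\<bar> \<le> d / 2" for s
  proof -
    have "\<bar>of_int \<lfloor>2 * s / d\<rfloor> - 2 * s / d\<bar> \<le> 1" by linarith
    then have "\<bar>d / 2\<bar> * \<bar>of_int \<lfloor>2 * s / d\<rfloor> - 2 * s / d\<bar> \<le> \<bar>d / 2\<bar> * 1"
      by (intro mult_left_mono) auto
    then show ?thesis unfolding abs_mult[symmetric] using d by (simp add: algebra_simps)
  qed
  have "cmod (g (k z) - \<phi> z) \<le> d" for z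
    using cmod_le[of "g (k z) - \<phi> z"] fl[of "Re (\<phi> z)"] fl[of "Im (\<phi> z)"]
    by (simp add: g_def k_def)
  with S show ?thesis unfolding eq by blast
qed

lemma step_sequence:
  assumes "\<phi> \<in> borel_measurable borel" "bounded (range \<phi>)"
  obtains \<psi> S where "\<And>n. spectral_step E (\<psi> n) (S n)"
    "uniform_limit UNIV \<psi> \<phi> sequentially" "\<And>n z. cmod (\<psi> n z - \<phi> z) \<le> inverse (real (Suc n))"
proof -
  have "\<exists>\<psi> S. spectral_step E \<psi> S \<and> (\<forall>z. cmod (\<psi> z - \<phi> z) \<le> inverse (real (Suc n)))" for n
    by (rule step_approximation[OF assms]) simp
  then obtain \<psi> S where *: "\<And>n. spectral_step E (\<psi> n) (S n)"
    "\<And>n z. cmod (\<psi> n z - \<phi> z) \<le> inverse (real (Suc n))"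
    by metis
  have "uniform_limit UNIV \<psi> \<phi> sequentially"
  proof (rule uniform_limitI)
    fix e :: real
    assume "0 < e"
    then obtain n0 where n0: "inverse (real (Suc n0)) < e" using reals_Archimedean by blast
    have "dist (\<psi> n z) (\<phi> z) < e" if "n \<ge> n0" for n z
    proof -
      have "inverse (real (Suc n)) \<le> inverse (real (Suc n0))" using that by (simp add: le_imp_inverse_le)
      with *(2)[of n z] n0 show ?thesis unfolding dist_norm by linarith
    qed
    then show "\<forall>\<^sub>F n in sequentially. \<forall>z\<in>UNIV. dist (\<psi> n z) (\<phi> z) < e"
      by (auto simp: eventually_sequentially)
  qed
  with * show thesis using that by blast
qed

lemma spectral_int_exists:
  assumes "\<phi> \<in> borel_measurable borel" "bounded (range \<phi>)"
  shows "\<exists>G. spectral_int E \<phi> G"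
proof -
  obtain \<psi> S where st: "\<And>n. spectral_step E (\<psi> n) (S n)" and u: "uniform_limit UNIV \<psi> \<phi> sequentially"
    and le: "\<And>n z. cmod (\<psi> n z - \<phi> z) \<le> inverse (real (Suc n))"
    using step_sequence[OF assms] by blast
  have "Cauchy S"
  proof (rule metric_CauchyI)
    fix e :: real
    assume "0 < e"
    then obtain n0 where n0: "inverse (real (Suc n0)) < e / 4"
      using reals_Archimedean[of "e / 4"] by auto
    have "dist (S m) (S n) < e" if "m \<ge> n0" "n \<ge> n0" for m n
    proof -
      have i: "inverse (real (Suc k)) \<le> inverse (real (Suc n0))" if "k \<ge> n0" for k
        using that by (simp add: le_imp_inverse_le)
      have "norm (S m - S n) \<le> 2 * (inverse (real (Suc m)) + inverse (real (Suc n)))"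
      proof (rule spectral_int_norm_le[OF spectral_int_diff[OF st[THEN spectral_int_step] st[THEN spectral_int_step]], where N="{}"])
        show "cmod (\<psi> m z - \<psi> n z) \<le> inverse (real (Suc m)) + inverse (real (Suc n))" for z
          using norm_triangle_ineq4[of "\<psi> m z - \<phi> z" "\<psi> n z - \<phi> z"] le[of m z] le[of n z] by simp
      qed (simp_all add: E_empty)
      also have "\<dots> \<le> 2 * (inverse (real (Suc n0)) + inverse (real (Suc n0)))"
        by (intro mult_left_mono add_mono i that) simp
      also have "\<dots> < e" using n0 by simp
      finally show ?thesis by (simp only: dist_norm)
    qed
    then show "\<exists>n0. \<forall>m\<ge>n0. \<forall>n\<ge>n0. dist (S m) (S n) < e" by blast
  qed
  then obtain G where "S \<longlonglongrightarrow> G" using Cauchy_convergent convergent_def by blast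
  then show ?thesis using spectral_int_limit[OF st[THEN spectral_int_step] u] by blast
qed

lemma step_sequence_spectral_int:
  assumes "spectral_int E \<phi> G"
  obtains \<psi> S where "\<And>n. spectral_step E (\<psi> n) (S n)" "uniform_limit UNIV \<psi> \<phi> sequentially" "S \<longlonglongrightarrow> G"
proof -
  obtain \<psi> S where st: "\<And>n. spectral_step E (\<psi> n) (S n)" and u: "uniform_limit UNIV \<psi> \<phi> sequentially"
    and le: "\<And>n z. cmod (\<psi> n z - \<phi> z) \<le> inverse (real (Suc n))"
    using step_sequence[OF spectral_intD(1,2)[OF assms]] by blast
  have "norm (S n - G) \<le> 2 * inverse (real (Suc n))" for n
    by (rule spectral_int_norm_le[OF spectral_int_diff[OF st[THEN spectral_int_step] assms], where N="{}"])
       (simp_all add: E_empty le del: of_nat_Suc)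
  then have "(\<lambda>n. S n - G) \<longlonglongrightarrow> 0"
    by (rule Lim_null_comparison[OF always_eventually, OF allI])
       (intro tendsto_mult_right_zero LIMSEQ_inverse_real_of_nat)
  then have "S \<longlonglongrightarrow> G" by (simp add: LIM_zero_iff)
  with st u that show thesis by blast
qed

text \<open>A product cannot be read off from quadratic forms. For indicators the rule is the
  multiplicativity of \<open>E\<close>, bilinearity extends it to step functions, and uniform limits
  do the rest.\<close>

lemma spectral_int_mult:
  assumes G: "spectral_int E \<phi> G" and H: "spectral_int E \<omega> H"
  shows "spectral_int E (\<lambda>z. \<phi> z * \<omega> z) (G o\<^sub>L H)"
proof -
  have ind: "spectral_int E (\<lambda>z. indicator M z * \<psi> z) (E M o\<^sub>L S)"
    if "spectral_step E \<psi> S" "M \<in> sets borel" for M \<psi> S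
    using that(1)
  proof induction
    case zero
    show ?case using spectral_int_zero by simp
  next
    case (add \<psi> S N c)
    have "M \<inter> N \<in> sets borel" using add that(2) by simp
    note spectral_int_add[OF add.IH spectral_int_cscale[OF spectral_int_indicator[OF this], of c]]
    then show ?case
      using add(2) that(2) orth_projection_bclinear[OF proj[OF that(2)]]
      by (simp add: blinfun_compose_add_right cscale_compose_right E_Int
          indicator_inter_arith distrib_left mult.left_commute)
  qed
  have step: "spectral_int E (\<lambda>z. \<psi>' z * \<psi> z) (S' o\<^sub>L S)"
    if "spectral_step E \<psi> S" "spectral_step E \<psi>' S'" for \<psi> S \<psi>' S'
    using that(2)
  proof induction
    case zero
    show ?case using spectral_int_zero by simp
  next
    case (add \<psi>' S' N c)
    note spectral_int_add[OF add.IH spectral_int_cscale[OF ind[OF that(1) add.hyps(2)], of c]]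
    then show ?case
      by (simp add: blinfun_compose_add_left cscale_compose_left distrib_right mult.assoc)
  qed
  obtain \<psi> S where 1: "\<And>n. spectral_step E (\<psi> n) (S n)" "uniform_limit UNIV \<psi> \<phi> sequentially" "S \<longlonglongrightarrow> G"
    using step_sequence_spectral_int[OF G] by blast
  obtain \<psi>' S' where 2: "\<And>n. spectral_step E (\<psi>' n) (S' n)" "uniform_limit UNIV \<psi>' \<omega> sequentially" "S' \<longlonglongrightarrow> H"
    using step_sequence_spectral_int[OF H] by blast
  show ?thesis
  proof (rule spectral_int_limit)
    show "spectral_int E (\<lambda>z. \<psi> n z * \<psi>' n z) (S n o\<^sub>L S' n)" for n
      using step 1 2 by blast
    show "uniform_limit UNIV (\<lambda>n z. \<psi> n z * \<psi>' n z) (\<lambda>z. \<phi> z * \<omega> z) sequentially"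
      using 1 2 spectral_intD(2)[OF G] spectral_intD(2)[OF H] by (intro uniform_lim_mult) auto
    show "(\<lambda>n. S n o\<^sub>L S' n) \<longlonglongrightarrow> (G o\<^sub>L H)"
      by (intro bounded_bilinear.tendsto[OF bounded_bilinear_blinfun_compose] 1 2)
  qed
qed

text \<open>This is also where spectral integrals get their adjoints: step operators have them since
  projections are self-adjoint, and \<open>adj_pair_limit\<close> keeps them in the limit.\<close>

lemma spectral_int_adjoint:
  assumes "spectral_int E \<phi> G"
  obtains G' where "spectral_int E (\<lambda>z. cnj (\<phi> z)) G'" "adj_pair G G'"
proof -
  have step: "\<exists>S'. spectral_step E (\<lambda>z. cnj (\<psi> z)) S' \<and> adj_pair S S'"
    if "spectral_step E \<psi> S" for \<psi> S
    using that
  proof induction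
    case zero
    show ?case using spectral_step.zero by (auto intro: adj_pair_simps)
  next
    case (add \<psi> S M c)
    then obtain S' where S': "spectral_step E (\<lambda>z. cnj (\<psi> z)) S'" "adj_pair S S'" by blast
    have "(\<lambda>z. cnj (\<psi> z + c * indicator M z)) = (\<lambda>z. cnj (\<psi> z) + cnj c * indicator M z)"
      by (auto split: split_indicator)
    with spectral_step.add[OF S'(1) add(2), of "cnj c"] show ?case
      using S'(2) orth_projection_adj[OF proj[OF add(2)]] adj_pair_simps(3,6) by metis
  qed
  obtain \<psi> S where 1: "\<And>n. spectral_step E (\<psi> n) (S n)" "uniform_limit UNIV \<psi> \<phi> sequentially" "S \<longlonglongrightarrow> G"
    using step_sequence_spectral_int[OF assms] by blast
  obtain S' where S': "\<And>n. spectral_step E (\<lambda>z. cnj (\<psi> n z)) (S' n)" "\<And>n. adj_pair (S n) (S' n)"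
    using step[OF 1(1)] by metis
  obtain G' where G': "S' \<longlonglongrightarrow> G'" "adj_pair G G'" using adj_pair_limit[OF 1(3) S'(2)] by blast
  have "uniform_limit UNIV (\<lambda>n z. cnj (\<psi> n z)) (\<lambda>z. cnj (\<phi> z)) sequentially"
    using 1(2) unfolding uniform_limit_iff dist_norm complex_cnj_diff[symmetric] complex_mod_cnj .
  then have "spectral_int E (\<lambda>z. cnj (\<phi> z)) G'"
    using spectral_int_limit[OF spectral_int_step[OF S'(1)] _ G'(1)] by blast
  with G' that show thesis by blast
qed

text \<open>Dividing by \<open>\<phi>\<close> on \<open>M\<close> turns the integral of \<open>\<phi>\<close> into the projection \<open>E M\<close>.\<close>

lemma spectral_int_kernel:
  assumes Z: "spectral_int E \<phi> Z" and M: "M \<in> sets borel" and d: "0 < d"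
    and ge: "\<And>z. z \<in> M \<Longrightarrow> d \<le> cmod (\<phi> z)" and 0: "Z x = 0"
  shows "E M x = 0"
proof -
  define \<psi> where "\<psi> z = indicator M z / \<phi> z" for z
  have "bounded (range \<psi>)"
  proof (rule boundedI[of _ "inverse d"])
    show "norm y \<le> inverse d" if "y \<in> range \<psi>" for y
      using that ge d
      by (auto simp: \<psi>_def norm_divide norm_inverse divide_inverse intro!: le_imp_inverse_le
          split: split_indicator)
  qed
  moreover have "\<psi> \<in> borel_measurable borel"
    unfolding \<psi>_def using spectral_intD(1)[OF Z] M by measurable
  ultimately obtain G where G: "spectral_int E \<psi> G" using spectral_int_exists by blast
  have "\<psi> z * \<phi> z = indicator M z" for z
    using ge[of z] d by (auto simp: \<psi>_def split: split_indicator)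
  then have "spectral_int E (indicator M) (G o\<^sub>L Z)"
    using spectral_int_mult[OF G Z] by simp
  then have "G o\<^sub>L Z = E M" using spectral_int_unique spectral_int_indicator[OF M] by blast
  then show ?thesis using 0 by (metis blinfun.zero_right blinfun_apply_blinfun_compose)
qed

lemma scalar_measure_E:
  assumes M: "M \<in> sets borel"
  shows "scalar_measure E (E M x) = density (scalar_measure E x) (indicator M)"
proof (rule measure_eqI)
  fix N
  assume "N \<in> sets (scalar_measure E (E M x))"
  then have N: "N \<in> sets borel" by simp
  have "emeasure (density (scalar_measure E x) (indicator M)) N
    = (\<integral>\<^sup>+ z. indicator M z * indicator N z \<partial>scalar_measure E x)"
    using M N by (subst emeasure_density) auto
  also have "\<dots> = (\<integral>\<^sup>+ z. indicator (N \<inter> M) z \<partial>scalar_measure E x)"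
    by (intro nn_integral_cong) (auto split: split_indicator)
  also have "\<dots> = emeasure (scalar_measure E x) (N \<inter> M)"
    using M N by (subst nn_integral_indicator) auto
  also have "\<dots> = emeasure (scalar_measure E (E M x)) N"
    using M N by (simp add: emeasure_scalar_measure E_Int_apply)
  finally show "emeasure (scalar_measure E (E M x)) N = emeasure (density (scalar_measure E x) (indicator M)) N" ..
qed simp

end

section \<open>Unbounded operators with a spectral measure\<close>

lemma lin_opD:
  assumes "lin_op T"
  shows "(x, y) \<in> T \<Longrightarrow> (x', y') \<in> T \<Longrightarrow> (x + x', y + y') \<in> T"
    and "(x, y) \<in> T \<Longrightarrow> (c *\<^sub>C x, c *\<^sub>C y) \<in> T"
    and "(x, y) \<in> T \<Longrightarrow> (x, y') \<in> T \<Longrightarrow> y = y'"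
    and "(x, y) \<in> T \<Longrightarrow> (x', y') \<in> T \<Longrightarrow> (x - x', y - y') \<in> T"
proof -
  show add: "(x, y) \<in> T \<Longrightarrow> (x', y') \<in> T \<Longrightarrow> (x + x', y + y') \<in> T" for x y x' y'
    using assms by (auto simp: lin_op_def)
  show scale: "(x, y) \<in> T \<Longrightarrow> (c *\<^sub>C x, c *\<^sub>C y) \<in> T" for c x y
    using assms by (auto simp: lin_op_def)
  show "(x, y) \<in> T \<Longrightarrow> (x, y') \<in> T \<Longrightarrow> y = y'"
    using assms unfolding lin_op_def single_valued_def by blast
  show "(x, y) \<in> T \<Longrightarrow> (x', y') \<in> T \<Longrightarrow> (x - x', y - y') \<in> T"
    using add[of x y "(-1) *\<^sub>C x'" "(-1) *\<^sub>C y'"] scale[of x' y' "-1"]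
    by (simp add: scaleC.minus_left)
qed

lemma cinner_dense_eq_0:
  assumes "closure D = UNIV" "\<And>x. x \<in> D \<Longrightarrow> cinner x y = 0"
  shows "y = 0"
proof -
  have "closed {x. cinner x y = 0}"
    by (rule closed_Collect_eq) (intro continuous_intros cinner.continuous_on)+
  then have "closure D \<subseteq> {x. cinner x y = 0}"
    using assms(2) by (intro closure_minimal) auto
  then have "cinner y y = 0" using assms(1) by blast
  then show ?thesis using Re_cinner_self[of y] by simp
qed

text \<open>A common setting for the normal operators \<open>a\<close>, \<open>b\<close> and for
  their moduli: a densely defined operator with a spectral measure.\<close>

locale spectral_op = spectral E for E :: "complex set \<Rightarrow> ('h::chilbert \<Rightarrow>\<^sub>L 'h)" +
  fixes T :: "('h \<times> 'h) set"
  assumes lin: "lin_op T" and integral: "is_spectral_integral E (\<lambda>z. z) T"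
    and dense: "closure (Domain T) = UNIV"
begin

lemma Domain_iff: "x \<in> Domain T \<longleftrightarrow> (\<integral>\<^sup>+ z. ennreal ((cmod z)\<^sup>2) \<partial>scalar_measure E x) < \<infinity>"
  using integral by (auto simp: is_spectral_integral_def)

lemma form: "(x, w) \<in> T \<Longrightarrow> cinner x w = (\<integral>z. z \<partial>scalar_measure E x)"
  using integral by (auto simp: is_spectral_integral_def)

text \<open>Membership in the domain is about square integrability, whereas the quadratic form needs
  the first power; the measure is finite and
  \<open>norm z \<le> 1 + (norm z)\<^sup>2\<close>.\<close>

lemma integrable_ident:
  assumes "(x, w) \<in> T"
  shows "integrable (scalar_measure E x) (\<lambda>z. z)"
proof (rule integrableI_bounded)
  have "(\<integral>\<^sup>+ z. ennreal (norm z) \<partial>scalar_measure E x)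
    \<le> (\<integral>\<^sup>+ z. 1 + ennreal ((cmod z)\<^sup>2) \<partial>scalar_measure E x)"
  proof (intro nn_integral_mono)
    fix z :: complex
    have "0 \<le> (norm z - 1)\<^sup>2" by simp
    then have "norm z \<le> 1 + (norm z)\<^sup>2"
      using norm_ge_zero[of z] unfolding power2_diff one_power2 mult_1_right by linarith
    then have "ennreal (norm z) \<le> ennreal (1 + (cmod z)\<^sup>2)" by (rule ennreal_leI)
    then show "ennreal (norm z) \<le> 1 + ennreal ((cmod z)\<^sup>2)" by (simp add: ennreal_plus)
  qed
  also have "\<dots> = emeasure (scalar_measure E x) UNIV + (\<integral>\<^sup>+ z. ennreal ((cmod z)\<^sup>2) \<partial>scalar_measure E x)"
    by (subst nn_integral_add) auto
  also have "\<dots> < \<infinity>"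
    using assms Domain_iff[of x] by (auto simp: emeasure_scalar_measure)
  finally show "(\<integral>\<^sup>+ z. ennreal (norm z) \<partial>scalar_measure E x) < \<infinity>" .
qed simp

lemma E_Compl: "M \<in> sets borel \<Longrightarrow> E (- M) x = x - E M x"
proof -
  assume M: "M \<in> sets borel"
  then have "spectral_int E (\<lambda>z. indicator UNIV z - indicator M z) (E UNIV - E M)"
    by (intro spectral_int_diff spectral_int_indicator) auto
  moreover have "spectral_int E (indicator (- M)) (E (- M))"
    using M by (intro spectral_int_indicator) auto
  moreover have "indicator (- M) = (\<lambda>z. indicator UNIV z - indicator M z :: complex)"
    by (auto split: split_indicator)
  ultimately have "E (- M) = E UNIV - E M" using spectral_int_unique by simp
  then show "E (- M) x = x - E M x" by (simp add: E_UNIV blinfun.diff_left)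
qed

lemma integral_E:
  assumes "M \<in> sets borel" "f \<in> borel_measurable borel"
  shows "(\<integral>z. f z \<partial>scalar_measure E (E M x)) = (\<integral>z. indicator M z * (f z :: complex) \<partial>scalar_measure E x)"
proof -
  have "scalar_measure E (E M x) = density (scalar_measure E x) (\<lambda>z. ennreal (indicator M z))"
    using assms(1) by (simp add: scalar_measure_E ennreal_indicator)
  then have "(\<integral>z. f z \<partial>scalar_measure E (E M x)) = (\<integral>z. indicator M z *\<^sub>R f z \<partial>scalar_measure E x)"
    using assms by (simp add: integral_density)
  also have "\<dots> = (\<integral>z. indicator M z * f z \<partial>scalar_measure E x)"
    by (intro Bochner_Integration.integral_cong) (auto split: split_indicator)
  finally show ?thesis .
qed

lemma Domain_bounded:
  assumes M: "M \<in> sets borel" "bounded M"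
  shows "E M x \<in> Domain T"
proof -
  obtain b where b: "\<And>z. z \<in> M \<Longrightarrow> cmod z \<le> b" using M(2) by (auto simp: bounded_iff)
  have "(\<integral>\<^sup>+ z. ennreal ((cmod z)\<^sup>2) \<partial>scalar_measure E (E M x))
    = (\<integral>\<^sup>+ z. indicator M z * ennreal ((cmod z)\<^sup>2) \<partial>scalar_measure E x)"
    using M(1) by (simp add: scalar_measure_E nn_integral_density)
  also have "\<dots> \<le> (\<integral>\<^sup>+ z. ennreal (b\<^sup>2) \<partial>scalar_measure E x)"
    using b by (intro nn_integral_mono) (auto split: split_indicator intro!: ennreal_leI power_mono)
  also have "\<dots> < \<infinity>"
    by (simp add: emeasure_scalar_measure ennreal_mult_less_top)
  finally show ?thesis by (simp add: Domain_iff)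
qed

text \<open>The quadratic form splits along \<open>E M\<close> and its complement, so by polarization the cross
  terms vanish.\<close>

lemma cross_terms:
  assumes M: "M \<in> sets borel" and 1: "(s, w) \<in> T" "E M s = s" and 2: "(t, w') \<in> T" "E M t = 0"
  shows "cinner s w' = 0" "cinner t w = 0"
proof -
  have sum: "cinner s w' + cinner t' w = 0"
    if "(s, w) \<in> T" "(t', w') \<in> T" "E M s = s" "E M t' = 0" for s w t' w'
  proof -
    have st: "(s + t', w + w') \<in> T" using lin_opD(1)[OF lin] that by blast
    have e: "E M (s + t') = s" "E (- M) (s + t') = t'"
      using that by (simp_all add: blinfun.add_right E_Compl[OF M])
    have i: "integrable (scalar_measure E (s + t')) (\<lambda>z. indicator N z * z)" if "N \<in> sets borel" for N
    proof -
      have "integrable (scalar_measure E (s + t')) (\<lambda>z. indicator N z *\<^sub>R z)"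
        by (rule integrable_mult_indicator) (use that integrable_ident[OF st] in auto)
      moreover have "(\<lambda>z. indicator N z *\<^sub>R z) = (\<lambda>z. indicator N z * (z :: complex))"
        by (auto split: split_indicator)
      ultimately show ?thesis by simp
    qed
    have "(\<integral>z. z \<partial>scalar_measure E (s + t'))
        = (\<integral>z. indicator M z * z + indicator (- M) z * z \<partial>scalar_measure E (s + t'))"
      by (intro Bochner_Integration.integral_cong) (auto split: split_indicator)
    also have "\<dots> = (\<integral>z. z \<partial>scalar_measure E s) + (\<integral>z. z \<partial>scalar_measure E t')"
      using M i[of M] i[of "- M"] integral_E[of M "\<lambda>z. z" "s + t'"] integral_E[of "- M" "\<lambda>z. z" "s + t'"]
      unfolding e by simp
    finally have "cinner (s + t') (w + w') = cinner s w + cinner t' w'"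
      using form st that(1,2) by simp
    then show ?thesis by (simp add: cinner_add_left cinner_add_right add.commute)
  qed
  have "cinner s w' + cinner t w = 0" by (rule sum) (use assms in auto)
  \<comment> \<open>Replacing \<open>t\<close> by \<open>\<i> *\<^sub>C t\<close> turns the
    vanishing sum into a vanishing difference.\<close>
  moreover have "cinner s (\<i> *\<^sub>C w') + cinner (\<i> *\<^sub>C t) w = 0"
    by (rule sum) (use assms lin_opD(2)[OF lin 2(1)] bclinearD[OF orth_projection_bclinear[OF proj[OF M]]] in
        \<open>auto simp: scaleC.zero_right\<close>)
  then have "\<i> * (cinner s w' - cinner t w) = 0"
    by (simp add: cinner_scaleC_left cinner_scaleC_right algebra_simps)
  ultimately show "cinner s w' = 0" "cinner t w = 0" by auto
qed

text \<open>That \<open>T\<close> commutes with \<open>E M\<close> is no part of the definition of a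
  spectral integral; it follows from the vanishing cross terms. Tested against a dense set, they say
  that \<open>E M\<close> kills the image of \<open>s - E M s\<close> and fixes the image of
  \<open>E M s\<close>.\<close>

lemma reduces:
  assumes M: "M \<in> sets borel" "bounded M" and sw: "(s, w) \<in> T"
  shows "(E M s, E M w) \<in> T"
proof -
  note adj = adj_pairD[OF orth_projection_adj[OF proj[OF M(1)]]]
  note idem = orth_projection_idem[OF proj[OF M(1)]]
  obtain w1 where w1: "(E M s, w1) \<in> T" using Domain_bounded[OF M] by blast
  have w2: "(s - E M s, w - w1) \<in> T" using lin_opD(4)[OF lin sw w1] .
  have s2: "E M (s - E M s) = 0" by (simp add: blinfun.diff_right idem)
  have "E M (w - w1) = 0"
  proof (rule cinner_dense_eq_0[OF dense])
    fix t assume "t \<in> Domain T"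
    obtain t1 where "(E M t, t1) \<in> T" using Domain_bounded[OF M] by blast
    from cross_terms(1)[OF M(1) this idem w2 s2] show "cinner t (E M (w - w1)) = 0"
      by (simp add: adj)
  qed
  moreover have "w1 - E M w1 = 0"
  proof (rule cinner_dense_eq_0[OF dense])
    fix t assume "t \<in> Domain T"
    then obtain t' where t': "(t, t') \<in> T" by blast
    obtain t1 where t1: "(E M t, t1) \<in> T" using Domain_bounded[OF M] by blast
    have "E M (t - E M t) = 0" by (simp add: blinfun.diff_right idem)
    from cross_terms(2)[OF M(1) w1 idem lin_opD(4)[OF lin t' t1] this]
    show "cinner t (w1 - E M w1) = 0"
      by (simp add: adj cinner.diff_left cinner.diff_right)
  qed
  ultimately have "E M w = w1" by (simp add: blinfun.diff_right)
  with w1 show ?thesis by simp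
qed

lemma restriction_absorb:
  assumes M: "M \<in> sets borel" and B: "spectral_int E (\<lambda>z. indicator M z * \<phi> z) B"
  shows "E M o\<^sub>L B = B" "B o\<^sub>L E M = B"
proof -
  have eq: "(\<lambda>z. indicator M z * (indicator M z * \<phi> z)) = (\<lambda>z. indicator M z * \<phi> z)"
    "(\<lambda>z. (indicator M z * \<phi> z) * indicator M z) = (\<lambda>z. indicator M z * \<phi> z)"
    by (auto split: split_indicator)
  have "spectral_int E (\<lambda>z. indicator M z * \<phi> z) (E M o\<^sub>L B)"
    using spectral_int_mult[OF spectral_int_indicator[OF M] B] unfolding eq .
  then show "E M o\<^sub>L B = B" using B by (rule spectral_int_unique)
  have "spectral_int E (\<lambda>z. indicator M z * \<phi> z) (B o\<^sub>L E M)"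
    using spectral_int_mult[OF B spectral_int_indicator[OF M]] unfolding eq .
  then show "B o\<^sub>L E M = B" using B by (rule spectral_int_unique)
qed

text \<open>On the range of \<open>E M\<close> the quadratic forms of \<open>T\<close> and of the
  bounded operator \<open>B\<close> agree. Let \<open>d\<close> be the difference of their values at
  \<open>s\<close>. It lies in the range of \<open>E M\<close>, hence in the domain, so the forms
  may be compared at \<open>s + d\<close> and \<open>s + \<i> *\<^sub>C d\<close>; this yields
  \<open>cinner d d = 0\<close>.\<close>

lemma restriction:
  assumes M: "M \<in> sets borel" "bounded M" and B: "spectral_int E (\<lambda>z. indicator M z * z) B"
    and s: "E M s = s"
  shows "(s, B s) \<in> T"
proof -
  note idem = orth_projection_idem[OF proj[OF M(1)]]
  have "E M o\<^sub>L B = B" by (rule restriction_absorb[OF M(1) B])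
  then have EB: "E M (B x) = B x" for x by (metis blinfun_apply_blinfun_compose)
  have form0: "cinner t (w - B t) = 0" if "(t, w) \<in> T" "E M t = t" for t w
  proof -
    have "cinner t w = (\<integral>z. indicator M z * z \<partial>scalar_measure E t)"
      using form[OF that(1)] integral_E[OF M(1), of "\<lambda>z. z" t] that(2) by simp
    then show ?thesis using spectral_intD(4)[OF B, of t] by (simp add: cinner.diff_right)
  qed
  have Dom: "t \<in> Domain T" if "E M t = t" for t
    using Domain_bounded[OF M, of t] unfolding that .
  obtain w where w: "(s, w) \<in> T" using Dom[OF s] by blast
  have Ew: "E M w = w" by (rule lin_opD(3)[OF lin w reduces[OF M w, unfolded s], symmetric])
  define d where "d = w - B s"
  have Ed: "E M d = d" by (simp add: d_def blinfun.diff_right Ew EB)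
  obtain d' where d': "(d, d') \<in> T" using Dom[OF Ed] by blast
  note Blin = bclinearD[OF spectral_intD(3)[OF B]]
  note Elin = bclinearD[OF orth_projection_bclinear[OF proj[OF M(1)]]]
  have "cinner (s + d) ((w + d') - B (s + d)) = 0"
    by (rule form0[OF lin_opD(1)[OF lin w d']]) (simp add: blinfun.add_right s Ed)
  then have 1: "cinner s (d' - B d) + cinner d d = 0"
    using form0[OF w s] form0[OF d' Ed]
    by (simp add: d_def[symmetric] blinfun.add_right cinner_add_left cinner_add_right add_diff_add
        add.commute)
  have "cinner (s + \<i> *\<^sub>C d) ((w + \<i> *\<^sub>C d') - B (s + \<i> *\<^sub>C d)) = 0"
    by (rule form0[OF lin_opD(1)[OF lin w lin_opD(2)[OF lin d']]]) (simp add: blinfun.add_right s Ed Elin)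
  then have "cinner s (\<i> *\<^sub>C (d' - B d)) + cinner (\<i> *\<^sub>C d) d = 0"
    using form0[OF w s] form0[OF d' Ed]
    by (simp add: d_def[symmetric] blinfun.add_right cinner_add_left cinner_add_right add_diff_add Blin
        scaleC.diff_right[symmetric] cinner_scaleC_left cinner_scaleC_right)
  then have "\<i> * (cinner s (d' - B d) - cinner d d) = 0"
    by (simp add: cinner_scaleC_left cinner_scaleC_right algebra_simps)
  with 1 have "cinner d d = 0" by auto
  then have "d = 0" using Re_cinner_self[of d] by simp
  with w show ?thesis by (simp add: d_def)
qed

lemma restriction_exists:
  assumes "M \<in> sets borel" "bounded M"
  shows "\<exists>B. spectral_int E (\<lambda>z. indicator M z * z) B"
proof (rule spectral_int_exists)
  obtain b where b: "0 < b" "\<forall>z\<in>M. cmod z \<le> b"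
    using assms(2) unfolding bounded_pos by blast
  show "bounded (range (\<lambda>z. indicator M z * z))"
  proof (rule boundedI[of _ b])
    show "norm y \<le> b" if "y \<in> range (\<lambda>z. indicator M z * z)" for y
      using that b by (auto split: split_indicator_asm)
  qed
  show "(\<lambda>z. indicator M z * z) \<in> borel_measurable borel"
    using assms(1) by (intro borel_measurable_times borel_measurable_indicator) auto
qed

lemma restriction_eq:
  assumes M: "M \<in> sets borel" "bounded M" and B: "spectral_int E (\<lambda>z. indicator M z * z) B"
    and sw: "(s, w) \<in> T"
  shows "E M w = B (E M s)"
  using lin_opD(3)[OF lin reduces[OF M sw] restriction[OF M B]]
  by (simp add: orth_projection_idem[OF proj[OF M(1)]])

text \<open>A vector is concentrated on the zero set of \<open>f\<close> once it is killed by every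
  band on which \<open>f\<close> is bounded below. The bands are cut down to discs so that
  \<open>T\<close> is bounded on each of them.\<close>

lemma E_zero_set:
  fixes f :: "complex \<Rightarrow> real"
  assumes cont: "continuous_on UNIV f" and nonneg: "\<And>z. 0 \<le> f z"
    and M: "\<And>n. E ({z. inverse (real (Suc n)) \<le> f z} \<inter> cball 0 (real n)) y = 0"
  shows "E {z. f z = 0} y = y"
proof -
  define M where "M n = {z. inverse (real (Suc n)) \<le> f z} \<inter> cball 0 (real n)" for n
  have Mb: "M n \<in> sets borel" for n
    unfolding M_def by (auto intro!: borel_closed closed_Int closed_Collect_le continuous_intros cont)
  have "- {z. f z = 0} = (\<Union>n. M n)"
  proof (intro set_eqI iffI)
    fix z assume "z \<in> - {z. f z = 0}"
    then have "0 < f z" using nonneg[of z] by simp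
    then obtain n1 where n1: "inverse (real (Suc n1)) < f z" using reals_Archimedean by blast
    obtain n2 where n2: "cmod z \<le> real n2" using real_arch_simple by blast
    have "inverse (real (Suc (max n1 n2))) \<le> inverse (real (Suc n1))"
      by (intro le_imp_inverse_le) auto
    then have "inverse (real (Suc (max n1 n2))) \<le> f z" using n1 by linarith
    moreover have "cmod z \<le> real (max n1 n2)" using n2 by linarith
    ultimately have "z \<in> M (max n1 n2)" by (simp add: M_def)
    then show "z \<in> (\<Union>n. M n)" by blast
  next
    fix z assume "z \<in> (\<Union>n. M n)"
    then obtain n where n: "inverse (real (Suc n)) \<le> f z" by (auto simp: M_def)
    moreover have "0 < inverse (real (Suc n))" by simp
    ultimately have "0 < f z" by (rule less_le_trans[rotated])
    then show "z \<in> - {z. f z = 0}" by auto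
  qed
  moreover have "E (\<Union>n. M n) y = 0" by (rule E_UN_null) (use M Mb in \<open>auto simp: M_def\<close>)
  moreover have "{z. f z = 0} \<in> sets borel"
    by (intro borel_closed closed_Collect_eq cont continuous_intros)
  ultimately show ?thesis using E_Compl[of "{z. f z = 0}" y] by simp
qed

lemma bounded_band:
  fixes f :: "complex \<Rightarrow> real"
  assumes "continuous_on UNIV f"
  shows "{z. e \<le> f z} \<inter> cball 0 b \<in> sets borel" "bounded ({z. e \<le> f z} \<inter> cball 0 b)"
  by (auto intro!: borel_closed closed_Int closed_Collect_le continuous_intros assms
      bounded_subset[OF bounded_cball])

text \<open>The left side does not mention \<open>E\<close>, so the projections onto single points
  depend on \<open>T\<close> alone. From left to right, \<open>T - l\<close> is bounded below on
  every band away from \<open>l\<close>, so such bands contribute nothing to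
  \<open>y\<close>.\<close>

lemma eigenvector_iff: "(y, l *\<^sub>C y) \<in> T \<longleftrightarrow> E {l} y = y"
proof
  assume "E {l} y = y"
  obtain B where B: "spectral_int E (\<lambda>z. indicator {l} z * z) B"
    using restriction_exists[of "{l}"] by auto
  have "(\<lambda>z. indicator {l} z * z) = (\<lambda>z. l * indicator {l} z)"
    by (auto split: split_indicator)
  then have "spectral_int E (\<lambda>z. indicator {l} z * z) (cscale l (E {l}))"
    using spectral_int_cscale[OF spectral_int_indicator[of "{l}"], of l] by simp
  with B have "B = cscale l (E {l})" by (rule spectral_int_unique)
  then have "B y = l *\<^sub>C y" using \<open>E {l} y = y\<close> by (simp add: cscale.rep_eq)
  with restriction[OF _ _ B \<open>E {l} y = y\<close>] show "(y, l *\<^sub>C y) \<in> T" by simp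
next
  assume y: "(y, l *\<^sub>C y) \<in> T"
  define f where "f z = cmod (z - l)" for z
  have f: "continuous_on UNIV f" unfolding f_def by (intro continuous_intros)
  have "E {z. f z = 0} y = y"
  proof (rule E_zero_set[OF f])
    fix n
    define M where "M = {z. inverse (real (Suc n)) \<le> f z} \<inter> cball 0 (real n)"
    have Mb: "M \<in> sets borel" "bounded M" unfolding M_def by (rule bounded_band[OF f])+
    obtain B where B: "spectral_int E (\<lambda>z. indicator M z * z) B"
      using restriction_exists[OF Mb] by blast
    have "E M (E M y) = 0"
    proof (rule spectral_int_kernel)
      show "spectral_int E (\<lambda>z. indicator M z * z - l * indicator M z) (B - cscale l (E M))"
        by (intro spectral_int_diff spectral_int_cscale spectral_int_indicator B Mb)
      show "(B - cscale l (E M)) (E M y) = 0"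
        using restriction_eq[OF Mb B y]
        by (simp add: blinfun.diff_left cscale.rep_eq orth_projection_idem[OF proj[OF Mb(1)]]
            bclinearD[OF orth_projection_bclinear[OF proj[OF Mb(1)]]])
      show "inverse (real (Suc n)) \<le> cmod (indicator M z * z - l * indicator M z)" if "z \<in> M" for z
        using that by (simp add: M_def f_def)
    qed (use Mb in auto)
    then have "E M y = 0" by (simp add: orth_projection_idem[OF proj[OF Mb(1)]])
    then show "E ({z. inverse (real (Suc n)) \<le> f z} \<inter> cball 0 (real n)) y = 0"
      unfolding M_def .
  qed (simp add: f_def)
  moreover have "{z. f z = 0} = {l}" by (auto simp: f_def)
  ultimately show "E {l} y = y" by simp
qed

text \<open>On the range of \<open>E (ball z0 e)\<close> the operator \<open>T - z0\<close> has norm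
  at most \<open>2 * e\<close>, yet the resolvent \<open>R\<close> inverts it. For small
  \<open>e\<close> only the zero vector survives.\<close>

lemma E_resolvent_ball:
  assumes "z0 \<notin> op_spectrum T"
  shows "\<exists>e>0. E (ball z0 e) = 0"
proof -
  obtain R where R: "{(y - z0 *\<^sub>C x, x) |x y. (x, y) \<in> T} = graph R"
    using assms by (auto simp: op_spectrum_def)
  define k where "k = norm R + 1"
  \<comment> \<open>One quarter: the factor 2 of the bound \<open>nZ\<close> and one more factor 2
    make the final estimate \<open>norm y \<le> norm y / 2\<close>.\<close>
  define e where "e = inverse k / 4"
  have k: "0 < k" "norm R \<le> k" by (simp_all add: k_def add_nonneg_pos)
  then have e: "0 < e" by (simp add: e_def)
  have Mb: "ball z0 e \<in> sets borel" "bounded (ball z0 e)" by auto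
  obtain B where B: "spectral_int E (\<lambda>z. indicator (ball z0 e) z * z) B"
    using restriction_exists[OF Mb] by blast
  define Z where "Z = B - cscale z0 (E (ball z0 e))"
  have Z: "spectral_int E (\<lambda>z. indicator (ball z0 e) z * z - z0 * indicator (ball z0 e) z) Z"
    unfolding Z_def by (intro spectral_int_diff spectral_int_cscale spectral_int_indicator B Mb)
  have nZ: "norm Z \<le> 2 * e"
    by (rule spectral_int_norm_le[OF Z _ _ E_empty])
       (use e in \<open>auto simp: dist_norm norm_minus_commute split: split_indicator\<close>)
  have "E (ball z0 e) x = 0" for x
  proof -
    define y where "y = E (ball z0 e) x"
    have y: "E (ball z0 e) y = y" by (simp add: y_def orth_projection_idem[OF proj[OF Mb(1)]])
    have "(B y - z0 *\<^sub>C y, y) \<in> graph R"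
      using restriction[OF Mb B y] R by blast
    then have "R (Z y) = y" by (simp add: graph_def Z_def y blinfun.diff_left cscale.rep_eq)
    then have "norm y \<le> norm R * norm (Z y)" by (metis norm_blinfun)
    also have "\<dots> \<le> norm R * (2 * e * norm y)"
      by (intro mult_left_mono order_trans[OF norm_blinfun] mult_right_mono nZ) auto
    also have "\<dots> = (norm R / k) * norm y / 2"
      using k(1) by (simp add: e_def field_simps)
    also have "\<dots> \<le> 1 * norm y / 2"
      using k by (intro divide_right_mono mult_right_mono) auto
    finally show ?thesis by (simp add: y_def)
  qed
  then have "E (ball z0 e) = 0" by (intro blinfun_eqI) simp
  with e show ?thesis by blast
qed

text \<open>The complement of \<open>S\<close> is covered by null balls, and Lindelof makes the
  cover countable, as \<open>E_UN_null\<close> requires.\<close>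

lemma E_off_spectrum:
  assumes "closed S" "op_spectrum T \<subseteq> S"
  shows "E (- S) = 0"
proof -
  have "\<exists>e>0. E (ball z e) = 0" if "z \<in> - S" for z
    using E_resolvent_ball that assms(2) by blast
  then obtain e where e: "\<And>z. z \<in> - S \<Longrightarrow> 0 < e z \<and> E (ball z (e z)) = 0" by metis
  define F where "F = (\<lambda>z. ball z (e z)) ` (- S)"
  obtain F' where F': "F' \<subseteq> F" "countable F'" "\<Union> F' = \<Union> F"
    using Lindelof[of F] unfolding F_def by auto
  have "- S \<subseteq> \<Union> F" using e by (force simp: F_def)
  have S: "- S \<in> sets borel" using assms(1) by auto
  have "E (\<Union>N\<in>F'. N) x = 0" for x
    by (rule E_UN_null) (use F' e in \<open>auto simp: F_def\<close>)
  moreover have "(\<Union>N\<in>F'. N) = \<Union> F" using F'(3) by simp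
  ultimately have 0: "E (\<Union> F) x = 0" for x by simp
  have "\<Union> F \<in> sets borel" by (rule borel_open) (auto simp: F_def)
  then have "E (- S) (E (\<Union> F) x) = E (- S) x" for x
    using E_Int_apply[OF S] \<open>- S \<subseteq> \<Union> F\<close> by (simp add: Int_absorb2)
  then show ?thesis by (intro blinfun_eqI) (simp add: 0)
qed

end

section \<open>Polar decompositions with discrete modulus\<close>

locale resolution =
  fixes R :: "int \<Rightarrow> ('h::chilbert \<Rightarrow>\<^sub>L 'h)"
  assumes proj: "\<And>n. orth_projection (R n)"
    and orth: "\<And>m n x. m \<noteq> n \<Longrightarrow> R m (R n x) = 0"
    and sums: "\<And>x. (\<lambda>i. R (int_decode i) x) sums x"
begin

lemma idem: "R n (R n x) = R n x"
  by (rule orth_projection_idem[OF proj])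

lemma R_R: "R m (R n x) = (if m = n then R n x else 0)"
  using orth idem by auto

lemma adj: "cinner (R n x) y = cinner x (R n y)"
  by (rule adj_pairD[OF orth_projection_adj[OF proj]])

lemma lin: "R n (c *\<^sub>C x) = c *\<^sub>C R n x"
  by (rule bclinearD[OF orth_projection_bclinear[OF proj]])

lemma eqI:
  fixes X Y :: "'h \<Rightarrow>\<^sub>L 'h"
  assumes "\<And>n x. X (R n x) = Y (R n x)"
  shows "X = Y"
proof (rule blinfun_eqI)
  fix x
  have "(\<lambda>i. X (R (int_decode i) x)) sums X x" "(\<lambda>i. Y (R (int_decode i) x)) sums Y x"
    by (intro bounded_linear.sums[OF blinfun.bounded_linear_right] sums)+
  then show "X x = Y x" unfolding assms by (rule sums_unique2)
qed

lemma fixedI: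
  assumes "\<And>k. k \<noteq> n \<Longrightarrow> R k x = 0"
  shows "R n x = x"
proof -
  have "(\<lambda>i. R (int_decode i) x) = (\<lambda>i. if i = int_encode n then R (int_decode i) x else 0)"
    using assms by (auto simp: fun_eq_iff) (metis int_decode_inverse)
  then have "(\<lambda>i. R (int_decode i) x) sums R (int_decode (int_encode n)) x"
    using sums_single[of "int_encode n" "\<lambda>i. R (int_decode i) x"] by simp
  then show ?thesis using sums[of x] by (metis int_encode_inverse sums_unique2)
qed

lemma parseval: "(\<integral>\<^sup>+n. ennreal ((norm (R n x))\<^sup>2) \<partial>count_space UNIV) = ennreal ((norm x)\<^sup>2)"
proof -
  have "(\<lambda>i. cinner x (R (int_decode i) x)) sums cinner x x"
    by (rule bounded_linear.sums[OF cinner.bounded_linear_right sums])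
  then have "(\<lambda>i. Re (cinner x (R (int_decode i) x))) sums Re (cinner x x)"
    by (rule sums_Re)
  then have "(\<lambda>i. (norm (R (int_decode i) x))\<^sup>2) sums (norm x)\<^sup>2"
    by (simp only: orth_projection_cinner[OF proj] Re_complex_of_real Re_cinner_self)
  then have "(\<Sum>i. ennreal ((norm (R (int_decode i) x))\<^sup>2)) = ennreal ((norm x)\<^sup>2)"
    by (intro suminf_ennreal_eq) auto
  then show ?thesis
    using nn_integral_bij_count_space[OF bij_int_decode, of "\<lambda>n. ennreal ((norm (R n x))\<^sup>2)"]
    by (simp add: nn_integral_count_space_nat)
qed

text \<open>The assumption for all indices at once is what counts: the other components
  \<open>R k x\<close> are sent to ranges orthogonal to that of \<open>R (n + d)\<close>, so both
  sides vanish on them.\<close>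

lemma intertwineI:
  fixes X :: "'h \<Rightarrow>\<^sub>L 'h"
  assumes "\<And>n x. R (n + d) (X (R n x)) = X (R n x)"
  shows "X o\<^sub>L R n = R (n + d) o\<^sub>L X"
proof (rule eqI)
  fix k x
  show "(X o\<^sub>L R n) (R k x) = (R (n + d) o\<^sub>L X) (R k x)"
    using R_R[of "n + d" "k + d" "X (R k x)"] assms[of k x] by (simp add: R_R split: if_splits)
qed

end

lemma adjoint_op_iff: "(x, y) \<in> adjoint_op T \<longleftrightarrow> (\<forall>s t. (s, t) \<in> T \<longrightarrow> cinner t x = cinner s y)"
  by (simp add: adjoint_op_def)

lemma adjoint_op_scale: "(x, y) \<in> adjoint_op T \<Longrightarrow> (c *\<^sub>C x, c *\<^sub>C y) \<in> adjoint_op T"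
  by (simp add: adjoint_op_iff cinner_scaleC_right)

interpretation cs: vector_space "cscale :: complex \<Rightarrow> ('h::chilbert \<Rightarrow>\<^sub>L 'h) \<Rightarrow> _"
  by unfold_locales (simp_all add: cscale.add_left cscale.add_right cscale_cscale)

lemma cspan_eq_span: "cspan S = cs.span S"
  by (simp add: cspan_def cs.span_explicit)

section \<open>Powers of \<open>q\<close> and the circles that make up
  \<open>q_Gamma\<close>\<close>

lemma q_powi_less:
  fixes q :: real
  assumes "0 < q" "q < 1" "m < n"
  shows "q powi n < q powi m"
  using assms by (simp add: power_int_strict_decreasing)

lemma q_powi_inj: "0 < q \<Longrightarrow> q < (1::real) \<Longrightarrow> q powi m = q powi n \<longleftrightarrow> m = n"
  using q_powi_less[of q m n] q_powi_less[of q n m] by (metis less_irrefl linorder_neqE)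

text \<open>The logarithm to base \<open>q\<close> carries the powers to the closed set of integers,
  so within the positive reals they are closed; the accumulation point 0 is added.\<close>

lemma closed_q_powers:
  assumes q: "0 < q" "q < 1"
  shows "closed (q_powers q \<union> {0})"
proof -
  define f where "f x = ln x / ln q" for x
  have lnq: "ln q < 0" using q by simp
  have ln_q: "ln (q powi j) = of_int j * ln q" for j
    using q by (simp add: powr_real_of_int'[symmetric] ln_powr)
  have pw: "x \<in> q_powers q \<longleftrightarrow> f x \<in> \<int>" if "0 < x" for x
  proof
    assume "x \<in> q_powers q"
    then obtain j where "x = q powi j" by (auto simp: q_powers_def)
    then have "f x = of_int j" using lnq by (simp add: f_def ln_q)
    then show "f x \<in> \<int>" by simp
  next
    assume "f x \<in> \<int>"
    then obtain j where "f x = of_int j" by (auto elim: Ints_cases)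
    then have "ln x = ln (q powi j)" using lnq by (simp add: f_def ln_q field_simps)
    then have "x = q powi j" using that q by simp
    then show "x \<in> q_powers q" by (auto simp: q_powers_def)
  qed
  have pos: "0 < x" if "x \<in> q_powers q" for x using that q by (auto simp: q_powers_def)
  have "- (q_powers q \<union> {0}) = {..<0} \<union> ({0<..} \<inter> f -` (- \<int>))"
    using pw pos by (auto simp: not_less) (metis linorder_neqE_linordered_idom not_less_iff_gr_or_eq)
  moreover have "open ({0<..} \<inter> f -` (- \<int>))"
  proof (rule continuous_open_preimage)
    show "continuous_on {0<..} f" unfolding f_def using lnq by (intro continuous_intros) auto
    show "open (- \<int> :: real set)" using closed_Ints by (simp add: open_closed)
  qed simp
  ultimately show ?thesis by (simp add: closed_def open_Un)
qed

definition q_circle :: "real \<Rightarrow> int \<Rightarrow> complex set" where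
  "q_circle q n = sphere 0 (q powi n)"

lemma q_circle_iff: "z \<in> q_circle q n \<longleftrightarrow> cmod z = q powi n"
  by (simp add: q_circle_def)

lemma q_circle_borel [simp, measurable]: "q_circle q n \<in> sets borel"
  by (simp add: q_circle_def)

lemma q_Gamma_eq: "0 < q \<Longrightarrow> q_Gamma q = (\<Union>n. q_circle q n)"
proof (intro set_eqI iffI)
  fix z assume q: "0 < q" and "z \<in> q_Gamma q"
  then show "z \<in> (\<Union>n. q_circle q n)" by (auto simp: q_Gamma_def q_circle_iff norm_mult simp del: of_real_power_int)
next
  fix z assume q: "0 < q" and "z \<in> (\<Union>n. q_circle q n)"
  then obtain n where n: "cmod z = q powi n" by (auto simp: q_circle_iff)
  have p: "q powi n > 0" using q by simp
  then have "z = (z / complex_of_real (q powi n)) * complex_of_real (q powi n)"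
    "cmod (z / complex_of_real (q powi n)) = 1"
    using n by (simp_all add: norm_divide norm_power_int del: of_real_power_int) (use p q in auto)
  then show "z \<in> q_Gamma q" unfolding q_Gamma_def by blast
qed

text \<open>Instantiated once for \<open>a\<close> and once for \<open>b\<close>; \<open>F\<close>
  is a chosen spectral measure of the modulus \<open>P\<close>.\<close>

locale polar_system =
  fixes q :: real and T :: "('h::chilbert \<times> 'h) set" and U :: "'h \<Rightarrow>\<^sub>L 'h"
    and P :: "('h \<times> 'h) set" and F :: "complex set \<Rightarrow> ('h \<Rightarrow>\<^sub>L 'h)"
  assumes q: "0 < q" "q < 1" and normal: "normal_op T" and kernel: "trivial_kernel T"
    and polar: "polar_decomposition T U P"
    and spectrum: "op_spectrum P \<subseteq> complex_of_real ` (q_powers q \<union> {0})"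
    and F: "spectral_measure_of P F"
begin

definition pt :: "int \<Rightarrow> complex" where "pt n = complex_of_real (q powi n)"

definition R :: "int \<Rightarrow> ('h \<Rightarrow>\<^sub>L 'h)" where "R n = F {pt n}"

text \<open>Since \<open>q < 1\<close>, large exponents mean small values: this is the spectral
  projection of the modulus for values up to \<open>q powi N\<close>. Such projections carry the
  functions with a nonzero limit at 0.\<close>

definition Q :: "int \<Rightarrow> ('h \<Rightarrow>\<^sub>L 'h)" where "Q N = F (pt ` {N..})"

lemma U: "unitary_op U" and P: "pos_selfadjoint P" and PP: "P \<odot> P = adjoint_op T \<odot> T"
  and T_eq: "T = graph U \<odot> P"
  using polar by (auto simp: polar_decomposition_def is_modulus_def)

sublocale F: spectral_op F P
  using F P by unfold_locales (auto simp: spectral_measure_of_def pos_selfadjoint_def)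

lemma pt_inj: "pt m = pt n \<longleftrightarrow> m = n"
  using q_powi_inj[OF q] by (simp add: pt_def del: of_real_power_int)

lemma pt_nonzero: "pt n \<noteq> 0"
  using q by (simp add: pt_def)

lemma cmod_pt: "cmod (pt n) = q powi n"
  using q by (simp add: pt_def del: of_real_power_int)

text \<open>A vector at the spectral value 0 lies in the kernel of \<open>P\<close>, hence of
  \<open>T\<close>.\<close>

lemma F_zero: "F {0} x = 0"
proof -
  let ?y = "F {0} x"
  have "(?y, 0 *\<^sub>C ?y) \<in> P"
    unfolding F.eigenvector_iff by (simp add: F.E_Int_apply)
  then have "(?y, 0) \<in> T"
    by (auto simp: T_eq op_mult_def graph_def relcomp_unfold)
  then show ?thesis using kernel by (simp add: trivial_kernel_def)
qed

lemma pt_image_borel: "pt ` I \<in> sets borel"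
  by (rule sets.countable) auto

lemma R_total: "F (range pt) x = x"
proof -
  let ?S = "complex_of_real ` (q_powers q \<union> {0})"
  have S: "?S = insert 0 (range pt)"
    by (auto simp: q_powers_def pt_def)
  have "closed ?S"
  proof -
    have "?S = {z. Im z = 0} \<inter> Re -` (q_powers q \<union> {0})"
      by (auto simp: complex_eq_iff image_iff intro!: bexI[of _ "Re _"])
    moreover have "closed (Re -` (q_powers q \<union> {0}))"
      by (intro closed_vimage closed_q_powers q continuous_on_Re continuous_on_id)
    moreover have "closed {z. Im z = 0}"
      by (intro closed_Collect_eq continuous_intros)
    ultimately show ?thesis by (simp add: closed_Int)
  qed
  then have "F (- ?S) = 0" by (rule F.E_off_spectrum[OF _ spectrum])
  then have "F (\<Union>M\<in>{- ?S, {0}}. M) x = 0"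
    using \<open>closed ?S\<close> by (intro F.E_UN_null) (auto simp: F_zero)
  moreover have "(\<Union>M\<in>{- ?S, {0}}. M) = - range pt"
    unfolding S using pt_nonzero by auto
  ultimately show ?thesis using F.E_Compl[OF pt_image_borel, of UNIV x] by simp
qed

sublocale R: resolution R
proof
  show "orth_projection (R n)" for n by (simp add: R_def F.proj)
  show "R m (R n x) = 0" if "m \<noteq> n" for m n x
    using that pt_inj[of m n] by (simp add: R_def F.E_Int_apply F.E_empty)
  show "(\<lambda>i. R (int_decode i) x) sums x" for x
  proof -
    have "disjoint_family (\<lambda>i. {pt (int_decode i)})"
      by (auto simp: disjoint_family_on_def pt_inj) (metis int_decode_inverse)
    then have "(\<lambda>i. F {pt (int_decode i)} x) sums F (\<Union>i. {pt (int_decode i)}) x"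
      by (intro F.E_sums) auto
    moreover have "(\<Union>i. {pt (int_decode i)}) = range pt"
      by (auto simp: image_iff) (metis int_encode_inverse)
    ultimately show ?thesis by (simp add: R_total R_def)
  qed
qed

lemma R_fixed_iff: "R n x = x \<longleftrightarrow> (x, pt n *\<^sub>C x) \<in> P"
  by (simp add: F.eigenvector_iff R_def)

text \<open>\<open>is_joint_fcalc\<close> quantifies over its own spectral measures, so the
  projections must not depend on the choice of \<open>F\<close>. They do not, because eigenvectors
  determine them.\<close>

lemma R_unique:
  assumes "spectral_measure_of P F'"
  shows "F' {pt n} = R n"
proof -
  interpret F': polar_system q T U P F'
    by unfold_locales (use q normal kernel polar spectrum assms in auto)
  show ?thesis unfolding R_def
    by (rule orth_projection_eqI)
       (simp_all add: F.proj F'.F.proj F.eigenvector_iff[symmetric] F'.F.eigenvector_iff[symmetric])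
qed

lemma Q_proj: "orth_projection (Q N)"
  by (simp add: Q_def F.proj pt_image_borel)

lemma F_image_R: "F (pt ` I) (R n x) = (if n \<in> I then R n x else 0)"
proof -
  have "F (pt ` I) (R n x) = F (pt ` I \<inter> {pt n}) x"
    by (simp add: R_def F.E_Int_apply pt_image_borel)
  also have "pt ` I \<inter> {pt n} = (if n \<in> I then {pt n} else {})"
    by (auto simp: pt_inj)
  finally show ?thesis by (simp add: R_def F.E_empty)
qed

lemma Q_R: "Q N (R n x) = (if N \<le> n then R n x else 0)"
  by (simp add: Q_def F_image_R)

lemma R_P:
  assumes "(x, w) \<in> P"
  shows "R k w = pt k *\<^sub>C R k x"
proof -
  have "(R k x, R k w) \<in> P" unfolding R_def by (rule F.reduces[OF _ _ assms]) auto
  moreover have "(R k x, pt k *\<^sub>C R k x) \<in> P"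
    unfolding R_fixed_iff[symmetric] by (rule R.idem)
  ultimately show ?thesis by (rule lin_opD(3)[OF F.lin])
qed

lemma R_PP:
  assumes "(x, w) \<in> P \<odot> P"
  shows "R k w = (pt k * pt k) *\<^sub>C R k x"
  using assms R_P[of _ _ k] by (auto simp: op_mult_def scaleC_scaleC)

lemma T_R: "(R n x, pt n *\<^sub>C U (R n x)) \<in> T"
proof -
  have "(R n x, pt n *\<^sub>C R n x) \<in> P" using R.idem R_fixed_iff by blast
  then show ?thesis
    using bclinearD[of U "pt n" "R n x"] U
    by (auto simp: T_eq op_mult_def graph_def unitary_op_def relcomp_unfold)
qed

lemma T_lin: "lin_op T"
  using normal by (simp add: normal_op_def)

text \<open>Normality of \<open>T\<close> gives \<open>P\<^sup>2 = U P\<^sup>2 U\<^sup>*\<close>, so \<open>U\<close> preserves the eigenspaces of \<open>P\<close>.\<close>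

lemma U_R: "U o\<^sub>L R n = R n o\<^sub>L U"
proof -
  have "R n (U (R n x)) = U (R n x)" for n x
  proof (rule R.fixedI)
    fix k
    assume "k \<noteq> n"
    define y where "y = R n x"
    have "(y, pt n *\<^sub>C y) \<in> P" using R.idem R_fixed_iff y_def by blast
    then have "(y, pt n *\<^sub>C pt n *\<^sub>C y) \<in> P \<odot> P"
      using lin_opD(2)[OF F.lin, of y "pt n *\<^sub>C y" "pt n"] by (auto simp: op_mult_def)
    then obtain w where w: "(y, w) \<in> T" "(w, pt n *\<^sub>C pt n *\<^sub>C y) \<in> adjoint_op T"
      unfolding PP by (auto simp: op_mult_def)
    have T: "(y, pt n *\<^sub>C U y) \<in> T" unfolding y_def by (rule T_R)
    have "w = pt n *\<^sub>C U y" using w(1) T by (rule lin_opD(3)[OF T_lin])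
    then have "(inverse (pt n) *\<^sub>C pt n *\<^sub>C U y, inverse (pt n) *\<^sub>C pt n *\<^sub>C pt n *\<^sub>C y) \<in> adjoint_op T"
      using w(2) adjoint_op_scale by blast
    moreover have "inverse (pt n) * (pt n * pt n) = pt n" by (simp add: pt_nonzero field_simps)
    ultimately have "(U y, pt n *\<^sub>C y) \<in> adjoint_op T"
      by (simp add: scaleC_scaleC pt_nonzero)
    moreover have "(pt n *\<^sub>C y, pt n *\<^sub>C pt n *\<^sub>C U y) \<in> T" using T by (rule lin_opD(2)[OF T_lin])
    ultimately have "(U y, pt n *\<^sub>C pt n *\<^sub>C U y) \<in> T \<odot> adjoint_op T" by (auto simp: op_mult_def)
    then have "(U y, pt n *\<^sub>C pt n *\<^sub>C U y) \<in> P \<odot> P"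
      using normal PP by (simp add: normal_op_def)
    \<comment> \<open>\<open>U y\<close> is an eigenvector of \<open>P \<odot> P\<close> for the
      square of \<open>q powi n\<close>, while its component at \<open>k\<close> belongs to the
      square of \<open>q powi k\<close>.\<close>
    from R_PP[OF this, of k] have "(pt n * pt n - pt k * pt k) *\<^sub>C R k (U y) = 0"
      by (simp add: R.lin scaleC_scaleC scaleC.diff_left)
    moreover have "pt n * pt n \<noteq> pt k * pt k"
    proof
      assume "pt n * pt n = pt k * pt k"
      then have "q powi n * q powi n = q powi k * q powi k"
        unfolding pt_def by (metis of_real_eq_iff of_real_mult)
      then have "q powi n = q powi k"
        using q by (metis less_eq_real_def power2_eq_iff_nonneg power2_eq_square zero_less_power_int)
      then show False using \<open>k \<noteq> n\<close> q_powi_inj[OF q] by simp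
    qed
    ultimately have "R k (U y) = 0"
      by (metis eq_iff_diff_eq_0 norm_eq_zero norm_scaleC mult_eq_0_iff)
    then show "R k (U (R n x)) = 0" by (simp add: y_def)
  qed
  then show ?thesis using R.intertwineI[of 0 U n] by simp
qed

text \<open>The relation lets \<open>V\<close> carry an eigenvector of \<open>P\<close> for
  \<open>q powi n\<close> to one for \<open>q powi (n + d)\<close>. It is used for \<open>v\<close>
  on \<open>|a|\<close> with \<open>d = 1\<close> and for \<open>u\<close> on \<open>|b|\<close>
  with \<open>d = -1\<close>.\<close>

lemma commutation_shift:
  assumes V: "unitary_op V" and rel: "P \<odot> graph V = op_scale (complex_of_real (q powi d)) (graph V \<odot> P)"
  shows "V o\<^sub>L R n = R (n + d) o\<^sub>L V"
proof (rule R.intertwineI)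
  fix n x
  define y where "y = R n x"
  have "(y, pt n *\<^sub>C y) \<in> P" using R.idem R_fixed_iff y_def by blast
  then have "(y, V (pt n *\<^sub>C y)) \<in> graph V \<odot> P" by (auto simp: op_mult_def graph_def)
  then have "(y, complex_of_real (q powi d) *\<^sub>C V (pt n *\<^sub>C y)) \<in> P \<odot> graph V"
    unfolding rel op_scale_def by blast
  then have "(V y, complex_of_real (q powi d) *\<^sub>C V (pt n *\<^sub>C y)) \<in> P"
    by (auto simp: op_mult_def graph_def)
  moreover have "complex_of_real (q powi d) *\<^sub>C V (pt n *\<^sub>C y) = pt (n + d) *\<^sub>C V y"
    using V q by (simp add: unitary_op_def bclinearD scaleC_scaleC pt_def power_int_add mult.commute)
  ultimately show "R (n + d) (V (R n x)) = V (R n x)" by (simp add: R_fixed_iff y_def)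
qed

lemma powi_R: "unitary_powi U l o\<^sub>L R n = R n o\<^sub>L unitary_powi U l"
  using unitary_powi_intertwine[OF U, of R 0 l n] U_R by simp

text \<open>\<open>D\<close> is the power \<open>it\<close> of the modulus, the integral of the
  bounded function \<open>\<phi> t\<close>; replacing \<open>t\<close> by \<open>- t\<close>
  conjugates this function and gives the adjoint \<open>D'\<close>.\<close>

lemma phase_exists:
  "\<exists>D D'. adj_pair D D' \<and> (\<forall>n x. D (R n x) = cis (t * (of_int n * ln q)) *\<^sub>C R n x)
    \<and> (\<forall>n x. D' (R n x) = cis (- t * (of_int n * ln q)) *\<^sub>C R n x)"
proof -
  define \<phi> where "\<phi> t z = cis (t * ln (cmod z))" for t z
  have "\<phi> t \<in> borel_measurable borel"
    unfolding \<phi>_def cis_conv_exp by measurable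
  moreover have "bounded (range (\<phi> t))"
    by (rule boundedI[of _ 1]) (auto simp: \<phi>_def)
  ultimately obtain D where D: "spectral_int F (\<phi> t) D" using F.spectral_int_exists by blast
  obtain D' where D': "spectral_int F (\<lambda>z. cnj (\<phi> t z)) D'" "adj_pair D D'"
    using F.spectral_int_adjoint[OF D] by blast
  have "(\<lambda>z. cnj (\<phi> t z)) = \<phi> (- t)" by (simp add: \<phi>_def cis_cnj fun_eq_iff)
  with D'(1) have D'': "spectral_int F (\<phi> (- t)) D'" by simp
  have eig: "D (R n x) = cis (t * (of_int n * ln q)) *\<^sub>C R n x" if D: "spectral_int F (\<phi> t) D" for D t n x
  proof -
    have "ln (cmod (pt n)) = of_int n * ln q"
      unfolding cmod_pt using q by (simp add: powr_real_of_int'[symmetric] ln_powr)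
    then have "(\<lambda>z. \<phi> t z * indicator {pt n} z) = (\<lambda>z. cis (t * (of_int n * ln q)) * indicator {pt n} z)"
      by (auto simp: \<phi>_def split: split_indicator)
    then have "spectral_int F (\<lambda>z. cis (t * (of_int n * ln q)) * indicator {pt n} z) (D o\<^sub>L R n)"
      using F.spectral_int_mult[OF D F.spectral_int_indicator[of "{pt n}"]] by (simp only: R_def) simp
    moreover have "spectral_int F (\<lambda>z. cis (t * (of_int n * ln q)) * indicator {pt n} z)
        (cscale (cis (t * (of_int n * ln q))) (R n))"
      unfolding R_def by (intro F.spectral_int_cscale F.spectral_int_indicator) simp
    ultimately have "D o\<^sub>L R n = cscale (cis (t * (of_int n * ln q))) (R n)"
      by (rule F.spectral_int_unique)
    then show ?thesis by (metis blinfun_apply_blinfun_compose cscale.rep_eq)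
  qed
  show ?thesis using D'(2) eig[OF D] eig[OF D''] by blast
qed

end

section \<open>Spectral integrals of the normal operator as limits of shifts\<close>

lemma span_compose:
  assumes lin: "\<And>X. X \<in> S \<Longrightarrow> bclinear X"
    and mult: "\<And>X Y. X \<in> S \<Longrightarrow> Y \<in> S' \<Longrightarrow> X o\<^sub>L Y \<in> cs.span S''"
    and X: "X \<in> cs.span S" and Y: "Y \<in> cs.span S'"
  shows "X o\<^sub>L Y \<in> cs.span S''"
  using X
proof (induction rule: cs.span_induct_alt)
  case base
  show ?case by (simp add: cs.span_zero)
next
  case (step c X Z)
  have "X o\<^sub>L Y \<in> cs.span S''"
    using Y
  proof (induction rule: cs.span_induct_alt)
    case base
    show ?case by (simp add: cs.span_zero)
  next
    case (step d Y W)
    then show ?case using mult[OF \<open>X \<in> S\<close> step(1)] lin[OF \<open>X \<in> S\<close>]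
      by (simp add: blinfun_compose_add_right cscale_compose_right cs.span_add cs.span_scale)
  qed
  with step show ?case
    by (simp add: blinfun_compose_add_left cscale_compose_left cs.span_add cs.span_scale)
qed

text \<open>Adds a spectral measure \<open>E\<close> of \<open>T\<close> itself. Nothing ties it to
  \<open>F\<close> at first; the link is found on the circles.\<close>

locale polar_spectral = polar_system q T U P F
  for q :: real and T :: "('h::chilbert \<times> 'h) set" and U P F +
  fixes E :: "complex set \<Rightarrow> ('h \<Rightarrow>\<^sub>L 'h)"
  assumes E: "spectral_measure_of T E"
begin

sublocale E: spectral_op E T
  using E normal by unfold_locales (auto simp: spectral_measure_of_def normal_op_def)

abbreviation C :: "int \<Rightarrow> complex set" where "C \<equiv> q_circle q"

text \<open>The link between the two measures is
  \<open>P \<odot> P = adjoint_op T \<odot> T\<close>. On a band \<open>M\<close> where the modulus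
  of \<open>z\<close> stays away from \<open>q powi m\<close>, the bounded operator \<open>Z\<close>
  represents \<open>T* T\<close> minus the square of \<open>q powi m\<close>. It kills
  \<open>x\<close>, and it is bounded below on the range of \<open>E M\<close>.\<close>

lemma E_circle_fixed:
  assumes x: "R m x = x"
  shows "E (C m) x = x"
proof -
  define f where "f z = \<bar>(cmod z)\<^sup>2 - (q powi m)\<^sup>2\<bar>" for z
  have f: "continuous_on UNIV f" unfolding f_def by (intro continuous_intros)
  have "E {z. f z = 0} x = x"
  proof (rule E.E_zero_set[OF f])
    fix n
    define M where "M = {z. inverse (real (Suc n)) \<le> f z} \<inter> cball 0 (real n)"
    have Mb: "M \<in> sets borel" "bounded M" unfolding M_def by (rule E.bounded_band[OF f])+
    obtain B where B: "spectral_int E (\<lambda>z. indicator M z * z) B"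
      using E.restriction_exists[OF Mb] by blast
    obtain B' where B': "spectral_int E (\<lambda>z. cnj (indicator M z * z)) B'" "adj_pair B B'"
      using E.spectral_int_adjoint[OF B] by blast
    define Z where "Z = (B' o\<^sub>L B) - cscale (pt m * pt m) (E M)"
    have Z: "spectral_int E (\<lambda>z. cnj (indicator M z * z) * (indicator M z * z) - (pt m * pt m) * indicator M z) Z"
      unfolding Z_def
      by (intro E.spectral_int_diff E.spectral_int_mult B B' E.spectral_int_cscale E.spectral_int_indicator Mb)
    note BE = E.restriction_absorb[OF Mb(1) B]
    note EM = adj_pairD[OF orth_projection_adj[OF E.proj[OF Mb(1)]]]
    \<comment> \<open>\<open>E M y\<close> lies in the domain of \<open>P \<odot> P\<close>, which
      acts on it as \<open>B' o B\<close>. Under \<open>R m\<close> this becomes multiplication by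
      the square of \<open>pt m\<close>, and \<open>Z\<close> cancels exactly that.\<close>
    have ortho: "cinner x (Z y) = 0" for y
    proof -
      define y' where "y' = E M y"
      have y': "E M y' = y'" by (simp add: y'_def orth_projection_idem[OF E.proj[OF Mb(1)]])
      have By: "E M (B y') = B y'" using BE(1) by (metis blinfun_apply_blinfun_compose)
      have 1: "(y', B y') \<in> T" by (rule E.restriction[OF Mb B y'])
      have 2: "(B y', B' (B y')) \<in> adjoint_op T"
        unfolding adjoint_op_iff
      proof (intro allI impI)
        fix s t assume st: "(s, t) \<in> T"
        have "cinner t (B y') = cinner (E M t) (B y')" by (simp add: EM By)
        also have "\<dots> = cinner (B (E M s)) (B y')" using E.restriction_eq[OF Mb B st] by simp
        also have "B (E M s) = B s" using BE(2) by (metis blinfun_apply_blinfun_compose)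
        finally show "cinner t (B y') = cinner s (B' (B y'))" by (simp add: adj_pairD[OF B'(2)])
      qed
      from 1 2 have "(y', B' (B y')) \<in> P \<odot> P" unfolding PP by (auto simp: op_mult_def)
      then have "R m (B' (B y')) = (pt m * pt m) *\<^sub>C R m y'" by (rule R_PP)
      then have "cinner x (B' (B y') - (pt m * pt m) *\<^sub>C y') = 0"
        using R.adj[of m x "B' (B y') - (pt m * pt m) *\<^sub>C y'"] x
        by (simp add: blinfun.diff_right R.lin)
      moreover have "Z y = B' (B y') - (pt m * pt m) *\<^sub>C y'"
        using BE(2) by (simp add: Z_def y'_def blinfun.diff_left cscale.rep_eq)
           (metis blinfun_apply_blinfun_compose)
      ultimately show ?thesis by simp
    qed
    obtain Z' where Z': "spectral_int E (\<lambda>z. cnj (cnj (indicator M z * z) * (indicator M z * z)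
        - (pt m * pt m) * indicator M z)) Z'" "adj_pair Z Z'"
      using E.spectral_int_adjoint[OF Z] by blast
    \<comment> \<open>A real integrand makes \<open>Z\<close> self-adjoint, so orthogonality of
      \<open>x\<close> to its range becomes \<open>Z x = 0\<close>.\<close>
    have real: "cnj (cnj (indicator M z * z) * (indicator M z * z) - (pt m * pt m) * indicator M z)
      = cnj (indicator M z * z) * (indicator M z * z) - (pt m * pt m) * indicator M z" for z
      by (auto simp: pt_def mult.commute split: split_indicator)
    have "Z' = Z" using Z'(1) Z unfolding real by (rule E.spectral_int_unique)
    then have "cinner y (Z x) = 0" for y
      using adj_pairD[OF Z'(2), of y x] ortho[of y] cinner_commute[of "Z y" x] by simp
    then have Zx: "Z x = 0" by (intro cinner_eqI) simp
    have "E M x = 0"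
    proof (rule E.spectral_int_kernel[OF Z Mb(1) _ _ Zx])
      show "inverse (real (Suc n))
        \<le> cmod (cnj (indicator M z * z) * (indicator M z * z) - (pt m * pt m) * indicator M z)" if "z \<in> M" for z
      proof -
        have "cnj (indicator M z * z) * (indicator M z * z) - (pt m * pt m) * indicator M z
          = complex_of_real ((cmod z)\<^sup>2 - (q powi m)\<^sup>2)"
          using that complex_norm_square[of z] by (simp add: pt_def power2_eq_square mult.commute)
        then show ?thesis using that by (simp add: M_def f_def del: of_real_diff)
      qed
    qed simp
    then show "E ({z. inverse (real (Suc n)) \<le> f z} \<inter> cball 0 (real n)) x = 0" unfolding M_def .
  qed (simp add: f_def)
  moreover have "{z. f z = 0} = C m"
    using q by (auto simp: f_def q_circle_iff power2_eq_iff_nonneg)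
  ultimately show ?thesis by simp
qed

lemma E_circle: "E (C m) = R m"
proof (rule R.eqI)
  fix n x
  have n: "E (C n) (R n x) = R n x" by (rule E_circle_fixed) (rule R.idem)
  show "E (C m) (R n x) = R m (R n x)"
  proof (cases "m = n")
    case True
    then show ?thesis using n by (simp add: R.idem)
  next
    case False
    then have "C m \<inter> C n = {}" using q_powi_inj[OF q] by (auto simp: q_circle_iff)
    then have "E (C m) (E (C n) (R n x)) = 0" by (simp add: E.E_Int_apply E.E_empty)
    then show ?thesis using n False by (simp add: R.orth)
  qed
qed

lemma E_off_Gamma: "E (- (\<Union>n. C n)) = 0"
proof (rule R.eqI)
  fix n x
  have B: "- (\<Union>n. C n) \<in> sets borel" by measurable
  have "E (- (\<Union>n. C n)) (E (C n) (R n x)) = E (- (\<Union>n. C n) \<inter> C n) (R n x)"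
    by (rule E.E_Int_apply[OF B]) simp
  also have "- (\<Union>n. C n) \<inter> C n = {}" by auto
  finally show "E (- (\<Union>n. C n)) (R n x) = blinfun_apply 0 (R n x)"
    by (simp add: E_circle R.idem E.E_empty)
qed

lemma E_tail: "E (\<Union>n\<in>{N..}. C n) = Q N"
proof (rule R.eqI)
  fix n x
  have "E (\<Union>n\<in>{N..}. C n) (E (C n) x) = E ((\<Union>n\<in>{N..}. C n) \<inter> C n) x"
    by (rule E.E_Int_apply) measurable
  also have "(\<Union>n\<in>{N..}. C n) \<inter> C n = (if N \<le> n then C n else {})"
    using q_powi_inj[OF q] by (auto simp: q_circle_iff)
  finally show "E (\<Union>n\<in>{N..}. C n) (R n x) = Q N (R n x)"
    by (simp add: E_circle Q_R E.E_empty)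
qed

text \<open>On the circle of radius \<open>q powi n\<close> the modulus is constant, so the phase
  \<open>U\<close> acts as multiplication by \<open>z / pt n\<close>. The inverse of this number is
  its conjugate there, which is why negative powers come from the adjoint.\<close>

lemma spectral_int_powi:
  "spectral_int E (\<lambda>z. indicator (C n) z * (z / pt n) powi l) (unitary_powi U l o\<^sub>L R n)"
proof -
  have 1: "spectral_int E (\<lambda>z. indicator (C n) z * (z / pt n)) (U o\<^sub>L R n)"
  proof -
    have Cb: "C n \<in> sets borel" "bounded (C n)" by (simp_all add: q_circle_def)
    obtain B where B: "spectral_int E (\<lambda>z. indicator (C n) z * z) B"
      using E.restriction_exists[OF Cb] by blast
    have "cscale (inverse (pt n)) B = U o\<^sub>L R n"
    proof (rule blinfun_eqI)
      fix x
      have "(R n x, B (R n x)) \<in> T"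
        by (rule E.restriction[OF Cb B]) (simp add: E_circle R.idem)
      then have "B (R n x) = pt n *\<^sub>C U (R n x)" using T_R by (rule lin_opD(3)[OF T_lin])
      moreover have "B (R n x) = B x"
        using E.restriction_absorb(2)[OF Cb(1) B] unfolding E_circle
        by (metis blinfun_apply_blinfun_compose)
      ultimately show "cscale (inverse (pt n)) B x = (U o\<^sub>L R n) x"
        by (simp add: cscale.rep_eq scaleC_scaleC pt_nonzero)
    qed
    moreover have "spectral_int E (\<lambda>z. inverse (pt n) * (indicator (C n) z * z)) (cscale (inverse (pt n)) B)"
      by (rule E.spectral_int_cscale[OF B])
    ultimately show ?thesis by (simp add: divide_inverse mult_ac)
  qed
  have 2: "spectral_int E (\<lambda>z. indicator (C n) z * inverse (z / pt n)) (badj U o\<^sub>L R n)"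
  proof -
    obtain G where G: "spectral_int E (\<lambda>z. cnj (indicator (C n) z * (z / pt n))) G" "adj_pair (U o\<^sub>L R n) G"
      using E.spectral_int_adjoint[OF 1] by blast
    have "adj_pair (R n o\<^sub>L U) (badj U o\<^sub>L R n)"
      by (intro adj_pair_simps orth_projection_adj R.proj unitary_op_inverse U)
    then have "G = badj U o\<^sub>L R n" using G(2) badj_eqI unfolding U_R by metis
    moreover have "cnj (indicator (C n) z * (z / pt n)) = indicator (C n) z * inverse (z / pt n)" for z
    proof (cases "z \<in> C n")
      case True
      then have m: "cmod (z / pt n) = 1" using q by (simp add: q_circle_iff norm_divide cmod_pt)
      then have "(z / pt n) * cnj (z / pt n) = 1"
        using complex_norm_square[of "z / pt n"] by simp
      then have "inverse (z / pt n) = cnj (z / pt n)" by (rule inverse_unique)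
      then show ?thesis using True by simp
    qed simp
    ultimately show ?thesis using G(1) by simp
  qed
  show ?thesis
  proof (induction l rule: int_induct[where k=0])
    case base
    show ?case using E.spectral_int_indicator[of "C n"] by (simp add: E_circle)
  next
    case (step1 i)
    have "spectral_int E (\<lambda>z. (indicator (C n) z * (z / pt n)) * (indicator (C n) z * (z / pt n) powi i))
      ((U o\<^sub>L R n) o\<^sub>L (unitary_powi U i o\<^sub>L R n))"
      by (rule E.spectral_int_mult[OF 1 step1.IH])
    moreover have "(U o\<^sub>L R n) o\<^sub>L (unitary_powi U i o\<^sub>L R n) = unitary_powi U (i + 1) o\<^sub>L R n"
      by (rule blinfun_eqI)
         (metis (no_types, lifting) R.idem U U_R blinfun_apply_blinfun_compose powi_R unitary_powi_add1)
    moreover have "(indicator (C n) z * (z / pt n)) * (indicator (C n) z * (z / pt n) powi i)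
      = indicator (C n) z * (z / pt n) powi (i + 1)" for z
    proof (cases "z \<in> C n")
      case True
      then have "z / pt n \<noteq> 0" using q pt_nonzero by (auto simp: q_circle_iff)
      then show ?thesis using True by (simp add: power_int_add mult.commute)
    qed simp
    ultimately show ?case by simp
  next
    case (step2 i)
    have "spectral_int E (\<lambda>z. (indicator (C n) z * inverse (z / pt n)) * (indicator (C n) z * (z / pt n) powi i))
      ((badj U o\<^sub>L R n) o\<^sub>L (unitary_powi U i o\<^sub>L R n))"
      by (rule E.spectral_int_mult[OF 2 step2.IH])
    moreover have "(badj U o\<^sub>L R n) o\<^sub>L (unitary_powi U i o\<^sub>L R n) = unitary_powi U (i - 1) o\<^sub>L R n"
      by (rule blinfun_eqI)
         (metis (no_types, lifting) R.idem U blinfun_apply_blinfun_compose powi_R unitary_powi_diff1)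
    moreover have "(indicator (C n) z * inverse (z / pt n)) * (indicator (C n) z * (z / pt n) powi i)
      = indicator (C n) z * (z / pt n) powi (i - 1)" for z
    proof (cases "z \<in> C n")
      case True
      then have "z / pt n \<noteq> 0" using q pt_nonzero by (auto simp: q_circle_iff)
      then show ?thesis using True by (simp add: power_int_diff divide_inverse mult.commute)
    qed simp
    ultimately show ?case by simp
  qed
qed

abbreviation W :: "int \<Rightarrow> int \<Rightarrow> ('h \<Rightarrow>\<^sub>L 'h)" where
  "W n l \<equiv> unitary_powi U l o\<^sub>L R n"

lemma W_bclinear: "bclinear (W n l)"
  using unitary_op_powi[OF U] by (auto simp: unitary_op_def orth_projection_bclinear[OF R.proj])

lemma W_W: "W n k o\<^sub>L W n l = W n (k + l)"
proof (rule blinfun_eqI)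
  fix x
  have "R n (unitary_powi U l (R n x)) = unitary_powi U l (R n x)"
    using powi_R[of l n] by (metis R.idem blinfun_apply_blinfun_compose)
  then show "(W n k o\<^sub>L W n l) x = W n (k + l) x"
    by (simp add: unitary_powi_add[OF U])
qed

text \<open>On the circle \<open>cnj z\<close> is a multiple of \<open>inverse z\<close>, so real
  polynomials in \<open>Re z\<close> and \<open>Im z\<close> are Laurent polynomials in
  \<open>z / pt n\<close> there. This brings the real Stone-Weierstrass theorem to bear.\<close>

lemma spectral_int_polynomial:
  fixes p :: "complex \<Rightarrow> real"
  assumes "real_polynomial_function p"
  shows "\<exists>X\<in>cs.span (range (W n)). spectral_int E (\<lambda>z. indicator (C n) z * complex_of_real (p z)) X"
  using assms
proof induction
  case (linear f)
  \<comment> \<open>The coefficients of \<open>z / pt n\<close> and of its conjugate in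
    \<open>Re z * f 1 + Im z * f \<i>\<close>.\<close>
  define \<alpha> where "\<alpha> = pt n / 2 * (complex_of_real (f 1) - \<i> * complex_of_real (f \<i>))"
  define \<beta> where "\<beta> = pt n / 2 * (complex_of_real (f 1) + \<i> * complex_of_real (f \<i>))"
  have "spectral_int E (\<lambda>z. \<alpha> * (indicator (C n) z * (z / pt n) powi 1)
      + \<beta> * (indicator (C n) z * (z / pt n) powi (-1))) (cscale \<alpha> (W n 1) + cscale \<beta> (W n (-1)))"
    by (intro E.spectral_int_add E.spectral_int_cscale spectral_int_powi)
  moreover have "\<alpha> * (indicator (C n) z * (z / pt n) powi 1) + \<beta> * (indicator (C n) z * (z / pt n) powi (-1))
      = indicator (C n) z * complex_of_real (f z)" for z
  proof (cases "z \<in> C n")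
    case True
    have "f z = f (Re z *\<^sub>R 1 + Im z *\<^sub>R \<i>)"
      by (rule arg_cong[of _ _ f]) (simp add: complex_eq_iff)
    also have "\<dots> = Re z * f 1 + Im z * f \<i>"
      using linear by (simp add: linear_simps)
    finally have fz: "f z = Re z * f 1 + Im z * f \<i>" .
    have z0: "z \<noteq> 0" using True q by (auto simp: q_circle_iff)
    have "z * cnj z = pt n * pt n"
      using True complex_norm_square[of z] by (simp add: q_circle_iff pt_def power2_eq_square)
    then have inv: "inverse (z / pt n) = cnj z / pt n"
      using z0 pt_nonzero[of n] by (simp add: field_simps)
    have "\<alpha> * (z / pt n) + \<beta> * (cnj z / pt n)
      = (complex_of_real (f 1) - \<i> * complex_of_real (f \<i>)) * z / 2
        + (complex_of_real (f 1) + \<i> * complex_of_real (f \<i>)) * cnj z / 2"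
      unfolding \<alpha>_def \<beta>_def using pt_nonzero[of n] by (simp add: field_simps)
    also have "\<dots> = complex_of_real (f z)"
      by (simp add: fz complex_eq_iff field_simps)
    finally show ?thesis using True inv by (simp add: power_int_minus)
  qed simp
  moreover have "cscale \<alpha> (W n 1) + cscale \<beta> (W n (-1)) \<in> cs.span (range (W n))"
    by (intro cs.span_add cs.span_scale cs.span_base rangeI)
  ultimately show ?case by auto
next
  case (const c)
  have "spectral_int E (\<lambda>z. complex_of_real c * (indicator (C n) z * (z / pt n) powi 0)) (cscale c (W n 0))"
    by (intro E.spectral_int_cscale spectral_int_powi)
  moreover have "cscale c (W n 0) \<in> cs.span (range (W n))"
    by (intro cs.span_scale cs.span_base rangeI)
  ultimately show ?case by (auto simp: mult.commute)
next
  case (add f g)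
  then obtain X Y where X: "X \<in> cs.span (range (W n))" "spectral_int E (\<lambda>z. indicator (C n) z * complex_of_real (f z)) X"
    and Y: "Y \<in> cs.span (range (W n))" "spectral_int E (\<lambda>z. indicator (C n) z * complex_of_real (g z)) Y"
    by blast
  show ?case
    using E.spectral_int_add[OF X(2) Y(2)] cs.span_add[OF X(1) Y(1)]
    by (auto simp: distrib_left intro!: bexI[of _ "X + Y"])
next
  case (mult f g)
  then obtain X Y where X: "X \<in> cs.span (range (W n))" "spectral_int E (\<lambda>z. indicator (C n) z * complex_of_real (f z)) X"
    and Y: "Y \<in> cs.span (range (W n))" "spectral_int E (\<lambda>z. indicator (C n) z * complex_of_real (g z)) Y"
    by blast
  have "X o\<^sub>L Y \<in> cs.span (range (W n))"
    by (rule span_compose[OF _ _ X(1) Y(1)]) (auto simp: W_bclinear W_W cs.span_base)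
  moreover have "(\<lambda>z. (indicator (C n) z * complex_of_real (f z)) * (indicator (C n) z * complex_of_real (g z)))
    = (\<lambda>z. indicator (C n) z * complex_of_real (f z * g z))"
    by (auto split: split_indicator)
  ultimately show ?case using E.spectral_int_mult[OF X(2) Y(2)] by (intro bexI) (simp only:)
qed

lemma circle_approximation:
  assumes cont: "continuous_on (C n) \<phi>" and e: "0 < e"
  shows "\<exists>X\<in>cs.span (range (W n)). \<exists>\<psi>. spectral_int E (\<lambda>z. indicator (C n) z * \<psi> z) X
    \<and> (\<forall>z\<in>C n. cmod (\<phi> z - \<psi> z) < e)"
proof -
  have cp: "compact (C n)" by (simp add: q_circle_def)
  obtain f where f: "real_polynomial_function f" "\<And>z. z \<in> C n \<Longrightarrow> \<bar>Re (\<phi> z) - f z\<bar> < e / 2"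
    using Stone_Weierstrass_real_polynomial_function[OF cp continuous_on_Re[OF cont], of "e / 2"] e by auto
  obtain g where g: "real_polynomial_function g" "\<And>z. z \<in> C n \<Longrightarrow> \<bar>Im (\<phi> z) - g z\<bar> < e / 2"
    using Stone_Weierstrass_real_polynomial_function[OF cp continuous_on_Im[OF cont], of "e / 2"] e by auto
  obtain X where X: "X \<in> cs.span (range (W n))" "spectral_int E (\<lambda>z. indicator (C n) z * complex_of_real (f z)) X"
    using spectral_int_polynomial[OF f(1)] by blast
  obtain Y where Y: "Y \<in> cs.span (range (W n))" "spectral_int E (\<lambda>z. indicator (C n) z * complex_of_real (g z)) Y"
    using spectral_int_polynomial[OF g(1)] by blast
  have "spectral_int E (\<lambda>z. indicator (C n) z * complex_of_real (f z)
      + \<i> * (indicator (C n) z * complex_of_real (g z))) (X + cscale \<i> Y)"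
    by (intro E.spectral_int_add E.spectral_int_cscale X Y)
  then have "spectral_int E (\<lambda>z. indicator (C n) z * (complex_of_real (f z) + \<i> * complex_of_real (g z))) (X + cscale \<i> Y)"
    by (simp add: distrib_left mult.left_commute)
  moreover have "X + cscale \<i> Y \<in> cs.span (range (W n))"
    by (intro cs.span_add cs.span_scale X Y)
  moreover have "cmod (\<phi> z - (complex_of_real (f z) + \<i> * complex_of_real (g z))) < e" if "z \<in> C n" for z
    using cmod_le[of "\<phi> z - (complex_of_real (f z) + \<i> * complex_of_real (g z))"] f(2)[OF that] g(2)[OF that]
    by simp
  ultimately show ?thesis by (intro bexI exI conjI ballI)
qed

text \<open>\<open>c\<close> is the limit of \<phi> at 0. The function splits into a negligible part
  on the large circles, finitely many circles treated by Laurent polynomials, and a tail close to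
  the constant \<open>c\<close>, for which a single \<open>Q j\<close> suffices.\<close>

lemma spectral_int_in_closure:
  assumes G: "spectral_int E \<phi> G" and cont: "\<And>n. continuous_on (C n) \<phi>"
    and tail: "\<And>e. 0 < e \<Longrightarrow> \<exists>i j. \<forall>n z. z \<in> C n \<longrightarrow> n \<notin> {i..<j} \<longrightarrow> cmod (\<phi> z - (if j \<le> n then c else 0)) < e"
    and S: "\<And>n l. W n l \<in> S" "c \<noteq> 0 \<Longrightarrow> range Q \<subseteq> S"
  shows "G \<in> closure (cs.span S)"
  unfolding closure_approachable
proof (intro allI impI)
  fix e' :: real
  assume "0 < e'"
  \<comment> \<open>A third, because the norm estimate loses a factor 2.\<close>
  define e where "e = e' / 3"
  have e: "0 < e" using \<open>0 < e'\<close> by (simp add: e_def)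
  obtain i j where ij: "\<And>n z. z \<in> C n \<Longrightarrow> n \<notin> {i..<j} \<Longrightarrow> cmod (\<phi> z - (if j \<le> n then c else 0)) < e"
    using tail[OF e] by blast
  have "\<forall>n. \<exists>X. X \<in> cs.span (range (W n)) \<and> (\<exists>\<psi>. spectral_int E (\<lambda>z. indicator (C n) z * \<psi> z) X
    \<and> (\<forall>z\<in>C n. cmod (\<phi> z - \<psi> z) < e))"
    using circle_approximation[OF cont e] by blast
  from choice[OF this] obtain X where X: "\<And>n. X n \<in> cs.span (range (W n))"
    and "\<forall>n. \<exists>\<psi>. spectral_int E (\<lambda>z. indicator (C n) z * \<psi> z) (X n)
      \<and> (\<forall>z\<in>C n. cmod (\<phi> z - \<psi> z) < e)"
    by blast
  from choice[OF this(2)] obtain \<psi>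
    where \<psi>: "\<And>n. spectral_int E (\<lambda>z. indicator (C n) z * \<psi> n z) (X n)"
      and near: "\<And>n z. z \<in> C n \<Longrightarrow> cmod (\<phi> z - \<psi> n z) < e"
    by blast
  define D where "D = (\<Union>n\<in>{j..}. C n)"
  define Y where "Y = (\<Sum>n\<in>{i..<j}. X n) + cscale c (Q j)"
  have Db: "D \<in> sets borel" unfolding D_def by measurable
  have Y: "spectral_int E (\<lambda>z. (\<Sum>n\<in>{i..<j}. indicator (C n) z * \<psi> n z) + c * indicator D z) Y"
    unfolding Y_def E_tail[symmetric] D_def[symmetric]
    by (intro E.spectral_int_add E.spectral_int_sum E.spectral_int_cscale E.spectral_int_indicator \<psi> Db)
  have "cs.span (range (W n)) \<subseteq> cs.span S" for n
    using S(1) by (intro cs.span_mono) auto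
  then have "(\<Sum>n\<in>{i..<j}. X n) \<in> cs.span S"
    using X by (intro cs.span_sum) blast
  moreover have "cscale c (Q j) \<in> cs.span S"
  proof (cases "c = 0")
    case False
    then show ?thesis using S(2) by (intro cs.span_scale cs.span_base) auto
  qed (simp add: cs.span_zero)
  ultimately have YS: "Y \<in> cs.span S" unfolding Y_def by (rule cs.span_add)
  have "norm (Y - G) \<le> 2 * e"
  proof (rule E.spectral_int_norm_le[OF E.spectral_int_diff[OF Y G] _ _ E_off_Gamma])
    show "- (\<Union>n. C n) \<in> sets borel" by measurable
    fix z
    assume "z \<notin> - (\<Union>n. C n)"
    then obtain n where n: "z \<in> C n" by auto
    have other: "z \<in> C m \<longleftrightarrow> m = n" for m
      using n q_powi_inj[OF q] by (auto simp: q_circle_iff)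
    have "(\<Sum>m\<in>{i..<j}. indicator (C m) z * \<psi> m z) = (\<Sum>m\<in>{i..<j}. if m = n then \<psi> n z else 0)"
      by (intro sum.cong) (auto simp: other indicator_def)
    also have "\<dots> = (if n \<in> {i..<j} then \<psi> n z else 0)" by simp
    finally have s: "(\<Sum>m\<in>{i..<j}. indicator (C m) z * \<psi> m z) = (if n \<in> {i..<j} then \<psi> n z else 0)" .
    have d: "c * indicator D z = (if j \<le> n then c else 0)"
      by (auto simp: D_def other indicator_def)
    show "cmod ((\<Sum>n\<in>{i..<j}. indicator (C n) z * \<psi> n z) + c * indicator D z - \<phi> z) \<le> e"
      unfolding s d using ij[OF n] near[OF n] by (auto simp: norm_minus_commute less_imp_le)
  qed (use e in simp)
  then have "dist Y G < e'" using \<open>0 < e'\<close> by (simp add: dist_norm e_def)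
  with YS show "\<exists>Y\<in>cs.span S. dist Y G < e'" by blast
qed

end

section \<open>Weights on an algebra of weighted shifts\<close>

text \<open>The real number \<open>cinner z (X z)\<close> does not change when \<open>z\<close> is
  multiplied by \<open>\<i>\<close> or by -1, so the polarization formulas of
  \<open>cinner x (X y)\<close> and \<open>cinner y (X x)\<close> are conjugate.\<close>

lemma positive_op_symmetric:
  assumes "positive_op X"
  shows "cinner (X x) y = cinner x (X y)"
proof -
  have lin: "bclinear X" and im: "Im (cinner z (X z)) = 0" for z
    using assms by (auto simp: positive_op_def)
  define B where "B z = cinner z (X z)" for z
  have real: "cnj (B z) = B z" for z
    using im[of z] by (simp add: B_def complex_eq_iff)
  have inv: "B (\<i> *\<^sub>C z) = B z" "B (- z) = B z" for z
    by (simp_all add: B_def bclinearD[OF lin] cinner_scaleC_left cinner_scaleC_right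
        blinfun.minus_right cinner.minus_left cinner.minus_right)
  have "y + \<i> *\<^sub>C x = \<i> *\<^sub>C (x - \<i> *\<^sub>C y)" "y - \<i> *\<^sub>C x = - (\<i> *\<^sub>C (x + \<i> *\<^sub>C y))"
    by (simp_all add: scaleC_add_right scaleC.diff_right scaleC_scaleC scaleC.minus_left)
  then have "4 * cinner x (X y) = B (x + y) - B (x - y) + \<i> * (B (x - \<i> *\<^sub>C y) - B (x + \<i> *\<^sub>C y))"
    using polarization[OF lin, of x y] inv inv(2)[of "x - y"] by (simp add: B_def add.commute)
  also have "\<dots> = cnj (4 * cinner y (X x))"
    unfolding polarization[OF lin, of y x] by (simp add: B_def[symmetric] real algebra_simps)
  finally show ?thesis using cinner_commute[of "X x" y] by simp
qed

text \<open>Positivity at \<open>v - t *\<^sub>R w\<close> with \<open>w = X v\<close> compares a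
  term linear in \<open>t\<close> with a quadratic one; as \<open>t\<close> tends to 0 this forces
  \<open>w = 0\<close>.\<close>

lemma positive_op_kernel:
  assumes X: "positive_op X" and 0: "Re (cinner v (X v)) = 0"
  shows "X v = 0"
proof -
  define w where "w = X v"
  define b where "b = Re (cinner w (X w))"
  have nonneg: "0 \<le> Re (cinner z (X z))" for z using X by (auto simp: positive_op_def)
  have sym: "Re (cinner v (X w)) = (norm w)\<^sup>2"
    using positive_op_symmetric[OF X, of v w] Re_cinner_self[of w] by (simp add: w_def)
  have "2 * (norm w)\<^sup>2 \<le> t * b" if "0 < t" for t
  proof -
    have "0 \<le> Re (cinner (v - t *\<^sub>R w) (X (v - t *\<^sub>R w)))" by (rule nonneg)
    also have "\<dots> = - 2 * t * (norm w)\<^sup>2 + t * t * b"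
      using 0 sym by (simp add: cinner.diff_left cinner.diff_right blinfun.diff_right blinfun.scaleR_right
          cinner.scaleR_left cinner.scaleR_right b_def w_def[symmetric] cinner_self algebra_simps)
    finally have "0 \<le> t * (t * b - 2 * (norm w)\<^sup>2)" by (simp add: algebra_simps)
    then show ?thesis using that by (simp add: zero_le_mult_iff)
  qed
  note le = this
  have "(norm w)\<^sup>2 \<le> 0"
  proof (rule ccontr)
    assume "\<not> (norm w)\<^sup>2 \<le> 0"
    then have pos: "0 < (norm w)\<^sup>2" by simp
    have "0 \<le> b" using nonneg by (simp add: b_def)
    \<comment> \<open>A value of \<open>t\<close> small enough that \<open>t * b\<close> is at most
      \<open>(norm w)\<^sup>2\<close>; the added 1 covers \<open>b = 0\<close>.\<close>
    have "2 * (norm w)\<^sup>2 \<le> ((norm w)\<^sup>2 / (b + 1)) * b"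
      by (rule le) (use pos \<open>0 \<le> b\<close> in auto)
    also have "\<dots> \<le> (norm w)\<^sup>2"
      using \<open>0 \<le> b\<close> pos by (simp add: divide_le_eq mult_left_mono)
    finally show False using pos by simp
  qed
  then show ?thesis by (simp add: w_def)
qed

text \<open>By Schwarz reflection the function extends holomorphically across the real axis.\<close>

lemma strip_vanishes:
  fixes f :: "complex \<Rightarrow> complex"
  assumes s: "0 < s" and cont: "continuous_on {w. 0 \<le> Im w \<and> Im w \<le> s} f"
    and holo: "f holomorphic_on {w. 0 < Im w \<and> Im w < s}"
    and real: "\<And>t. f (complex_of_real t) = 0"
  shows "f (\<i> * complex_of_real s) = 0"
proof -
  define S where "S = {w. - s < Im w} \<inter> {w. Im w < s}"
  have S: "open S" unfolding S_def
    by (intro open_Int open_Collect_less continuous_intros)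
  have conn: "connected S" unfolding S_def
    by (intro convex_connected convex_Int convex_halfspace_Im_lt convex_halfspace_Im_gt)
  define g where "g z = (if 0 \<le> Im z then f z else cnj (f (cnj z)))" for z
  have g: "g holomorphic_on S"
    unfolding g_def
  proof (rule Schwarz_reflection[OF S])
    show "cnj ` S \<subseteq> S" by (auto simp: S_def)
    show "f holomorphic_on (S \<inter> {z. 0 < Im z})"
      by (rule holomorphic_on_subset[OF holo]) (auto simp: S_def)
    show "continuous_on (S \<inter> {z. 0 \<le> Im z}) f"
      by (rule continuous_on_subset[OF cont]) (auto simp: S_def)
    show "f z \<in> \<real>" if "z \<in> S" "z \<in> \<real>" for z
      using that(2) real by (auto elim!: Reals_cases)
  qed
  have zero: "g z = 0" if "z \<in> S" for z
  proof (rule analytic_continuation[OF g S conn])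
    show "\<real> \<inter> S \<subseteq> S" by blast
    show "0 \<in> S" using s by (simp add: S_def)
    show "0 islimpt (\<real> \<inter> S)"
      unfolding islimpt_approachable
    proof (intro allI impI)
      fix e :: real
      assume "0 < e"
      then have "complex_of_real (e / 2) \<in> \<real> \<inter> S" "complex_of_real (e / 2) \<noteq> 0"
        "dist (complex_of_real (e / 2)) 0 < e"
        using s by (auto simp: S_def simp del: of_real_divide)
      then show "\<exists>x'\<in>\<real> \<inter> S. x' \<noteq> 0 \<and> dist x' 0 < e" by blast
    qed
    show "g z = 0" if "z \<in> \<real> \<inter> S" for z
      using that real by (auto simp: g_def elim!: Reals_cases)
  qed fact
  \<comment> \<open>Points below the upper edge, where \<open>g\<close> is known to vanish; on the
    edge itself only continuity of \<open>f\<close> is available.\<close>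
  define w where "w n = \<i> * complex_of_real (s - s / real (Suc (Suc n)))" for n
  have lim: "w \<longlonglongrightarrow> \<i> * complex_of_real (s - 0)"
    unfolding w_def
    by (intro tendsto_intros LIMSEQ_Suc[OF LIMSEQ_Suc[OF lim_const_over_n]])
  have w: "0 \<le> Im (w n)" "Im (w n) < s" for n
    using s by (auto simp: w_def field_simps)
  have "f (w n) = 0" for n
    using zero[of "w n"] w[of n] s by (simp add: g_def S_def)
  moreover have "(\<lambda>n. f (w n)) \<longlonglongrightarrow> f (\<i> * complex_of_real s)"
    by (rule continuous_on_tendsto_compose[OF cont])
       (use lim w s in \<open>auto simp: less_imp_le\<close>)
  ultimately show ?thesis by (simp add: LIMSEQ_const_iff)
qed

text \<open>The decomposition of the Hilbert space, freed from \<open>a\<close> and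
  \<open>b\<close>. \<open>J i\<close> takes the component in the image of \<open>K\<close> under
  \<open>e i\<close>, \<open>D t\<close> stands for the power \<open>2it\<close> of
  \<open>|b|\<close>, \<open>cut n\<close> is a truncation, and the generators in \<open>G\<close>
  are shifts by \<open>d\<close> restricted to an index set \<open>I\<close>.\<close>

locale weighted_shifts =
  fixes q :: real and K :: "'h::chilbert set" and \<xi> :: 'h
    and e :: "int \<times> int \<Rightarrow> ('h \<Rightarrow>\<^sub>L 'h)" and J :: "int \<times> int \<Rightarrow> ('h \<Rightarrow>\<^sub>L 'h)"
    and D :: "real \<Rightarrow> ('h \<Rightarrow>\<^sub>L 'h)" and cut :: "nat \<Rightarrow> ('h \<Rightarrow>\<^sub>L 'h)"
    and G :: "('h \<Rightarrow>\<^sub>L 'h) set"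
  assumes q: "0 < q" "q < 1"
    and \<xi>: "\<xi> \<in> K" "norm \<xi> = 1"
    and K: "\<And>x y. x \<in> K \<Longrightarrow> y \<in> K \<Longrightarrow> x - y \<in> K" "\<And>c x. x \<in> K \<Longrightarrow> c *\<^sub>C x \<in> K"
    and e_bclinear: "\<And>i. bclinear (e i)"
    and e_cinner: "\<And>i j x y. x \<in> K \<Longrightarrow> y \<in> K \<Longrightarrow> cinner (e i x) (e j y) = (if i = j then cinner x y else 0)"
    and op_ext: "\<And>(X :: 'h \<Rightarrow>\<^sub>L 'h) (Y :: 'h \<Rightarrow>\<^sub>L 'h). 
      (\<And>i x. x \<in> K \<Longrightarrow> blinfun_apply X (e i x) = blinfun_apply Y (e i x)) \<Longrightarrow> X = Y"
    and J_range: "\<And>i x. J i x \<in> e i ` K"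
    and J_cinner: "\<And>i x y. x \<in> K \<Longrightarrow> cinner (e i x) (J i y) = cinner (e i x) y"
    and J_parseval: "\<And>x. (\<integral>\<^sup>+i. ennreal ((norm (J i x))\<^sup>2) \<partial>count_space UNIV) = ennreal ((norm x)\<^sup>2)"
    and D_adj: "\<And>t. adj_pair (D t) (D (- t))"
    and D_e: "\<And>t i x. x \<in> K \<Longrightarrow> D t (e i x) = cis (2 * t * (of_int (snd i) * ln q)) *\<^sub>C e i x"
    and cut_proj: "\<And>n. orth_projection (cut n)"
    and cut_e: "\<And>n i x. x \<in> K \<Longrightarrow>
      cut n (e i x) = (if \<bar>fst i\<bar> \<le> int n \<and> - int n \<le> snd i then e i x else 0)"
    and G_adj: "\<And>X. X \<in> G \<Longrightarrow> \<exists>Y. adj_pair X Y"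
    and G_e: "\<And>X. X \<in> G \<Longrightarrow> \<exists>d I. \<forall>i. \<forall>x\<in>K. X (e i x) = (if i \<in> I then e (i + d) x else 0)"
    and G_cut: "\<And>X n. X \<in> G \<Longrightarrow> cut n o\<^sub>L X o\<^sub>L cut n \<in> insert 0 G"
    and G_cut_eventually: "\<And>X. X \<in> G \<Longrightarrow> \<exists>n0. \<forall>n\<ge>n0. cut n o\<^sub>L X o\<^sub>L cut n = X"
begin

definition A :: "('h \<Rightarrow>\<^sub>L 'h) set" where "A = closure (cs.span G)"

definition \<psi> :: "('h \<Rightarrow>\<^sub>L 'h) \<Rightarrow> ennreal" where
  "\<psi> X = (\<integral>\<^sup>+i. ennreal (q powi (2 * snd i) * Re (cinner (e i \<xi>) (X (e i \<xi>)))) \<partial>count_space UNIV)"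

definition \<sigma> :: "real \<Rightarrow> ('h \<Rightarrow>\<^sub>L 'h) \<Rightarrow> ('h \<Rightarrow>\<^sub>L 'h)" where
  "\<sigma> t X = D t o\<^sub>L X o\<^sub>L D (- t)"

lemma e_lin: "e i (c *\<^sub>C x) = c *\<^sub>C e i x"
  by (rule bclinearD[OF e_bclinear])

lemma e_norm: "x \<in> K \<Longrightarrow> norm (e i x) = norm x"
  using e_cinner[of x x i i] by (simp add: norm_eq_sqrt_cinner)

lemma A_induct [consumes 1, case_names closed zero add]:
  assumes "X \<in> A" "closed {X. P X}" "P 0" "\<And>c X Y. X \<in> G \<Longrightarrow> P Y \<Longrightarrow> P (cscale c X + Y)"
  shows "P X"
proof -
  have "cs.span G \<subseteq> {X. P X}"
  proof
    fix X assume "X \<in> cs.span G"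
    then show "X \<in> {X. P X}"
      by (induction rule: cs.span_induct_alt) (use assms in auto)
  qed
  then have "A \<subseteq> {X. P X}" unfolding A_def using assms(2) by (rule closure_minimal)
  then show ?thesis using assms(1) by blast
qed

lemma A_adj:
  assumes "X \<in> A"
  obtains Y where "adj_pair X Y"
proof -
  have "\<exists>Y. adj_pair X Y"
    using assms
  proof (induction rule: A_induct)
    case closed
    show ?case
      unfolding closed_sequential_limits
    proof (intro allI impI; elim conjE)
      fix X :: "nat \<Rightarrow> 'h \<Rightarrow>\<^sub>L 'h" and L
      assume X: "\<forall>n. X n \<in> {X. \<exists>Y. adj_pair X Y}" and "X \<longlonglongrightarrow> L"
      from X choice[of "\<lambda>n. adj_pair (X n)"] obtain Y where "\<And>n. adj_pair (X n) (Y n)" by blast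
      with \<open>X \<longlonglongrightarrow> L\<close> show "L \<in> {X. \<exists>Y. adj_pair X Y}"
        using adj_pair_limit by blast
    qed
  next
    case zero
    show ?case using adj_pair_simps(1) by blast
  next
    case (add c X Y)
    then show ?case using G_adj[of X] adj_pair_simps(3,6) by meson
  qed
  with that show thesis by blast
qed

lemma A_bclinear: "X \<in> A \<Longrightarrow> bclinear X"
  using A_adj adj_pair_bclinear by metis

lemma A_badj: "X \<in> A \<Longrightarrow> adj_pair X (badj X)"
  using A_adj badj_eqI by metis

text \<open>Elements of \<open>A\<close> have the form \<open>x \<otimes> 1\<close> with respect to \<open>H = \<ell>\<^sup>2(\<int>\<^sup>2) \<otimes> K\<close>.\<close>

definition amplified :: "('h \<Rightarrow>\<^sub>L 'h) \<Rightarrow> bool" where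
  "amplified X \<longleftrightarrow> (\<forall>i j. \<forall>x\<in>K. \<forall>y\<in>K.
     cinner (e i x) (X (e j y)) = cinner (e i \<xi>) (X (e j \<xi>)) * cinner x y)"

lemma amplifiedD:
  "amplified X \<Longrightarrow> x \<in> K \<Longrightarrow> y \<in> K \<Longrightarrow>
    cinner (e i x) (X (e j y)) = cinner (e i \<xi>) (X (e j \<xi>)) * cinner x y"
  unfolding amplified_def by blast

lemma A_amplified: "X \<in> A \<Longrightarrow> amplified X"
proof (induction rule: A_induct)
  case closed
  have "{X. amplified X} = (\<Inter>i j. \<Inter>x\<in>K. \<Inter>y\<in>K.
      {X :: 'h \<Rightarrow>\<^sub>L 'h. cinner (e i x) (X (e j y)) = cinner (e i \<xi>) (X (e j \<xi>)) * cinner x y})"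
    by (auto simp: amplified_def)
  moreover have "closed {X :: 'h \<Rightarrow>\<^sub>L 'h. cinner (e i x) (X (e j y)) = cinner (e i \<xi>) (X (e j \<xi>)) * cinner x y}" for i j x y
    by (intro closed_Collect_eq continuous_intros cinner.continuous_on blinfun.continuous_on)
  ultimately show ?case by (simp add: closed_INT)
next
  case zero
  show ?case by (simp add: amplified_def)
next
  case (add c X Y)
  obtain d I where X: "\<And>i x. x \<in> K \<Longrightarrow> X (e i x) = (if i \<in> I then e (i + d) x else 0)"
    using G_e[OF add(1)] by blast
  have "cinner \<xi> \<xi> = 1" using \<xi> by (simp add: cinner_self)
  moreover have "cinner (e i x) (X (e j y)) = (if j \<in> I \<and> i = j + d then cinner x y else 0)"
    if "x \<in> K" "y \<in> K" for i j x y
    using that by (simp add: X e_cinner)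
  ultimately have "cinner (e i x) ((cscale c X + Y) (e j y))
      = cinner (e i \<xi>) ((cscale c X + Y) (e j \<xi>)) * cinner x y" if "x \<in> K" "y \<in> K" for i j x y
    using amplifiedD[OF add(2) that, of i j] that \<xi>(1)
    by (simp add: blinfun.add_left cscale.rep_eq cinner_add_right cinner_scaleC_right distrib_right)
  then show ?case unfolding amplified_def by blast
qed

text \<open>A column of \<open>X\<close> might have components \<open>e i y\<close> with
  \<open>y\<close> transverse to \<xi>. Amplification excludes them: the deviation \<open>d\<close>
  of \<open>y\<close> from its multiple of \<xi> satisfies
  \<open>cinner (e i d) (e i d) = 0\<close>. Otherwise the norm of a column would not be determined
  by the entries at \<xi>.\<close>

lemma amplified_J:
  assumes X: "amplified X"
  shows "J i (X (e j \<xi>)) = cinner (e i \<xi>) (X (e j \<xi>)) *\<^sub>C e i \<xi>"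
proof -
  define c where "c = cinner (e i \<xi>) (X (e j \<xi>))"
  obtain y where y: "y \<in> K" "J i (X (e j \<xi>)) = e i y" using J_range by blast
  define d where "d = y - c *\<^sub>C \<xi>"
  have d: "d \<in> K" using y \<xi> K by (simp add: d_def)
  have "e i d = J i (X (e j \<xi>)) - c *\<^sub>C e i \<xi>" by (simp add: d_def blinfun.diff_right e_lin y)
  then have "cinner (e i d) (e i d) = cinner (e i d) (X (e j \<xi>)) - c * cinner (e i d) (e i \<xi>)"
    using d by (metis J_cinner cinner.diff_right cinner_scaleC_right)
  also have "\<dots> = 0" using amplifiedD[OF X d \<xi>(1), of i j] d \<xi> by (simp add: c_def e_cinner)
  finally have "e i d = 0" using Re_cinner_self[of "e i d"] by simp
  then show ?thesis by (simp add: d_def blinfun.diff_right e_lin y c_def)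
qed

lemma amplified_norm:
  assumes "amplified X"
  shows "ennreal ((norm (X (e j \<xi>)))\<^sup>2)
    = (\<integral>\<^sup>+i. ennreal ((cmod (cinner (e i \<xi>) (X (e j \<xi>))))\<^sup>2) \<partial>count_space UNIV)"
proof -
  have "ennreal ((norm (X (e j \<xi>)))\<^sup>2) = (\<integral>\<^sup>+i. ennreal ((norm (J i (X (e j \<xi>))))\<^sup>2) \<partial>count_space UNIV)"
    by (rule J_parseval[symmetric])
  then show ?thesis by (simp add: amplified_J[OF assms] norm_scaleC e_norm \<xi>)
qed

lemma amplified_adj:
  assumes X: "amplified X" and XY: "adj_pair X Y"
  shows "amplified Y"
  unfolding amplified_def
proof (intro allI ballI)
  have eq: "cinner (e i x) (Y (e j y)) = cnj (cinner (e j y) (X (e i x)))" for i j x y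
    by (metis adj_pairD[OF XY] cinner_commute)
  show "cinner (e i x) (Y (e j y)) = cinner (e i \<xi>) (Y (e j \<xi>)) * cinner x y"
    if "x \<in> K" "y \<in> K" for i j x y
    unfolding eq amplifiedD[OF X that(2,1), of j i] using cinner_commute[of x y] by simp
qed

text \<open>The columns at the single vector \<xi> give the entries at all of \<open>K\<close>,
  hence the components under every \<open>J i\<close>.\<close>

lemma amplified_eq_0:
  assumes X: "amplified X" and 0: "\<And>j. X (e j \<xi>) = 0"
  shows "X = 0"
proof (rule op_ext)
  fix j y
  assume y: "y \<in> K"
  have "J i (X (e j y)) = 0" for i
  proof -
    obtain x where x: "x \<in> K" "J i (X (e j y)) = e i x" using J_range by blast
    then have "cinner (J i (X (e j y))) (J i (X (e j y))) = cinner (e i x) (X (e j y))"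
      by (metis J_cinner)
    also have "\<dots> = 0" using amplifiedD[OF X x(1) y] by (simp add: 0)
    finally show ?thesis using Re_cinner_self[of "J i (X (e j y))"] by simp
  qed
  then have "ennreal ((norm (X (e j y)))\<^sup>2) = 0"
    by (subst J_parseval[symmetric]) simp
  then show "X (e j y) = blinfun_apply 0 (e j y)" by (simp add: ennreal_eq_0_iff)
qed

section \<open>The weight property, semicontinuity and faithfulness\<close>

lemma pos_partD:
  assumes "X \<in> pos_part A"
  shows "X \<in> A" "positive_op X" "0 \<le> Re (cinner x (X x))"
  using assms by (auto simp: pos_part_def positive_op_def)

lemma weight_term_nonneg: "X \<in> pos_part A \<Longrightarrow> 0 \<le> q powi n * Re (cinner x (X x))"
  using pos_partD(3)[of X x] q by simp

lemma weight: "is_weight A \<psi>"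
  unfolding is_weight_def
proof (intro conjI ballI allI impI)
  fix X Y
  assume XY: "X \<in> pos_part A" "Y \<in> pos_part A"
  show "\<psi> (X + Y) = \<psi> X + \<psi> Y"
    unfolding \<psi>_def using XY
    by (subst nn_integral_add[symmetric])
       (auto simp: blinfun.add_left cinner_add_right distrib_left ennreal_plus weight_term_nonneg)
next
  fix X and c :: real
  assume X: "X \<in> pos_part A" and c: "0 \<le> c"
  have "ennreal (q powi (2 * snd i) * Re (cinner (e i \<xi>) ((c *\<^sub>R X) (e i \<xi>))))
    = ennreal c * ennreal (q powi (2 * snd i) * Re (cinner (e i \<xi>) (X (e i \<xi>))))" for i
    using c by (simp add: blinfun.scaleR_left cinner.scaleR_right ennreal_mult'[symmetric] mult.left_commute)
  then show "\<psi> (c *\<^sub>R X) = ennreal c * \<psi> X"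
    unfolding \<psi>_def by (simp add: nn_integral_cmult)
qed

text \<open>Every term of the sum is norm continuous in \<open>X\<close>, and Fatou's lemma bounds
  the sum of the limits.\<close>

lemma lsc: "lsc_weight A \<psi>"
  unfolding lsc_weight_def
proof
  fix c
  have "closed {X. \<psi> X \<le> c}"
    unfolding closed_sequential_limits
  proof (intro allI impI; elim conjE)
    fix X :: "nat \<Rightarrow> 'h \<Rightarrow>\<^sub>L 'h" and L
    assume X: "\<forall>n. X n \<in> {X. \<psi> X \<le> c}" and lim: "X \<longlonglongrightarrow> L"
    have lim_i: "(\<lambda>n. ennreal (q powi (2 * snd i) * Re (cinner (e i \<xi>) (X n (e i \<xi>)))))
      \<longlonglongrightarrow> ennreal (q powi (2 * snd i) * Re (cinner (e i \<xi>) (L (e i \<xi>))))" for i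
      by (intro tendsto_ennrealI tendsto_mult tendsto_Re cinner.tendsto blinfun.tendsto lim tendsto_const)
    have "\<psi> L = (\<integral>\<^sup>+i. liminf (\<lambda>n. ennreal (q powi (2 * snd i) * Re (cinner (e i \<xi>) (X n (e i \<xi>))))) \<partial>count_space UNIV)"
      unfolding \<psi>_def by (intro nn_integral_cong lim_imp_Liminf[OF _ lim_i, symmetric]) simp
    also have "\<dots> \<le> liminf (\<lambda>n. \<psi> (X n))"
      unfolding \<psi>_def by (rule nn_integral_liminf) simp
    also have "\<dots> \<le> c" using X by (intro Liminf_le) auto
    finally show "L \<in> {X. \<psi> X \<le> c}" by simp
  qed
  then have "closedin (top_of_set (pos_part A)) (pos_part A \<inter> {X. \<psi> X \<le> c})"
    by (rule closedin_closed_Int)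
  then show "closedin (top_of_set (pos_part A)) {X \<in> pos_part A. \<psi> X \<le> c}"
    by (simp add: Collect_conj_eq)
qed

text \<open>A zero of the form of a positive operator lies in its kernel, so all columns at \<xi>
  vanish, and these detect \<open>X\<close>.\<close>

lemma faithful: "faithful_weight A \<psi>"
  unfolding faithful_weight_def
proof (intro ballI impI)
  fix X
  assume X: "X \<in> pos_part A" and "\<psi> X = 0"
  then have "ennreal (q powi (2 * snd i) * Re (cinner (e i \<xi>) (X (e i \<xi>)))) = 0" for i
    unfolding \<psi>_def
    by (subst (asm) nn_integral_0_iff_AE) (simp_all add: AE_count_space del: split_paired_All)
  then have "q powi (2 * snd i) * Re (cinner (e i \<xi>) (X (e i \<xi>))) \<le> 0" for i
    by (simp only: ennreal_eq_0_iff)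
  then have "Re (cinner (e i \<xi>) (X (e i \<xi>))) = 0" for i
    using q pos_partD(3)[OF X, of "e i \<xi>"] by (metis mult_le_0_iff not_less order_antisym zero_less_power_int)
  then have "X (e i \<xi>) = 0" for i using positive_op_kernel[OF pos_partD(2)[OF X]] by blast
  then show "X = 0" using amplified_eq_0 A_amplified pos_partD(1)[OF X] by blast
qed

section \<open>Truncation and dense definition\<close>

lemma cut_norm: "norm (cut n) \<le> 1"
proof (rule norm_blinfun_bound)
  fix x
  have "(norm (cut n x))\<^sup>2 = cmod (cinner x (cut n x))"
    unfolding orth_projection_cinner[OF cut_proj] by (simp add: norm_power)
  also have "\<dots> \<le> norm x * norm (cut n x)" by (rule cauchy_schwarz)
  finally show "norm (cut n x) \<le> 1 * norm x"
    by (cases "cut n x = 0") (simp_all add: power2_eq_square)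
qed simp

lemma cut_compress_norm: "norm (cut n o\<^sub>L X o\<^sub>L cut n) \<le> norm X"
proof -
  have "norm (cut n o\<^sub>L X o\<^sub>L cut n) \<le> norm (cut n) * norm X * norm (cut n)"
    by (intro order_trans[OF norm_blinfun_compose] mult_right_mono norm_blinfun_compose) simp
  also have "\<dots> \<le> 1 * norm X * 1"
    by (intro mult_mono cut_norm) auto
  finally show ?thesis by simp
qed

lemma compose_lin3:
  assumes "bclinear X"
  shows "X o\<^sub>L (cscale c Y + Z) o\<^sub>L W = cscale c (X o\<^sub>L Y o\<^sub>L W) + (X o\<^sub>L Z o\<^sub>L W)"
  by (rule blinfun_eqI) (simp add: blinfun.add_left blinfun.add_right cscale.rep_eq bclinearD[OF assms])

lemma continuous_compose3: "continuous_on UNIV (\<lambda>Y. X o\<^sub>L Y o\<^sub>L (W :: 'h \<Rightarrow>\<^sub>L 'h))"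
  by (intro bounded_bilinear.continuous_on[OF bounded_bilinear_blinfun_compose] continuous_intros)

lemma A_closed: "closed A"
  by (simp add: A_def)

lemma A_sequence:
  assumes "X \<in> A"
  obtains Y where "\<And>n. Y n \<in> cs.span G" "Y \<longlonglongrightarrow> X"
  using assms unfolding A_def closure_sequential by blast

lemma A_compress:
  assumes X: "X \<in> A"
  shows "cut n o\<^sub>L X o\<^sub>L cut n \<in> A"
  using X
proof (induction rule: A_induct)
  case closed
  have "closed ((\<lambda>X. cut n o\<^sub>L X o\<^sub>L cut n) -` A)"
    by (rule closed_vimage[OF A_closed continuous_compose3])
  then show ?case by (simp add: vimage_def)
next
  case zero
  show ?case using closure_subset[of "cs.span G"] cs.span_zero by (auto simp: A_def)
next
  case (add c X Y)
  obtain y where y: "\<And>n. y n \<in> cs.span G" "y \<longlonglongrightarrow> (cut n o\<^sub>L Y o\<^sub>L cut n)"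
    using A_sequence[OF add(2)] by metis
  have "cut n o\<^sub>L X o\<^sub>L cut n \<in> cs.span G"
    using G_cut[OF add(1), of n] cs.span_base[of _ G] cs.span_zero by auto
  then have "cscale c (cut n o\<^sub>L X o\<^sub>L cut n) + y k \<in> cs.span G" for k
    using y by (intro cs.span_add cs.span_scale)
  moreover have "(\<lambda>k. cscale c (cut n o\<^sub>L X o\<^sub>L cut n) + y k)
    \<longlonglongrightarrow> cscale c (cut n o\<^sub>L X o\<^sub>L cut n) + (cut n o\<^sub>L Y o\<^sub>L cut n)"
    by (intro tendsto_intros y)
  ultimately have "cscale c (cut n o\<^sub>L X o\<^sub>L cut n) + (cut n o\<^sub>L Y o\<^sub>L cut n) \<in> A"
    unfolding A_def closure_sequential by (intro exI conjI allI)
  then show ?case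
    by (simp add: compose_lin3 orth_projection_bclinear[OF cut_proj])
qed

text \<open>Compression is contractive and leaves each generator unchanged from some
  \<open>n\<close> on, so convergence on the span passes to the closure.\<close>

lemma compress_tendsto:
  assumes X: "X \<in> A"
  shows "(\<lambda>n. cut n o\<^sub>L X o\<^sub>L cut n) \<longlonglongrightarrow> X"
proof -
  have span: "(\<lambda>n. cut n o\<^sub>L Y o\<^sub>L cut n) \<longlonglongrightarrow> Y" if "Y \<in> cs.span G" for Y
    using that
  proof (induction rule: cs.span_induct_alt)
    case base
    show ?case by simp
  next
    case (step c X Y)
    have "(\<lambda>n. cut n o\<^sub>L X o\<^sub>L cut n) \<longlonglongrightarrow> X"
      using G_cut_eventually[OF step(1)] by (intro tendsto_eventually) (auto simp: eventually_sequentially)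
    with step(2) have "(\<lambda>n. cscale c (cut n o\<^sub>L X o\<^sub>L cut n) + (cut n o\<^sub>L Y o\<^sub>L cut n)) \<longlonglongrightarrow> cscale c X + Y"
      by (intro tendsto_add cscale.tendsto tendsto_const)
    then show ?case by (simp add: compose_lin3 orth_projection_bclinear[OF cut_proj])
  qed
  show ?thesis
  proof (rule LIMSEQ_I)
    fix r :: real
    assume r: "0 < r"
    then obtain Y where Y: "Y \<in> cs.span G" "dist Y X < r / 3"
      using X unfolding A_def closure_approachable by (metis zero_less_divide_iff zero_less_numeral)
    obtain n0 where n0: "\<And>n. n \<ge> n0 \<Longrightarrow> norm ((cut n o\<^sub>L Y o\<^sub>L cut n) - Y) < r / 3"
      using LIMSEQ_D[OF span[OF Y(1)], of "r / 3"] r by auto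
    have "norm ((cut n o\<^sub>L X o\<^sub>L cut n) - X) < r" if "n \<ge> n0" for n
    proof -
      have "(cut n o\<^sub>L X o\<^sub>L cut n) - X
        = (cut n o\<^sub>L (X - Y) o\<^sub>L cut n) + ((cut n o\<^sub>L Y o\<^sub>L cut n) - Y) + (Y - X)"
        by (rule blinfun_eqI) (simp add: blinfun.add_left blinfun.diff_left blinfun.diff_right)
      then have "norm ((cut n o\<^sub>L X o\<^sub>L cut n) - X) \<le> norm (X - Y) + norm ((cut n o\<^sub>L Y o\<^sub>L cut n) - Y) + norm (Y - X)"
        using cut_compress_norm[of n "X - Y"]
        by (simp only:) (intro norm_triangle_le add_mono order_refl | assumption)+
      then show ?thesis using n0[OF that] Y(2) by (simp add: dist_norm norm_minus_commute)
    qed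
    then show "\<exists>n0. \<forall>n\<ge>n0. norm ((cut n o\<^sub>L X o\<^sub>L cut n) - X) < r" by blast
  qed
qed

text \<open>Truncation leaves finitely many first coordinates, and second coordinates from
  \<open>- int n\<close> on; there the weights form a convergent geometric series in
  \<open>q\<^sup>2\<close>.\<close>

lemma weight_compress_finite:
  assumes X: "X \<in> pos_part A"
  shows "\<psi> (cut n o\<^sub>L X o\<^sub>L cut n) < \<infinity>"
proof -
  define w where "w k = (if - int n \<le> k then ennreal (norm X * q powi (2 * k)) else 0)" for k
  define v where "v i = (if \<bar>fst i\<bar> \<le> int n then w (snd i) else 0)" for i :: "int \<times> int"
  have "\<psi> (cut n o\<^sub>L X o\<^sub>L cut n) \<le> (\<integral>\<^sup>+i. v i \<partial>count_space UNIV)"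
    unfolding \<psi>_def
  proof (intro nn_integral_mono)
    fix i :: "int \<times> int"
    have c: "cinner (e i \<xi>) (cut n x) = cinner (cut n (e i \<xi>)) x" for x
      by (simp add: adj_pairD[OF orth_projection_adj[OF cut_proj]])
    have "Re (cinner (e i \<xi>) (X (e i \<xi>))) \<le> norm X"
    proof -
      have "Re (cinner (e i \<xi>) (X (e i \<xi>))) \<le> norm (e i \<xi>) * norm (X (e i \<xi>))"
        using complex_Re_le_cmod cauchy_schwarz order_trans by blast
      also have "\<dots> \<le> norm (e i \<xi>) * (norm X * norm (e i \<xi>))"
        by (intro mult_left_mono norm_blinfun) simp
      finally show ?thesis by (simp add: e_norm \<xi>)
    qed
    then have "q powi (2 * snd i) * Re (cinner (e i \<xi>) (X (e i \<xi>))) \<le> norm X * q powi (2 * snd i)"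
      using q by (simp add: mult.commute[of "norm X"] mult_left_mono)
    then show "ennreal (q powi (2 * snd i) * Re (cinner (e i \<xi>) ((cut n o\<^sub>L X o\<^sub>L cut n) (e i \<xi>)))) \<le> v i"
      by (simp add: c cut_e \<xi> v_def w_def ennreal_leI)
  qed
  also have "\<dots> = (\<integral>\<^sup>+m. \<integral>\<^sup>+k. v (m, k) \<partial>count_space UNIV \<partial>count_space UNIV)"
    by (rule nn_integral_fst_count_space[symmetric])
  also have "\<dots> = (\<integral>\<^sup>+m. (\<integral>\<^sup>+k. w k \<partial>count_space UNIV) * indicator {- int n..int n} m \<partial>count_space UNIV)"
    by (intro nn_integral_cong) (auto simp: v_def indicator_def abs_le_iff)
  also have "\<dots> = (\<integral>\<^sup>+k. w k \<partial>count_space UNIV) * of_nat (card {- int n..int n})"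
    by (subst nn_integral_cmult_indicator) auto
  also have "\<dots> < \<infinity>"
  proof -
    have "(\<integral>\<^sup>+k. w k \<partial>count_space UNIV)
      = (\<integral>\<^sup>+k. ennreal (norm X * q powi (2 * k)) * indicator {- int n..} k \<partial>count_space UNIV)"
      by (intro nn_integral_cong) (auto simp: w_def indicator_def)
    also have "\<dots> = (\<integral>\<^sup>+k. ennreal (norm X * q powi (2 * k)) \<partial>count_space {- int n..})"
      by (simp add: nn_integral_count_space_indicator)
    also have "\<dots> = (\<integral>\<^sup>+j. ennreal (norm X * q powi (2 * (int j - int n))) \<partial>count_space UNIV)"
    proof (rule nn_integral_bij_count_space[symmetric])
      show "bij_betw (\<lambda>j. int j - int n) UNIV {- int n..}"
        by (rule bij_betw_byWitness[where f' = "\<lambda>k. nat (k + int n)"]) auto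
    qed
    also have "\<dots> = (\<Sum>j. ennreal (norm X * q powi (- 2 * int n) * (q\<^sup>2) ^ j))"
    proof -
      have "q powi (2 * (int j - int n)) = q powi (- 2 * int n) * (q\<^sup>2) ^ j" for j
      proof -
        have "q powi (2 * (int j - int n)) = q powi (- 2 * int n + int (2 * j))" by (simp add: algebra_simps)
        also have "\<dots> = q powi (- 2 * int n) * q powi (int (2 * j))"
          using q by (subst power_int_add) auto
        also have "q powi (int (2 * j)) = (q\<^sup>2) ^ j"
          by (simp only: power_int_of_nat power_mult)
        finally show ?thesis .
      qed
      then show ?thesis by (simp add: nn_integral_count_space_nat mult.assoc)
    qed
    also have "\<dots> < \<infinity>"
    proof -
      have "q\<^sup>2 < 1" using q by (simp add: power_less_one_iff)
      then have "summable (\<lambda>j. norm X * q powi (- 2 * int n) * (q\<^sup>2) ^ j)"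
        by (intro summable_mult summable_geometric) simp
      then have "(\<Sum>j. ennreal (norm X * q powi (- 2 * int n) * (q\<^sup>2) ^ j)) \<noteq> top"
        by (rule ennreal_suminf_neq_top) (use q in \<open>intro mult_nonneg_nonneg; simp\<close>)
      then show ?thesis by (simp only: less_top infinity_ennreal_def)
    qed
    finally show ?thesis by (simp add: ennreal_mult_less_top of_nat_less_top)
  qed
  finally show ?thesis .
qed

lemma densely_defined: "densely_defined_weight A \<psi>"
  unfolding densely_defined_weight_def
proof
  fix X
  assume X: "X \<in> pos_part A"
  have pos: "cut n o\<^sub>L X o\<^sub>L cut n \<in> pos_part A" for n
  proof -
    have "cinner x (cut n (X (cut n x))) = cinner (cut n x) (X (cut n x))" for x
      by (simp add: adj_pairD[OF orth_projection_adj[OF cut_proj]])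
    then have "positive_op (cut n o\<^sub>L X o\<^sub>L cut n)"
      using pos_partD(2)[OF X] A_bclinear[OF A_compress[OF pos_partD(1)[OF X]]]
      by (simp add: positive_op_def)
    then show ?thesis using A_compress[OF pos_partD(1)[OF X]] by (simp add: pos_part_def)
  qed
  show "X \<in> closure {X \<in> pos_part A. \<psi> X < \<infinity>}"
    unfolding closure_sequential
    using compress_tendsto[OF pos_partD(1)[OF X]] weight_compress_finite[OF X] pos
    by (intro exI[of _ "\<lambda>n. cut n o\<^sub>L X o\<^sub>L cut n"]) simp
qed

section \<open>The modular group and the KMS condition\<close>

lemma D_bclinear: "bclinear (D t)"
  by (rule adj_pair_bclinear[OF D_adj])

lemma D_lin: "D t (c *\<^sub>C x) = c *\<^sub>C D t x"
  by (rule bclinearD[OF D_bclinear])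

lemma D_cinner: "cinner (D t x) y = cinner x (D (- t) y)"
  by (rule adj_pairD[OF D_adj])

lemma D_add: "D s o\<^sub>L D t = D (s + t)"
  by (rule op_ext) (simp add: D_e D_lin scaleC_scaleC cis_mult algebra_simps)

lemma D_0: "D 0 = id_blinfun"
  by (rule op_ext) (simp add: D_e)

lemma D_D: "D s (D t x) = D (s + t) x"
  using D_add[of s t] by (metis blinfun_apply_blinfun_compose)

lemma D_norm: "norm (D t x) = norm x"
  by (simp add: norm_eq_sqrt_cinner D_cinner D_D D_0)

lemma \<sigma>_norm: "norm (\<sigma> t X) \<le> norm X"
proof (rule norm_blinfun_bound)
  show "norm (\<sigma> t X x) \<le> norm X * norm x" for x
    using norm_blinfun[of X "D (- t) x"] by (simp add: \<sigma>_def D_norm)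
qed simp

lemma \<sigma>_add: "\<sigma> t (X + Y) = \<sigma> t X + \<sigma> t Y"
  by (rule blinfun_eqI) (simp add: \<sigma>_def blinfun.add_left blinfun.add_right)

lemma \<sigma>_diff: "\<sigma> t (X - Y) = \<sigma> t X - \<sigma> t Y"
  by (rule blinfun_eqI) (simp add: \<sigma>_def blinfun.diff_left blinfun.diff_right)

lemma \<sigma>_cscale: "\<sigma> t (cscale c X) = cscale c (\<sigma> t X)"
  by (rule blinfun_eqI) (simp add: \<sigma>_def cscale.rep_eq D_lin)

lemma \<sigma>_compose: "\<sigma> t (X o\<^sub>L Y) = \<sigma> t X o\<^sub>L \<sigma> t Y"
  by (rule blinfun_eqI) (simp add: \<sigma>_def D_D D_0)

lemma \<sigma>_\<sigma>: "\<sigma> s (\<sigma> t X) = \<sigma> (s + t) X"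
  by (rule blinfun_eqI) (simp add: \<sigma>_def D_D algebra_simps)

lemma \<sigma>_0: "\<sigma> 0 X = X"
  by (rule blinfun_eqI) (simp add: \<sigma>_def D_0)

lemma \<sigma>_adj: "adj_pair X Y \<Longrightarrow> adj_pair (\<sigma> t X) (\<sigma> t Y)"
  using D_cinner[of "- t"] by (simp add: adj_pair_def \<sigma>_def D_cinner)

text \<open>A shift by \<open>d\<close> is an eigenvector of \<sigma>, because the phases before and
  after it differ only through the second component of \<open>d\<close>. Invariance of the algebra
  and continuity of the orbits are read off from this on the span.\<close>

lemma \<sigma>_generator:
  assumes X: "X \<in> G"
  obtains d where "\<And>t. \<sigma> t X = cscale (cis (2 * t * (of_int d * ln q))) X"
proof -
  obtain d I where d: "\<And>i x. x \<in> K \<Longrightarrow> X (e i x) = (if i \<in> I then e (i + d) x else 0)"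
    using G_e[OF X] by blast
  obtain Y where "adj_pair X Y" using G_adj[OF X] by blast
  then have lin: "X (c *\<^sub>C x) = c *\<^sub>C X x" for c x using adj_pair_bclinear bclinearD by blast
  have "\<sigma> t X = cscale (cis (2 * t * (of_int (snd d) * ln q))) X" for t
  proof (rule op_ext)
    fix i x
    assume x: "x \<in> K"
    have "cis (2 * (- t) * (of_int (snd i) * ln q)) * cis (2 * t * (of_int (snd (i + d)) * ln q))
      = cis (2 * t * (of_int (snd d) * ln q))"
      by (simp add: cis_mult algebra_simps)
    then show "\<sigma> t X (e i x) = cscale (cis (2 * t * (of_int (snd d) * ln q))) X (e i x)"
      using D_e[OF x, of "- t" i] D_e[OF x, of t "i + d"]
      by (simp add: \<sigma>_def d[OF x] lin cscale.rep_eq D_lin scaleC_scaleC scaleC.zero_right)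
  qed
  with that show thesis by blast
qed

lemma \<sigma>_tendsto: "Y \<longlonglongrightarrow> X \<Longrightarrow> (\<lambda>n. \<sigma> t (Y n)) \<longlonglongrightarrow> \<sigma> t X"
  unfolding \<sigma>_def
  by (intro bounded_bilinear.tendsto[OF bounded_bilinear_blinfun_compose] tendsto_const)

lemma \<sigma>_A:
  assumes X: "X \<in> A"
  shows "\<sigma> t X \<in> A"
proof -
  have "\<sigma> t Y \<in> cs.span G" if "Y \<in> cs.span G" for Y
    using that
  proof (induction rule: cs.span_induct_alt)
    case base
    have "\<sigma> t 0 = 0" by (rule blinfun_eqI) (simp add: \<sigma>_def)
    then show ?case by (simp add: cs.span_zero)
  next
    case (step c X Y)
    obtain d where "\<sigma> t X = cscale (cis (2 * t * (of_int d * ln q))) X"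
      using \<sigma>_generator[OF step(1)] by metis
    then show ?case
      unfolding \<sigma>_add \<sigma>_cscale using step by (simp add: cs.span_add cs.span_scale cs.span_base)
  qed
  note span = this
  obtain Y where Y: "\<And>n. Y n \<in> cs.span G" "Y \<longlonglongrightarrow> X" using A_sequence[OF X] by metis
  show ?thesis
    unfolding A_def closure_sequential
    using span[OF Y(1)] \<sigma>_tendsto[OF Y(2)] by (intro exI[of _ "\<lambda>n. \<sigma> t (Y n)"]) simp
qed

text \<open>On the span the orbits are trigonometric polynomials; since \<sigma> is contractive,
  approximation in norm is uniform in \<open>t\<close>.\<close>

lemma \<sigma>_continuous:
  assumes X: "X \<in> A"
  shows "continuous_on UNIV (\<lambda>t. \<sigma> t X)"
proof -
  have span: "continuous_on UNIV (\<lambda>t. \<sigma> t Y)" if "Y \<in> cs.span G" for Y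
    using that
  proof (induction rule: cs.span_induct_alt)
    case base
    have "\<sigma> t 0 = 0" for t by (rule blinfun_eqI) (simp add: \<sigma>_def)
    then show ?case by simp
  next
    case (step c X Y)
    obtain d where d: "\<And>t. \<sigma> t X = cscale (cis (2 * t * (of_int d * ln q))) X"
      using \<sigma>_generator[OF step(1)] by metis
    have "continuous_on UNIV (\<lambda>t. cscale c (cscale (cis (2 * t * (of_int d * ln q))) X) + \<sigma> t Y)"
      unfolding cis_conv_exp
      by (intro continuous_on_add step(2) cscale.continuous_on continuous_intros)
    then show ?case by (simp add: \<sigma>_add \<sigma>_cscale d)
  qed
  obtain Y where Y: "\<And>n. Y n \<in> cs.span G" "Y \<longlonglongrightarrow> X" using A_sequence[OF X] by metis
  have unif: "uniform_limit UNIV (\<lambda>n t. \<sigma> t (Y n)) (\<lambda>t. \<sigma> t X) sequentially"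
  proof (rule uniform_limitI)
    fix r :: real
    assume "0 < r"
    then have "\<forall>\<^sub>F n in sequentially. dist (Y n) X < r" using Y(2) by (simp add: tendsto_iff)
    then show "\<forall>\<^sub>F n in sequentially. \<forall>t\<in>UNIV. dist (\<sigma> t (Y n)) (\<sigma> t X) < r"
    proof (rule eventually_mono)
      fix n
      assume "dist (Y n) X < r"
      then show "\<forall>t\<in>UNIV. dist (\<sigma> t (Y n)) (\<sigma> t X) < r"
        unfolding dist_norm \<sigma>_diff[symmetric] using \<sigma>_norm order_le_less_trans by blast
    qed
  qed
  show ?thesis
    by (rule uniform_limit_theorem[OF _ unif]) (use span Y(1) in auto)
qed

lemma automorphism: "automorphism_group A \<sigma>"
  unfolding automorphism_group_def star_automorphism_def
proof (intro conjI allI ballI)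
  fix t
  show "bij_betw (\<sigma> t) A A"
    by (rule bij_betw_byWitness[where f' = "\<sigma> (- t)"]) (auto simp: \<sigma>_\<sigma> \<sigma>_0 \<sigma>_A)
  fix X assume X: "X \<in> A"
  show "\<sigma> t (badj X) = badj (\<sigma> t X)"
    by (rule badj_eqI[OF \<sigma>_adj[OF A_badj[OF X]], symmetric])
qed (simp_all add: \<sigma>_add \<sigma>_compose \<sigma>_cscale \<sigma>_0 \<sigma>_\<sigma> \<sigma>_continuous)

lemma \<sigma>_entry:
  assumes "x \<in> K" "y \<in> K" "bclinear X"
  shows "cinner (e i x) (\<sigma> t X (e j y))
    = cis (2 * t * (of_int (snd i - snd j) * ln q)) * cinner (e i x) (X (e j y))"
proof -
  have "cinner (e i x) (\<sigma> t X (e j y)) = cinner (D (- t) (e i x)) (X (D (- t) (e j y)))"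
    by (simp add: \<sigma>_def D_cinner)
  also have "\<dots> = (cnj (cis (2 * (- t) * (of_int (snd i) * ln q))) * cis (2 * (- t) * (of_int (snd j) * ln q)))
      * cinner (e i x) (X (e j y))"
    unfolding D_e[OF assms(1)] D_e[OF assms(2)] bclinearD[OF assms(3)]
    by (simp add: cinner_scaleC_left cinner_scaleC_right)
  also have "cnj (cis (2 * (- t) * (of_int (snd i) * ln q))) * cis (2 * (- t) * (of_int (snd j) * ln q))
    = cis (2 * t * (of_int (snd i - snd j) * ln q))"
    by (simp add: cis_cnj cis_mult algebra_simps)
  finally show ?thesis .
qed

lemma \<psi>_\<sigma>: "bclinear X \<Longrightarrow> \<psi> (\<sigma> t X) = \<psi> X"
  by (simp add: \<psi>_def \<sigma>_entry \<xi>)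

text \<open>Matrix entries turn the analytic extension of the orbit into an entire exponential.\<close>

lemma analytic_entry:
  assumes gen: "analytic_generator A \<sigma> (1/2) X Y"
  shows "cinner (e i \<xi>) (Y (e j \<xi>)) = complex_of_real (q powi (snd j - snd i)) * cinner (e i \<xi>) (X (e j \<xi>))"
proof -
  obtain \<Phi> where X: "X \<in> A"
    and cont: "continuous_on {w. 0 \<le> Im w \<and> Im w \<le> 1/2} \<Phi>"
    and der: "\<And>w. 0 < Im w \<Longrightarrow> Im w < 1/2 \<Longrightarrow> \<exists>D. (\<Phi> has_derivative (\<lambda>h. cscale h D)) (at w)"
    and real: "\<And>t. \<Phi> (complex_of_real t) = \<sigma> t X"
    and Y: "\<Phi> (\<i> * complex_of_real (1/2)) = Y"
    using gen unfolding analytic_generator_def by blast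
  define a where "a = of_int (snd i - snd j) * ln q"
  define c where "c = cinner (e i \<xi>) (X (e j \<xi>))"
  \<comment> \<open>The matrix entry of the extension minus the exponential that agrees with it on
    the real axis.\<close>
  define f where "f w = cinner (e i \<xi>) (\<Phi> w (e j \<xi>)) - exp (2 * \<i> * w * complex_of_real a) * c" for w
  have "f (\<i> * complex_of_real (1/2)) = 0"
  proof (rule strip_vanishes)
    show "continuous_on {w. 0 \<le> Im w \<and> Im w \<le> 1/2} f"
      unfolding f_def
      by (intro continuous_intros cinner.continuous_on blinfun.continuous_on cont)
    show "f holomorphic_on {w. 0 < Im w \<and> Im w < 1/2}"
      unfolding f_def
    proof (intro holomorphic_intros)
      show "(\<lambda>w. cinner (e i \<xi>) (\<Phi> w (e j \<xi>))) holomorphic_on {w. 0 < Im w \<and> Im w < 1/2}"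
        unfolding holomorphic_on_def
      proof
        fix w
        assume "w \<in> {w. 0 < Im w \<and> Im w < 1/2}"
        then obtain D where D: "(\<Phi> has_derivative (\<lambda>h. cscale h D)) (at w)" using der by auto
        have "bounded_linear (\<lambda>Z. cinner (e i \<xi>) (blinfun_apply Z (e j \<xi>)))"
          by (rule bounded_linear_compose[OF cinner.bounded_linear_right blinfun.bounded_linear_left])
        from bounded_linear.has_derivative[OF this D]
        have "((\<lambda>w. cinner (e i \<xi>) (\<Phi> w (e j \<xi>))) has_derivative (\<lambda>h. cinner (e i \<xi>) (D (e j \<xi>)) * h)) (at w)"
          by (simp add: cscale.rep_eq cinner_scaleC_right mult.commute)
        then have "((\<lambda>w. cinner (e i \<xi>) (\<Phi> w (e j \<xi>))) has_field_derivative cinner (e i \<xi>) (D (e j \<xi>))) (at w)"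
          by (simp add: has_field_derivative_def)
        then show "(\<lambda>w. cinner (e i \<xi>) (\<Phi> w (e j \<xi>))) field_differentiable
            (at w within {w. 0 < Im w \<and> Im w < 1/2})"
          by (metis field_differentiable_def has_field_derivative_at_within)
      qed
    qed
    show "f (complex_of_real t) = 0" for t
      using \<sigma>_entry[OF \<xi>(1) \<xi>(1) A_bclinear[OF X], of i t j]
      by (simp add: f_def real c_def a_def cis_conv_exp mult_ac)
  qed simp
  then have "cinner (e i \<xi>) (Y (e j \<xi>)) = exp (2 * \<i> * (\<i> * complex_of_real (1/2)) * complex_of_real a) * c"
    by (simp only: f_def Y right_minus_eq)
  \<comment> \<open>At \<open>\<i> / 2\<close> the exponent is \<open>- a\<close>, and since
    \<open>a\<close> is an integer multiple of \<open>ln q\<close> the exponential is a power of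
    \<open>q\<close>.\<close>
  also have "2 * \<i> * (\<i> * complex_of_real (1/2)) * complex_of_real a = complex_of_real (- a)"
    by (simp add: mult_ac)
  also have "exp (complex_of_real (- a)) = complex_of_real (exp (- a))"
    by (rule exp_of_real)
  also have "exp (- a) = q powi (snd j - snd i)"
    using q by (simp add: a_def powr_real_of_int'[symmetric] powr_def algebra_simps)
  finally show ?thesis by (simp only: c_def)
qed

text \<open>The diagonal entry of \<open>Y o X\<close> is the squared norm of a column, which
  Parseval expands over the rows.\<close>

lemma \<psi>_square:
  assumes XY: "adj_pair X Y" and X: "amplified X"
  shows "\<psi> (Y o\<^sub>L X) = (\<integral>\<^sup>+j. \<integral>\<^sup>+i. ennreal (q powi (2 * snd j) * (cmod (cinner (e i \<xi>) (X (e j \<xi>))))\<^sup>2)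
    \<partial>count_space UNIV \<partial>count_space UNIV)"
  unfolding \<psi>_def
proof (rule nn_integral_cong)
  fix j :: "int \<times> int"
  have "Re (cinner (e j \<xi>) ((Y o\<^sub>L X) (e j \<xi>))) = (norm (X (e j \<xi>)))\<^sup>2"
    unfolding positive_op_norm_sq[OF XY] by simp
  then have "ennreal (q powi (2 * snd j) * Re (cinner (e j \<xi>) ((Y o\<^sub>L X) (e j \<xi>))))
    = ennreal (q powi (2 * snd j)) * ennreal ((norm (X (e j \<xi>)))\<^sup>2)"
    using q by (simp add: ennreal_mult)
  also have "\<dots> = (\<integral>\<^sup>+i. ennreal (q powi (2 * snd j)) * ennreal ((cmod (cinner (e i \<xi>) (X (e j \<xi>))))\<^sup>2) \<partial>count_space UNIV)"
    unfolding amplified_norm[OF X] by (rule nn_integral_cmult[symmetric]) simp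
  also have "\<dots> = (\<integral>\<^sup>+i. ennreal (q powi (2 * snd j) * (cmod (cinner (e i \<xi>) (X (e j \<xi>))))\<^sup>2) \<partial>count_space UNIV)"
    using q by (simp add: ennreal_mult)
  finally show "ennreal (q powi (2 * snd j) * Re (cinner (e j \<xi>) ((Y o\<^sub>L X) (e j \<xi>)))) = \<dots>" .
qed

lemma KMS_condition:
  assumes gen: "analytic_generator A \<sigma> (1/2) X Y"
  shows "\<psi> (badj X o\<^sub>L X) = \<psi> (Y o\<^sub>L badj Y)"
proof -
  have X: "X \<in> A" using gen by (simp add: analytic_generator_def)
  have Y: "Y \<in> A" using gen by (auto simp: analytic_generator_def)
  have entry: "q powi (2 * snd i) * (cmod (cinner (e j \<xi>) (badj Y (e i \<xi>))))\<^sup>2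
    = q powi (2 * snd j) * (cmod (cinner (e i \<xi>) (X (e j \<xi>))))\<^sup>2" for i j
  proof -
    have "cinner (e j \<xi>) (badj Y (e i \<xi>)) = cnj (cinner (e i \<xi>) (Y (e j \<xi>)))"
      by (metis adj_pairD[OF A_badj[OF Y]] cinner_commute)
    then have "cmod (cinner (e j \<xi>) (badj Y (e i \<xi>))) = q powi (snd j - snd i) * cmod (cinner (e i \<xi>) (X (e j \<xi>)))"
      using q by (simp add: analytic_entry[OF gen] norm_mult del: of_real_power_int)
    \<comment> \<open>Here the exponents match: the factor at \<open>\<i> / 2\<close> exchanges the
      weight of the row for that of the column.\<close>
    moreover have "q powi (2 * snd i) * (q powi (snd j - snd i))\<^sup>2 = q powi (2 * snd j)"
    proof -
      have "(q powi (snd j - snd i))\<^sup>2 = q powi ((snd j - snd i) + (snd j - snd i))"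
        using q power_int_add[of q "snd j - snd i" "snd j - snd i"] by (simp only: power2_eq_square) simp
      then have "q powi (2 * snd i) * (q powi (snd j - snd i))\<^sup>2 = q powi (2 * snd i + ((snd j - snd i) + (snd j - snd i)))"
        using q by (subst power_int_add[of q "2 * snd i"]) (simp_all only:, simp)
      then show ?thesis by simp
    qed
    ultimately show ?thesis by (simp add: power_mult_distrib mult.assoc[symmetric])
  qed
  have "\<psi> (Y o\<^sub>L badj Y) = (\<integral>\<^sup>+i. \<integral>\<^sup>+j. ennreal (q powi (2 * snd i) * (cmod (cinner (e j \<xi>) (badj Y (e i \<xi>))))\<^sup>2)
    \<partial>count_space UNIV \<partial>count_space UNIV)"
    by (rule \<psi>_square[OF adj_pair_sym[OF A_badj[OF Y]] amplified_adj[OF A_amplified[OF Y] A_badj[OF Y]]])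
  also have "\<dots> = (\<integral>\<^sup>+i. \<integral>\<^sup>+j. (\<lambda>(i, j). ennreal (q powi (2 * snd j) * (cmod (cinner (e i \<xi>) (X (e j \<xi>))))\<^sup>2)) (i, j)
    \<partial>count_space UNIV \<partial>count_space UNIV)"
    by (simp only: entry prod.case)
  \<comment> \<open>Tonelli: all terms are nonnegative, so rows and columns may be summed in either
    order.\<close>
  also have "\<dots> = (\<integral>\<^sup>+j. \<integral>\<^sup>+i. (\<lambda>(i, j). ennreal (q powi (2 * snd j) * (cmod (cinner (e i \<xi>) (X (e j \<xi>))))\<^sup>2)) (i, j)
    \<partial>count_space UNIV \<partial>count_space UNIV)"
    unfolding nn_integral_fst_count_space nn_integral_snd_count_space ..
  also have "\<dots> = \<psi> (badj X o\<^sub>L X)"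
    unfolding \<psi>_square[OF A_badj[OF X] A_amplified[OF X]] by (simp only: prod.case)
  finally show ?thesis ..
qed

lemma KMS: "KMS_weight A \<psi>"
  unfolding KMS_weight_def
  using weight automorphism KMS_condition \<psi>_\<sigma> A_bclinear pos_partD(1) by blast

end

section \<open>The algebra in terms of matrix units\<close>

context spectral
begin

lemma spectral_integral_graphI:
  assumes "spectral_int E \<phi> X"
  shows "is_spectral_integral E \<phi> (graph X)"
  unfolding is_spectral_integral_def
proof (intro conjI allI impI)
  show "lin_op (graph X)"
    using bclinearD[OF spectral_intD(3)[OF assms]]
    by (auto simp: lin_op_def graph_def single_valued_def blinfun.add_right)
  show "Domain (graph X) = {x. (\<integral>\<^sup>+ z. ennreal ((cmod (\<phi> z))\<^sup>2) \<partial>scalar_measure E x) < \<infinity>}"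
  proof -
    obtain c where c: "\<And>z. cmod (\<phi> z) \<le> c" using spectral_intD(2)[OF assms] by (auto simp: bounded_iff)
    have "(\<integral>\<^sup>+ z. ennreal ((cmod (\<phi> z))\<^sup>2) \<partial>scalar_measure E x) < \<infinity>" for x
    proof -
      have "(\<integral>\<^sup>+ z. ennreal ((cmod (\<phi> z))\<^sup>2) \<partial>scalar_measure E x) \<le> (\<integral>\<^sup>+ z. ennreal (c\<^sup>2) \<partial>scalar_measure E x)"
        using c by (intro nn_integral_mono ennreal_leI power_mono) auto
      also have "\<dots> < \<infinity>" by (simp add: emeasure_scalar_measure ennreal_mult_less_top)
      finally show ?thesis .
    qed
    then show ?thesis by (auto simp: graph_def)
  qed
qed (use spectral_intD(1,4)[OF assms] in \<open>auto simp: graph_def\<close>)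

lemma spectral_integral_graphD:
  assumes "is_spectral_integral E \<phi> (graph X)" "bounded (range \<phi>)"
  shows "spectral_int E \<phi> X"
proof -
  have int: "\<phi> \<in> borel_measurable borel" "lin_op (graph X)"
    "\<And>x y. (x, y) \<in> graph X \<Longrightarrow> cinner x y = (\<integral>z. \<phi> z \<partial>scalar_measure E x)"
    using assms(1) unfolding is_spectral_integral_def by blast+
  have gr: "(x, X x) \<in> graph X" for x by (simp add: graph_def)
  have "bclinear X"
    unfolding bclinear_def
  proof (intro allI)
    fix c x
    have "(c *\<^sub>C x, c *\<^sub>C X x) \<in> graph X" by (rule lin_opD(2)[OF int(2) gr])
    then show "X (c *\<^sub>C x) = c *\<^sub>C X x" by (auto simp: graph_def)
  qed
  then show ?thesis
    unfolding spectral_int_def using int(1) int(3)[OF gr] assms(2) by blast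
qed

lemma spectral_int_modify:
  assumes X: "spectral_int E \<phi> X" and \<psi>: "\<psi> \<in> borel_measurable borel" "bounded (range \<psi>)"
    and N: "N \<in> sets borel" "E N = 0" "\<And>z. z \<notin> N \<Longrightarrow> \<phi> z = \<psi> z"
  shows "spectral_int E \<psi> X"
proof -
  obtain Y where Y: "spectral_int E \<psi> Y" using spectral_int_exists[OF \<psi>] by blast
  have "X = Y" by (rule spectral_int_unique_off[OF X Y N])
  with Y show ?thesis by simp
qed

end

section \<open>Functional calculus on \<open>q_Gamma\<close>, with and without the point 0\<close>

lemma closed_q_Gamma_0:
  assumes "0 < q" "q < 1"
  shows "closed (q_Gamma q \<union> {0})"
proof -
  have "q_Gamma q \<union> {0} = norm -` (q_powers q \<union> {0})"
    unfolding q_Gamma_eq[OF assms(1)] by (auto simp: q_circle_iff q_powers_def)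
  then show ?thesis using closed_q_powers[OF assms] by (simp add: closed_vimage continuous_on_norm_id)
qed

lemma C0D: "g \<in> C0 S \<Longrightarrow> 0 < e \<Longrightarrow> \<exists>K. compact K \<and> K \<subseteq> S \<and> (\<forall>z\<in>S - K. cmod (g z) < e)"
  by (simp add: C0_def)

lemma C0_bounded:
  assumes "g \<in> C0 S"
  shows "bounded (range (extend0 S g))"
proof -
  obtain K where K: "compact K" "K \<subseteq> S" "\<And>z. z \<in> S - K \<Longrightarrow> cmod (g z) < 1"
    using C0D[OF assms zero_less_one] by blast
  have "continuous_on K g"
    using assms by (intro continuous_on_subset[OF _ K(2)]) (simp add: C0_def)
  then have "bounded (g ` K)" using K(1) by (intro compact_imp_bounded compact_continuous_image)
  then obtain b where b: "\<And>z. z \<in> K \<Longrightarrow> cmod (g z) \<le> b" by (auto simp: bounded_iff)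
  have "cmod (extend0 S g z) \<le> max 1 b" for z
    using b[of z] K(3)[of z] by (cases "z \<in> S"; cases "z \<in> K") (auto simp: extend0_def)
  then show ?thesis by (intro boundedI[of _ "max 1 b"]) auto
qed

lemma q_circle_subset: "0 < q \<Longrightarrow> q_circle q n \<subseteq> q_Gamma q"
  using q_Gamma_eq by auto

lemma q_powi_small:
  assumes "0 < q" "q < (1::real)" "0 < d"
  shows "\<exists>j. \<forall>n\<ge>j. q powi n < d"
proof -
  obtain k where k: "q ^ k < d" using real_arch_pow_inv[OF assms(3,2)] by blast
  have "q powi n < d" if "n \<ge> int k" for n
  proof -
    have "q powi n \<le> q powi (int k)" using that assms by (intro power_int_decreasing) auto
    then show ?thesis using k by (simp add: power_int_of_nat)
  qed
  then show ?thesis by blast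
qed

lemma q_powi_large:
  assumes "0 < q" "q < (1::real)"
  shows "\<exists>i. \<forall>n<i. b < q powi n"
proof -
  have "0 < inverse (max b 1)" by simp
  then obtain j where j: "\<And>n. n \<ge> j \<Longrightarrow> q powi n < inverse (max b 1)"
    using q_powi_small[OF assms] by blast
  have "b < q powi n" if "n < - j" for n
  proof -
    have "q powi (- n) < inverse (max b 1)" using that by (intro j) simp
    then have "inverse (q powi n) < inverse (max b 1)" by (simp add: power_int_minus)
    then have "max b 1 < q powi n" using assms by (subst (asm) inverse_less_iff_less) auto
    then show ?thesis by simp
  qed
  then show ?thesis by blast
qed

context polar_system
begin

text \<open>Covers \<open>a\<close> and \<open>b\<close> at once: only if 0 belongs to
  \<open>\<Gamma>\<close> can the function have a nonzero limit there, and only then do the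
  projections \<open>Q N\<close> enter.\<close>

lemma fcalc_in_closure:
  assumes fc: "is_fcalc T (extend0 \<Gamma> g) X" and g: "g \<in> C0 \<Gamma>"
    and \<Gamma>: "\<Gamma> = q_Gamma q \<or> \<Gamma> = q_Gamma q \<union> {0}"
    and S: "\<And>n l. unitary_powi U l o\<^sub>L R n \<in> S" "0 \<in> \<Gamma> \<Longrightarrow> range Q \<subseteq> S"
  shows "X \<in> closure (cs.span S)"
proof -
  obtain E where ET: "spectral_measure_of T E" "is_spectral_integral E (extend0 \<Gamma> g) (graph X)"
    using fc by (auto simp: is_fcalc_def)
  interpret polar_spectral q T U P F E by unfold_locales (rule ET(1))
  have sub: "C n \<subseteq> \<Gamma>" for n using \<Gamma> q_circle_subset[OF q(1)] by auto
  have eq: "extend0 \<Gamma> g z = g z" if "z \<in> C n" for z n using sub that by (auto simp: extend0_def)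
  have nz: "z \<noteq> 0" if "z \<in> q_Gamma q" for z
    using that q unfolding q_Gamma_eq[OF q(1)] by (auto simp: q_circle_iff)
  define c where "c = (if 0 \<in> \<Gamma> then g 0 else 0)"
  show ?thesis
  proof (rule spectral_int_in_closure)
    show "spectral_int E (extend0 \<Gamma> g) X"
      by (rule E.spectral_integral_graphD[OF ET(2) C0_bounded[OF g]])
    show "continuous_on (C n) (extend0 \<Gamma> g)" for n
    proof -
      have "continuous_on (C n) g"
        using g by (intro continuous_on_subset[OF _ sub]) (simp add: C0_def)
      then show ?thesis using eq by (subst continuous_on_cong[OF refl]) auto
    qed
    show "unitary_powi U l o\<^sub>L R n \<in> S" for n l by (rule S)
    show "range Q \<subseteq> S" if "c \<noteq> 0" using that S(2) by (auto simp: c_def split: if_splits)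
    fix e :: real
    assume e: "0 < e"
    obtain K where K: "compact K" "K \<subseteq> \<Gamma>" "\<And>z. z \<in> \<Gamma> - K \<Longrightarrow> cmod (g z) < e"
      using C0D[OF g e] by blast
    obtain b where b: "\<And>z. z \<in> K \<Longrightarrow> cmod z \<le> b"
      using compact_imp_bounded[OF K(1)] by (auto simp: bounded_iff)
    obtain i where i: "\<And>n. n < i \<Longrightarrow> b < q powi n" using q_powi_large[OF q] by blast
    \<comment> \<open>Near 0 the function is close to \<open>c\<close>: by continuity if 0 is a
      point of \<open>\<Gamma>\<close>, and otherwise because the compact set \<open>K\<close> stays
      away from 0, so that \<open>g\<close> is small there.\<close>
    obtain d where d: "0 < d" "\<And>z. z \<in> \<Gamma> \<Longrightarrow> z \<noteq> 0 \<Longrightarrow> cmod z < d \<Longrightarrow> cmod (g z - c) < e"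
    proof (cases "0 \<in> \<Gamma>")
      case True
      have "continuous_on \<Gamma> g" using g by (simp add: C0_def)
      then obtain d where "0 < d" "\<And>z. z \<in> \<Gamma> \<Longrightarrow> dist z 0 < d \<Longrightarrow> dist (g z) (g 0) < e"
        using True e unfolding continuous_on_iff by metis
      then show thesis using that[of d] True by (auto simp: c_def dist_norm)
    next
      case False
      have "open (- K)" using K(1) by (simp add: compact_imp_closed open_Compl)
      moreover have "0 \<in> - K" using False K(2) by auto
      ultimately obtain d where "0 < d" "ball 0 d \<subseteq> - K" using open_contains_ball by blast
      then show thesis using that[of d] False K(3) by (auto simp: c_def dist_norm subset_iff)
    qed
    obtain j where j: "\<And>n. n \<ge> j \<Longrightarrow> q powi n < d" using q_powi_small[OF q d(1)] by blast
    \<comment> \<open>With \<open>max i j\<close> as the right end, an index outside the interval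
      and below that end is below \<open>i\<close>, even if \<open>j < i\<close>.\<close>
    have "cmod (extend0 \<Gamma> g z - (if max i j \<le> n then c else 0)) < e"
      if z: "z \<in> C n" and n: "n \<notin> {i..<max i j}" for n z
    proof (cases "max i j \<le> n")
      case True
      have "cmod z < d" using j[of n] True z by (simp add: q_circle_iff)
      moreover have "z \<in> q_Gamma q" using z q_circle_subset[OF q(1)] by auto
      ultimately show ?thesis using d(2)[of z] sub[of n] z True nz eq[OF z] by auto
    next
      case False
      then have "n < i" using n by auto
      then have "z \<notin> K" using i[of n] b[of z] z by (auto simp: q_circle_iff)
      then show ?thesis using K(3)[of z] sub[of n] z False eq[OF z] by auto
    qed
    then show "\<exists>i j. \<forall>n z. z \<in> C n \<longrightarrow> n \<notin> {i..<j} \<longrightarrow> cmod (extend0 \<Gamma> g z - (if j \<le> n then c else 0)) < e"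
      by blast
  qed
qed

text \<open>Each circle lies at positive distance from the rest of \<open>\<Gamma>\<close>, so
  cutting a monomial off to it keeps it continuous on \<open>\<Gamma>\<close>. This is shown by
  comparison with a function that is continuous on the whole plane.\<close>

lemma matrix_unit_fcalc:
  assumes E: "spectral_measure_of T E" and \<Gamma>: "\<Gamma> = q_Gamma q \<or> \<Gamma> = q_Gamma q \<union> {0}"
  shows "\<exists>g\<in>C0 \<Gamma>. is_fcalc T (extend0 \<Gamma> g) (unitary_powi U l o\<^sub>L R n)"
proof -
  interpret polar_spectral q T U P F E by unfold_locales (rule E)
  define g where "g z = indicator (C n) z * (z / pt n) powi l" for z
  \<comment> \<open>Conjugates replace negative powers: they are equal on the unit circle, but
    without the pole at 0.\<close>
  define ph where "ph w = (if 0 \<le> l then w ^ nat l else cnj w ^ nat (- l))" for w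
  \<comment> \<open>A tent in the modulus: \<open>q powi n * (1 - q)\<close> is the distance to the
    next smaller circle, and the next larger one is farther away.\<close>
  define h where "h z = complex_of_real (max 0 (1 - \<bar>cmod z - q powi n\<bar> / (q powi n * (1 - q)))) * ph (z / pt n)" for z
  have pos: "0 < q powi n * (1 - q)" using q by simp
  have gh: "g z = h z" if "z \<in> \<Gamma>" for z
  proof (cases "z \<in> C n")
    case True
    then have m: "cmod (z / pt n) = 1" using q by (simp add: q_circle_iff norm_divide cmod_pt)
    then have "(z / pt n) * cnj (z / pt n) = 1" using complex_norm_square[of "z / pt n"] by simp
    then have "inverse (z / pt n) = cnj (z / pt n)" by (rule inverse_unique)
    then have "(z / pt n) powi l = ph (z / pt n)"
      unfolding power_int_def ph_def by simp
    then show ?thesis using True by (simp add: g_def h_def q_circle_iff)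
  next
    case False
    have "q powi n * (1 - q) \<le> \<bar>cmod z - q powi n\<bar>"
    proof (cases "z = 0")
      case True
      then show ?thesis using q by (simp add: algebra_simps)
    next
      case z: False
      then obtain k where k: "cmod z = q powi k"
        using \<Gamma> \<open>z \<in> \<Gamma>\<close> unfolding q_Gamma_eq[OF q(1)] by (auto simp: q_circle_iff)
      have "k \<noteq> n" using False k by (auto simp: q_circle_iff)
      then consider "k \<ge> n + 1" | "k \<le> n - 1" by linarith
      then show ?thesis
      proof cases
        case 1
        then have "q powi k \<le> q powi (n + 1)" using q by (intro power_int_decreasing) auto
        also have "\<dots> = q powi n * q" using q by (simp add: power_int_add)
        finally show ?thesis using k by (simp add: algebra_simps)
      next
        case 2
        then have "q powi (n - 1) \<le> q powi k" using q by (intro power_int_decreasing) auto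
        moreover have "q powi n = q powi (n - 1) * q" using q by (simp add: power_int_diff)
        moreover have "q powi (n - 1) * q * (1 - q) \<le> q powi (n - 1) * 1 * (1 - q)"
          using q by (intro mult_right_mono mult_left_mono) auto
        ultimately show ?thesis using k by (simp add: algebra_simps)
      qed
    qed
    then have "1 - \<bar>cmod z - q powi n\<bar> / (q powi n * (1 - q)) \<le> 0"
      using pos by (simp add: le_divide_eq)
    then have "max 0 (1 - \<bar>cmod z - q powi n\<bar> / (q powi n * (1 - q))) = 0" by simp
    then show ?thesis using False unfolding g_def h_def by simp
  qed
  have ph: "continuous_on UNIV ph"
  proof (cases "0 \<le> l")
    case True
    then have "ph = (\<lambda>w. w ^ nat l)" by (simp add: ph_def fun_eq_iff)
    then show ?thesis by (simp only:) (intro continuous_intros)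
  next
    case False
    then have "ph = (\<lambda>w. cnj w ^ nat (- l))" by (simp add: ph_def fun_eq_iff)
    then show ?thesis by (simp only:) (intro continuous_intros)
  qed
  have "continuous_on UNIV (\<lambda>z. z / pt n)"
    using pt_nonzero[of n] by (intro continuous_intros) auto
  then have "continuous_on UNIV (\<lambda>z. ph (z / pt n))"
    by (rule continuous_on_compose2[OF ph]) simp
  then have "continuous_on UNIV h"
    unfolding h_def using pos q by (intro continuous_intros) auto
  then have cont: "continuous_on \<Gamma> g"
    using gh by (subst continuous_on_cong[OF refl]) (auto intro: continuous_on_subset)
  have sub: "C n \<subseteq> \<Gamma>" using \<Gamma> q_circle_subset[OF q(1)] by auto
  have "g \<in> C0 \<Gamma>"
    unfolding C0_def
  proof (intro CollectI conjI allI impI cont exI[of _ "C n"])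
    show "compact (C n)" by (simp add: q_circle_def)
  qed (use sub in \<open>auto simp: g_def\<close>)
  moreover have "extend0 \<Gamma> g = g" using sub by (auto simp: extend0_def g_def fun_eq_iff indicator_def)
  moreover have "is_spectral_integral E g (graph (unitary_powi U l o\<^sub>L R n))"
    unfolding g_def by (intro E.spectral_integral_graphI spectral_int_powi)
  ultimately show ?thesis
    unfolding is_fcalc_def using E by (intro bexI[of _ g] exI[of _ E] conjI) simp_all
qed

text \<open>The part of \<open>\<Gamma>\<close> in the disc of radius \<open>q powi N\<close> is
  compact because it contains 0. This is why tails arise from \<open>b\<close> but not from
  \<open>a\<close>.\<close>

lemma tail_fcalc:
  assumes E: "spectral_measure_of T E" and \<Gamma>: "\<Gamma> = q_Gamma q \<union> {0}"
  shows "\<exists>g\<in>C0 \<Gamma>. is_fcalc T (extend0 \<Gamma> g) (Q N)"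
proof -
  interpret polar_spectral q T U P F E by unfold_locales (rule E)
  define M where "M = \<Gamma> \<inter> cball 0 (q powi N)"
  define g where "g = (indicator M :: complex \<Rightarrow> complex)"
  define d where "d = q powi (N - 1) - q powi N"
  have d: "0 < d" using q_powi_less[OF q, of "N - 1" N] by (simp add: d_def)
  \<comment> \<open>A continuous ramp over the gap between the circles with exponents
    \<open>N\<close> and \<open>N - 1\<close>.\<close>
  define h where "h z = complex_of_real (min 1 (max 0 ((q powi (N - 1) - cmod z) / d)))" for z
  have gh: "g z = h z" if "z \<in> \<Gamma>" for z
  proof (cases "cmod z \<le> q powi N")
    case True
    then have "1 \<le> (q powi (N - 1) - cmod z) / d" using d by (simp add: d_def)
    then show ?thesis using True that by (simp add: g_def h_def M_def)
  next
    case False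
    then have "z \<noteq> 0" using q by auto
    then have "z \<in> q_Gamma q" using \<Gamma> that by auto
    then obtain k where k: "cmod z = q powi k"
      unfolding q_Gamma_eq[OF q(1)] by (auto simp: q_circle_iff)
    have "k < N"
    proof (rule ccontr)
      assume "\<not> k < N"
      then have "q powi k \<le> q powi N" using q by (intro power_int_decreasing) auto
      then show False using False k by simp
    qed
    then have "q powi (N - 1) \<le> cmod z" unfolding k using q by (intro power_int_decreasing) auto
    then have "(q powi (N - 1) - cmod z) / d \<le> 0" using d by (simp add: divide_le_0_iff)
    then show ?thesis using False by (simp add: g_def h_def M_def)
  qed
  have "continuous_on UNIV h"
    unfolding h_def using d by (intro continuous_intros) auto
  then have cont: "continuous_on \<Gamma> g"
    using gh by (subst continuous_on_cong[OF refl]) (auto intro: continuous_on_subset)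
  have cM: "compact M" unfolding M_def \<Gamma>
    by (intro closed_Int_compact closed_q_Gamma_0 q compact_cball)
  have "g \<in> C0 \<Gamma>"
    unfolding C0_def
    by (intro CollectI conjI allI impI cont exI[of _ M] cM) (auto simp: g_def M_def)
  moreover have ext: "extend0 \<Gamma> g = g" by (auto simp: extend0_def g_def M_def fun_eq_iff indicator_def)
  have "spectral_int E g (Q N)"
  proof (rule E.spectral_int_modify)
    show "spectral_int E (indicator (\<Union>n\<in>{N..}. C n)) (Q N)"
      unfolding E_tail[symmetric] by (rule E.spectral_int_indicator) measurable
    show "g \<in> borel_measurable borel"
      unfolding g_def by (intro borel_measurable_indicator borel_closed compact_imp_closed cM)
    show "bounded (range g)" unfolding g_def by (rule boundedI[of _ 1]) (auto split: split_indicator)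
    show "- (\<Union>n. C n) \<in> sets borel" by measurable
    fix z
    assume "z \<notin> - (\<Union>n. C n)"
    then obtain n where n: "z \<in> C n" by auto
    have "z \<in> C k \<longleftrightarrow> k = n" for k using n q_powi_inj[OF q] by (auto simp: q_circle_iff)
    moreover have "z \<in> M \<longleftrightarrow> N \<le> n"
    proof
      assume "z \<in> M"
      then show "N \<le> n"
        using n q_powi_less[OF q, of n N] by (auto simp: M_def q_circle_iff not_le[symmetric])
    next
      assume "N \<le> n"
      then have "q powi n \<le> q powi N" using q by (intro power_int_decreasing) auto
      then show "z \<in> M" using n q_circle_subset[OF q(1), of n] by (auto simp: M_def \<Gamma> q_circle_iff)
    qed
    ultimately show "indicator (\<Union>n\<in>{N..}. C n) z = g z" by (auto simp: g_def indicator_def)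
  qed (rule E_off_Gamma)
  then have "is_spectral_integral E g (graph (Q N))" by (rule E.spectral_integral_graphI)
  ultimately show ?thesis
    unfolding is_fcalc_def using E ext by (intro bexI[of _ g] exI[of _ E] conjI) simp_all
qed

end

section \<open>The pair of operators \<open>a\<close>, \<open>b\<close> and its matrix units\<close>

lemma orth_projection_compose:
  assumes "orth_projection X" "orth_projection Y" "X o\<^sub>L Y = Y o\<^sub>L X"
  shows "orth_projection (X o\<^sub>L Y)"
proof -
  have c: "X (Y x) = Y (X x)" for x using assms(3) by (metis blinfun_apply_blinfun_compose)
  have "adj_pair (X o\<^sub>L Y) (Y o\<^sub>L X)"
    using assms(1,2) by (intro adj_pair_simps orth_projection_adj)
  then have "adj_pair (X o\<^sub>L Y) (X o\<^sub>L Y)" unfolding assms(3) .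
  moreover have "(X o\<^sub>L Y) o\<^sub>L (X o\<^sub>L Y) = X o\<^sub>L Y"
    by (rule blinfun_eqI) (simp add: c orth_projection_idem assms(1,2))
  ultimately show ?thesis
    using orth_projection_bclinear[OF assms(1)] orth_projection_bclinear[OF assms(2)]
    by (auto simp: orth_projection_def adj_pair_def)
qed

lemma closure_span_compose:
  assumes lin: "\<And>X. X \<in> S \<Longrightarrow> bclinear X"
    and mult: "\<And>X Y. X \<in> S \<Longrightarrow> Y \<in> S' \<Longrightarrow> X o\<^sub>L Y \<in> cs.span S''"
    and X: "X \<in> closure (cs.span S)" and Y: "Y \<in> closure (cs.span S')"
  shows "X o\<^sub>L Y \<in> closure (cs.span S'')"
proof -
  obtain x where x: "\<And>n. x n \<in> cs.span S" "x \<longlonglongrightarrow> X" using X unfolding closure_sequential by blast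
  obtain y where y: "\<And>n. y n \<in> cs.span S'" "y \<longlonglongrightarrow> Y" using Y unfolding closure_sequential by blast
  have "(\<lambda>n. x n o\<^sub>L y n) \<longlonglongrightarrow> (X o\<^sub>L Y)"
    by (intro bounded_bilinear.tendsto[OF bounded_bilinear_blinfun_compose] x y)
  moreover have "x n o\<^sub>L y n \<in> cs.span S''" for n
    by (rule span_compose[OF lin mult x(1) y(1)])
  ultimately show ?thesis
    unfolding closure_sequential by (intro exI[of _ "\<lambda>n. x n o\<^sub>L y n"]) simp
qed

lemma span_subset_closure:
  assumes "S \<subseteq> closure (cs.span S')"
  shows "cs.span S \<subseteq> closure (cs.span S')"
proof
  fix X assume "X \<in> cs.span S"
  then show "X \<in> closure (cs.span S')"
  proof (induction rule: cs.span_induct_alt)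
    case base
    show ?case using closure_subset cs.span_zero by blast
  next
    case (step c X Y)
    have "X \<in> closure (cs.span S')" using assms step(1) by blast
    then obtain x where x: "\<And>n. x n \<in> cs.span S'" "x \<longlonglongrightarrow> X"
      unfolding closure_sequential by blast
    obtain y where y: "\<And>n. y n \<in> cs.span S'" "y \<longlonglongrightarrow> Y"
      using step(2) unfolding closure_sequential by blast
    have "(\<lambda>n. cscale c (x n) + y n) \<longlonglongrightarrow> cscale c X + Y"
      by (intro tendsto_add cscale.tendsto tendsto_const x y)
    moreover have "cscale c (x n) + y n \<in> cs.span S'" for n
      by (intro cs.span_add cs.span_scale x y)
    ultimately show ?case
      unfolding closure_sequential by (intro exI[of _ "\<lambda>n. cscale c (x n) + y n"]) simp
  qed
qed

locale azb =
  fixes q :: real and a b p r :: "('h::chilbert \<times> 'h) set" and u v :: "'h \<Rightarrow>\<^sub>L 'h"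
    and E\<^sub>p E\<^sub>r :: "complex set \<Rightarrow> ('h \<Rightarrow>\<^sub>L 'h)"
  assumes q: "0 < q" "q < 1" and admissible: "admissible_pair q a b u p v r"
    and E\<^sub>p: "spectral_measure_of p E\<^sub>p" and E\<^sub>r: "spectral_measure_of r E\<^sub>r"
    and E\<^sub>p_E\<^sub>r: "\<And>M N. M \<in> sets borel \<Longrightarrow> N \<in> sets borel \<Longrightarrow> E\<^sub>p M o\<^sub>L E\<^sub>r N = E\<^sub>r N o\<^sub>L E\<^sub>p M"
begin

sublocale a: polar_system q a u p E\<^sub>p
  using q admissible E\<^sub>p by unfold_locales (auto simp: admissible_pair_def)

sublocale b: polar_system q b v r E\<^sub>r
  using q admissible E\<^sub>r by unfold_locales (auto simp: admissible_pair_def)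

lemma uv: "u o\<^sub>L v = v o\<^sub>L u"
  using admissible by (simp add: admissible_pair_def)

lemma proj_commute: "M \<in> sets borel \<Longrightarrow> N \<in> sets borel \<Longrightarrow> E\<^sub>p M (E\<^sub>r N x) = E\<^sub>r N (E\<^sub>p M x)"
  using E\<^sub>p_E\<^sub>r[of M N] by (metis blinfun_apply_blinfun_compose)

lemma P_R: "a.R m (b.R n x) = b.R n (a.R m x)"
  by (simp add: a.R_def b.R_def proj_commute)

definition S :: "int \<Rightarrow> int \<Rightarrow> ('h \<Rightarrow>\<^sub>L 'h)" where
  "S k l = unitary_powi v k o\<^sub>L unitary_powi u l"

lemma powi_uv: "unitary_powi u l o\<^sub>L unitary_powi v k = unitary_powi v k o\<^sub>L unitary_powi u l"
proof -
  have "unitary_powi u l o\<^sub>L v = v o\<^sub>L unitary_powi u l"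
    using unitary_powi_intertwine[OF a.U, of "\<lambda>_. v" 0 l] uv by simp
  then show ?thesis
    using unitary_powi_intertwine[OF b.U, of "\<lambda>_. unitary_powi u l" 0 k] by simp
qed

lemma S_unitary: "unitary_op (S k l)"
  unfolding S_def by (intro unitary_op_compose unitary_op_powi a.U b.U)

lemma S_S: "S k l (S k' l' x) = S (k + k') (l + l') x"
proof -
  have "unitary_powi u l (unitary_powi v k' y) = unitary_powi v k' (unitary_powi u l y)" for y
    using powi_uv[of l k'] by (metis blinfun_apply_blinfun_compose)
  then show ?thesis
    by (simp add: S_def unitary_powi_add[OF a.U] unitary_powi_add[OF b.U])
qed

lemma S_0: "S 0 0 x = x"
  by (simp add: S_def)

lemma P_S: "a.R m (S k l x) = S k l (a.R (m - k) x)"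
proof -
  have "v o\<^sub>L a.R n = a.R (n + 1) o\<^sub>L v" for n
    using admissible by (intro a.commutation_shift b.U) (simp add: admissible_pair_def)
  then have 1: "unitary_powi v k o\<^sub>L a.R (m - k) = a.R m o\<^sub>L unitary_powi v k"
    using unitary_powi_intertwine[OF b.U, of a.R 1 k "m - k"] by simp
  have 2: "unitary_powi u l o\<^sub>L a.R (m - k) = a.R (m - k) o\<^sub>L unitary_powi u l"
    by (rule a.powi_R)
  show ?thesis
    using arg_cong[OF 1, of "\<lambda>X. X (unitary_powi u l x)"] arg_cong[OF 2, of "\<lambda>X. X x"]
    by (simp add: S_def)
qed

lemma R_S: "b.R n (S k l x) = S k l (b.R (n + l) x)"
proof -
  have "u o\<^sub>L b.R n = b.R (n + (- 1)) o\<^sub>L u" for n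
    using admissible by (intro b.commutation_shift a.U) (simp add: admissible_pair_def power_int_minus)
  then have 1: "unitary_powi u l o\<^sub>L b.R (n + l) = b.R n o\<^sub>L unitary_powi u l"
    using unitary_powi_intertwine[OF a.U, of b.R "- 1" l "n + l"] by simp
  have 2: "unitary_powi v k o\<^sub>L b.R n = b.R n o\<^sub>L unitary_powi v k"
    by (rule b.powi_R)
  show ?thesis
    using arg_cong[OF 1, of "\<lambda>X. X x"] arg_cong[OF 2, of "\<lambda>X. X (unitary_powi u l x)"]
    by (simp add: S_def)
qed

definition K :: "'h set" where "K = {x. a.R 0 x = x \<and> b.R 0 x = x}"

definition e :: "int \<times> int \<Rightarrow> ('h \<Rightarrow>\<^sub>L 'h)" where "e i = S (fst i) (- snd i)"

definition J :: "int \<times> int \<Rightarrow> ('h \<Rightarrow>\<^sub>L 'h)" where "J i = b.R (snd i) o\<^sub>L a.R (fst i)"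

text \<open>The second coordinate is bounded from below only. Small values of \<open>|b|\<close>
  have summable weight, and a bound from above would destroy norm convergence on the tails
  \<open>b.Q N\<close>.\<close>

definition cut :: "nat \<Rightarrow> ('h \<Rightarrow>\<^sub>L 'h)" where
  "cut n = E\<^sub>p (a.pt ` {- int n..int n}) o\<^sub>L E\<^sub>r (b.pt ` {- int n..})"

lemma P_e: "x \<in> K \<Longrightarrow> a.R m (e i x) = (if m = fst i then e i x else 0)"
  using a.R.R_R[of "m - fst i" 0 x] by (simp add: e_def P_S K_def)

lemma R_e: "x \<in> K \<Longrightarrow> b.R n (e i x) = (if n = snd i then e i x else 0)"
  using b.R.R_R[of "n - snd i" 0 x] by (simp add: e_def R_S K_def)

lemma S_e: "S k l (e i x) = e (i + (k, - l)) x"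
  by (simp add: e_def S_S add.commute diff_conv_add_uminus[symmetric])

lemma Ep_e: "x \<in> K \<Longrightarrow> E\<^sub>p (a.pt ` I) (e i x) = (if fst i \<in> I then e i x else 0)"
  using a.F_image_R[of I "fst i" "e i x"] P_e[of x "fst i" i] by simp

lemma Er_e: "x \<in> K \<Longrightarrow> E\<^sub>r (b.pt ` I) (e i x) = (if snd i \<in> I then e i x else 0)"
  using b.F_image_R[of I "snd i" "e i x"] R_e[of x "snd i" i] by simp

lemma J_in_range: "J i x \<in> e i ` K"
proof
  define y where "y = S (- fst i) (snd i) (J i x)"
  show "J i x = e i y" by (simp add: y_def e_def S_S S_0)
  show "y \<in> K"
    by (simp add: K_def y_def P_S R_S J_def P_R a.R.idem b.R.idem)
qed

lemma operator_ext:
  fixes X Y :: "'h \<Rightarrow>\<^sub>L 'h"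
  assumes "\<And>i x. x \<in> K \<Longrightarrow> blinfun_apply X (e i x) = blinfun_apply Y (e i x)"
  shows "X = Y"
proof (rule a.R.eqI)
  fix m x
  have "X o\<^sub>L a.R m = Y o\<^sub>L a.R m"
  proof (rule b.R.eqI)
    fix n y
    obtain z where "z \<in> K" "J (m, n) y = e (m, n) z" using J_in_range[of "(m, n)" y] by blast
    then show "(X o\<^sub>L a.R m) (b.R n y) = (Y o\<^sub>L a.R m) (b.R n y)"
      using assms by (simp add: J_def P_R)
  qed
  then show "X (a.R m x) = Y (a.R m x)" by (metis blinfun_apply_blinfun_compose)
qed

text \<open>Tails occur without a power of \<open>v\<close>: the phase of \<open>b\<close> has no
  continuous extension to 0, and a continuous function with nonzero limit there is asymptotically
  constant.\<close>

definition matrix_units :: "('h \<Rightarrow>\<^sub>L 'h) set" where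
  "matrix_units = {S k l o\<^sub>L (a.R m o\<^sub>L b.R n) |k l m n. True} \<union> {S 0 l o\<^sub>L (a.R m o\<^sub>L b.Q N) |l m N. True}"

lemma matrix_unitsI:
  "S k l o\<^sub>L (a.R m o\<^sub>L b.R n) \<in> matrix_units" "S 0 l o\<^sub>L (a.R m o\<^sub>L b.Q N) \<in> matrix_units"
  unfolding matrix_units_def by blast+

text \<open>If \<open>a\<close> or \<open>b\<close> had no spectral measure, the functional calculus relation would be empty and the
  algebra would be \<open>{0}\<close>. Allowing for this degenerate case avoids the spectral theorem.\<close>

definition G :: "('h \<Rightarrow>\<^sub>L 'h) set" where
  "G = (if (\<exists>E. spectral_measure_of a E) \<and> (\<exists>E. spectral_measure_of b E) then matrix_units else {})"

lemma T_e: "x \<in> K \<Longrightarrow> (S k l o\<^sub>L (a.R m o\<^sub>L b.R n)) (e i x) = (if i = (m, n) then e (i + (k, - l)) x else 0)"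
  by (simp add: R_e P_e S_e prod_eq_iff)

lemma Q_e: "x \<in> K \<Longrightarrow> (S 0 l o\<^sub>L (a.R m o\<^sub>L b.Q N)) (e i x)
    = (if fst i = m \<and> N \<le> snd i then e (i + (0, - l)) x else 0)"
  by (simp add: b.Q_def Er_e P_e S_e)

lemma cut_e: "x \<in> K \<Longrightarrow> cut n (e i x) = (if \<bar>fst i\<bar> \<le> int n \<and> - int n \<le> snd i then e i x else 0)"
  by (simp add: cut_def Er_e Ep_e abs_le_iff)

lemma K_lin: "x \<in> K \<Longrightarrow> c *\<^sub>C x \<in> K" "x \<in> K \<Longrightarrow> y \<in> K \<Longrightarrow> x - y \<in> K"
  by (auto simp: K_def a.R.lin b.R.lin blinfun.diff_right)

lemma phases: "\<exists>D. (\<forall>t. adj_pair (D t) (D (- t)))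
  \<and> (\<forall>t n x. D t (b.R n x) = cis (2 * t * (of_int n * ln q)) *\<^sub>C b.R n x)"
proof -
  obtain D D' where D: "\<And>t. adj_pair (D t) (D' t)"
    "\<And>t n x. D t (b.R n x) = cis (t * (of_int n * ln q)) *\<^sub>C b.R n x"
    "\<And>t n x. D' t (b.R n x) = cis (- t * (of_int n * ln q)) *\<^sub>C b.R n x"
    using b.phase_exists by metis
  have "D' t = D (- t)" for t by (rule b.R.eqI) (simp add: D)
  then have "adj_pair (D (2 * t)) (D (2 * - t))" for t using D(1)[of "2 * t"] by simp
  then show ?thesis using D(2)[of "2 * _"] by (intro exI[of _ "\<lambda>t. D (2 * t)"]) auto
qed

text \<open>If all joint components vanished, the two resolutions would make every vector 0; a
  nonzero component is moved into \<open>K\<close> by a shift.\<close>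

lemma unit_vector:
  assumes "\<exists>x::'h. x \<noteq> 0"
  shows "\<exists>x\<in>K. norm x = 1"
proof -
  have "\<exists>i x. J i x \<noteq> 0"
  proof (rule ccontr)
    assume "\<not> (\<exists>i x. J i x \<noteq> 0)"
    then have 0: "b.R n (a.R m x) = 0" for m n x by (simp add: J_def)
    have "a.R m x = 0" for m x using b.R.fixedI[of 0 "a.R m x"] 0 by simp
    then have "x = 0" for x :: 'h using a.R.fixedI[of 0 x] by simp
    then show False using assms by blast
  qed
  then obtain i x where "J i x \<noteq> 0" by blast
  moreover obtain y where y: "y \<in> K" "J i x = e i y" using J_in_range[of i x] by blast
  ultimately have "y \<noteq> 0" by auto
  then have "norm (complex_of_real (inverse (norm y)) *\<^sub>C y) = 1" by (simp add: norm_scaleC norm_inverse)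
  then show ?thesis using K_lin(1)[OF y(1)] by blast
qed

lemma matrix_units_adj:
  assumes "X \<in> matrix_units"
  shows "\<exists>Y. adj_pair X Y"
proof -
  have "\<exists>Y. adj_pair (S k l o\<^sub>L (a.R m o\<^sub>L Z)) Y" if "orth_projection Z" for k l m Z
    using adj_pair_simps(5)[OF unitary_op_inverse(1)[OF S_unitary]
        adj_pair_simps(5)[OF orth_projection_adj[OF a.R.proj] orth_projection_adj[OF that]]] by blast
  then show ?thesis
    using assms b.R.proj b.Q_proj by (auto simp: matrix_units_def)
qed

lemma matrix_units_shift:
  assumes "X \<in> matrix_units"
  shows "\<exists>d I. \<forall>i. \<forall>x\<in>K. X (e i x) = (if i \<in> I then e (i + d) x else 0)"
  using assms unfolding matrix_units_def
proof (elim UnE CollectE exE conjE)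
  fix k l m n
  assume "X = S k l o\<^sub>L (a.R m o\<^sub>L b.R n)"
  then show ?thesis using T_e by (intro exI[of _ "(k, - l)"] exI[of _ "{(m, n)}"]) simp
next
  fix l m N
  assume "X = S 0 l o\<^sub>L (a.R m o\<^sub>L b.Q N)"
  then show ?thesis using Q_e by (intro exI[of _ "(0, - l)"] exI[of _ "{i. fst i = m \<and> N \<le> snd i}"]) simp
qed

lemma matrix_units_cut:
  assumes "X \<in> matrix_units"
  shows "cut n o\<^sub>L X o\<^sub>L cut n \<in> insert 0 matrix_units"
    and "\<exists>n0. \<forall>n\<ge>n0. cut n o\<^sub>L X o\<^sub>L cut n = X"
proof -
  have "cut n o\<^sub>L X o\<^sub>L cut n \<in> insert 0 matrix_units \<and> (\<exists>n0. \<forall>n\<ge>n0. cut n o\<^sub>L X o\<^sub>L cut n = X)"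
    using assms[unfolded matrix_units_def]
  proof (elim UnE CollectE exE conjE)
    fix k l m j
    define Y where "Y = S k l o\<^sub>L (a.R m o\<^sub>L b.R j)"
    assume X: "X = S k l o\<^sub>L (a.R m o\<^sub>L b.R j)"
    have eq: "cut n o\<^sub>L Y o\<^sub>L cut n
      = (if \<bar>m\<bar> \<le> int n \<and> - int n \<le> j \<and> \<bar>m + k\<bar> \<le> int n \<and> - int n \<le> j - l then Y else 0)" for n
      by (rule operator_ext) (simp add: cut_e T_e Y_def del: blinfun_apply_blinfun_compose
          add: blinfun_compose.rep_eq[of "cut n o\<^sub>L _"] blinfun_compose.rep_eq[of "cut n"])
    have "cut n o\<^sub>L Y o\<^sub>L cut n = Y" if "n \<ge> nat (\<bar>m\<bar> + \<bar>j\<bar> + \<bar>k\<bar> + \<bar>l\<bar>)" for n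
      unfolding eq using that by auto
    moreover have "Y \<in> matrix_units" unfolding Y_def by (rule matrix_unitsI)
    then have "cut n o\<^sub>L Y o\<^sub>L cut n \<in> insert 0 matrix_units" unfolding eq by simp
    ultimately show ?thesis unfolding X Y_def[symmetric] by blast
  next
    fix l m N
    define Y where "Y N = S 0 l o\<^sub>L (a.R m o\<^sub>L b.Q N)" for N
    assume X: "X = S 0 l o\<^sub>L (a.R m o\<^sub>L b.Q N)"
    \<comment> \<open>A compressed tail is a tail starting later: the truncation on the right
      demands \<open>- int n \<le> snd i\<close>, the one on the left
      \<open>- int n \<le> snd i - l\<close>.\<close>
    have eq: "cut n o\<^sub>L Y N o\<^sub>L cut n
      = (if \<bar>m\<bar> \<le> int n then Y (max N (max (- int n) (l - int n))) else 0)" for n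
      by (rule operator_ext) (auto simp: cut_e Q_e Y_def simp del: blinfun_apply_blinfun_compose
          simp: blinfun_compose.rep_eq[of "cut n o\<^sub>L _"] blinfun_compose.rep_eq[of "cut n"])
    have "cut n o\<^sub>L Y N o\<^sub>L cut n = Y N" if "n \<ge> nat (\<bar>m\<bar> + \<bar>N\<bar> + \<bar>l\<bar>)" for n
    proof -
      have "\<bar>m\<bar> \<le> int n" "max N (max (- int n) (l - int n)) = N" using that by auto
      then show ?thesis unfolding eq by simp
    qed
    moreover have "Y j \<in> matrix_units" for j unfolding Y_def by (rule matrix_unitsI)
    then have "cut n o\<^sub>L Y N o\<^sub>L cut n \<in> insert 0 matrix_units" unfolding eq by simp
    ultimately show ?thesis unfolding X Y_def[symmetric] by blast
  qed
  then show "cut n o\<^sub>L X o\<^sub>L cut n \<in> insert 0 matrix_units"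
    "\<exists>n0. \<forall>n\<ge>n0. cut n o\<^sub>L X o\<^sub>L cut n = X" by blast+
qed

lemma weighted_shifts:
  assumes \<xi>: "\<xi> \<in> K" "norm \<xi> = 1"
  shows "\<exists>D. weighted_shifts q K \<xi> e J D cut G"
proof -
  obtain D where D: "\<And>t. adj_pair (D t) (D (- t))"
    "\<And>t n x. D t (b.R n x) = cis (2 * t * (of_int n * ln q)) *\<^sub>C b.R n x"
    using phases by blast
  have "weighted_shifts q K \<xi> e J D cut G"
  proof
    show "0 < q" "q < 1" "\<xi> \<in> K" "norm \<xi> = 1" by (fact q \<xi>)+
    show "bclinear (e i)" for i using S_unitary by (simp add: e_def unitary_op_def)
    show "cinner (e i x) (e j y) = (if i = j then cinner x y else 0)" if "x \<in> K" "y \<in> K" for i j x y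
    proof (cases "i = j")
      case True
      then show ?thesis using S_unitary by (simp add: e_def unitary_op_def)
    next
      case False
      then consider "fst i \<noteq> fst j" | "snd i \<noteq> snd j" by (auto simp: prod_eq_iff)
      then have "cinner (e i x) (e j y) = 0"
      proof cases
        case 1
        then show ?thesis
          using a.R.adj[of "fst i" "e i x" "e j y"] P_e[OF that(1), of "fst i" i] P_e[OF that(2), of "fst i" j] by simp
      next
        case 2
        then show ?thesis
          using b.R.adj[of "snd i" "e i x" "e j y"] R_e[OF that(1), of "snd i" i] R_e[OF that(2), of "snd i" j] by simp
      qed
      then show ?thesis using False by simp
    qed
    show "cinner (e i x) (J i y) = cinner (e i x) y" if "x \<in> K" for i x y
      by (simp add: J_def a.R.adj[symmetric] b.R.adj[symmetric] P_e[OF that] R_e[OF that])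
    show "(\<integral>\<^sup>+i. ennreal ((norm (J i x))\<^sup>2) \<partial>count_space UNIV) = ennreal ((norm x)\<^sup>2)" for x
    proof -
      have "(\<integral>\<^sup>+i. ennreal ((norm (J i x))\<^sup>2) \<partial>count_space UNIV)
        = (\<integral>\<^sup>+m. \<integral>\<^sup>+n. ennreal ((norm (J (m, n) x))\<^sup>2) \<partial>count_space UNIV \<partial>count_space UNIV)"
        by (rule nn_integral_fst_count_space[symmetric])
      then show ?thesis by (simp add: J_def b.R.parseval a.R.parseval)
    qed
    show "D t (e i x) = cis (2 * t * (of_int (snd i) * ln q)) *\<^sub>C e i x" if "x \<in> K" for t i x
      using D(2)[of t "snd i" "e i x"] R_e[OF that, of "snd i" i] by simp
    show "orth_projection (cut n)" for n
      unfolding cut_def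
      by (intro orth_projection_compose a.F.proj b.F.proj E\<^sub>p_E\<^sub>r a.pt_image_borel b.pt_image_borel)
    \<comment> \<open>In the degenerate case \<open>G\<close> has no elements, so the conditions on
      generators concern \<open>matrix_units\<close> only.\<close>
    have GX: "G = matrix_units" if "X \<in> G" for X using that unfolding G_def by (metis empty_iff)
    show "\<exists>Y. adj_pair X Y" "\<exists>d I. \<forall>i. \<forall>x\<in>K. X (e i x) = (if i \<in> I then e (i + d) x else 0)"
      "cut n o\<^sub>L X o\<^sub>L cut n \<in> insert 0 G" "\<exists>n0. \<forall>n\<ge>n0. cut n o\<^sub>L X o\<^sub>L cut n = X" if "X \<in> G" for X n
      using matrix_units_adj[of X] matrix_units_shift[of X] matrix_units_cut[of X] that
      unfolding GX[OF that] by blast+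
  qed (fact D(1) J_in_range cut_e K_lin | erule operator_ext | rule operator_ext, simp)+
  then show ?thesis by blast
qed

lemma powi_S: "unitary_powi v k = S k 0" "unitary_powi u l = S 0 l"
  by (simp_all add: S_def)

text \<open>The algebra is spanned by products with the function of \<open>b\<close> on the left.
  Moving \<open>b.R n\<close> to the right past \<open>u\<close> to the power \<open>l\<close>
  raises its index by \<open>l\<close>, because that power lowers the exponent of \<open>|b|\<close>
  by \<open>l\<close>.\<close>

lemma matrix_unit_eq:
  "(unitary_powi v k o\<^sub>L b.R n) o\<^sub>L (unitary_powi u l o\<^sub>L a.R m) = S k l o\<^sub>L (a.R m o\<^sub>L b.R (n + l))"
  by (rule operator_ext) (auto simp: powi_S P_e R_e S_e prod_eq_iff)

lemma tail_unit_eq: "b.Q N o\<^sub>L (unitary_powi u l o\<^sub>L a.R m) = S 0 l o\<^sub>L (a.R m o\<^sub>L b.Q (N + l))"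
  by (rule operator_ext) (auto simp: b.Q_def Er_e powi_S P_e S_e)

text \<open>One inclusion approximates the two factors separately and multiplies. The other holds
  already for generators, as every matrix unit is itself the product of a function of
  \<open>b\<close> and a function of \<open>a\<close>.\<close>

lemma azb_algebra_eq: "azb_algebra q a b = closure (cs.span G)"
proof -
  define \<A> where "\<A> = {X o\<^sub>L Y |X Y g h.
     g \<in> C0 (q_Gamma q \<union> {0}) \<and> is_fcalc b (extend0 (q_Gamma q \<union> {0}) g) X
     \<and> h \<in> C0 (q_Gamma q) \<and> is_fcalc a (extend0 (q_Gamma q) h) Y}"
  have alg: "azb_algebra q a b = closure (cs.span \<A>)"
    by (simp add: azb_algebra_def \<A>_def cspan_eq_span)
  show ?thesis
  proof (cases "(\<exists>E. spectral_measure_of a E) \<and> (\<exists>E. spectral_measure_of b E)")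
    case False
    then have "\<A> = {}" by (auto simp: \<A>_def is_fcalc_def)
    moreover have "G = {}" unfolding G_def using False by (rule if_not_P)
    ultimately show ?thesis unfolding alg by simp
  next
    case True
    then obtain Ea Eb where E: "spectral_measure_of a Ea" "spectral_measure_of b Eb" by blast
    have G: "G = matrix_units" unfolding G_def using True by (rule if_P)
    define B where "B = range (\<lambda>(n, k). unitary_powi v k o\<^sub>L b.R n) \<union> range b.Q"
    define A where "A = range (\<lambda>(m, l). unitary_powi u l o\<^sub>L a.R m)"
    have "\<A> \<subseteq> closure (cs.span G)"
    proof
      fix Z assume "Z \<in> \<A>"
      then obtain X Y g h where Z: "Z = X o\<^sub>L Y"
        and g: "g \<in> C0 (q_Gamma q \<union> {0})" "is_fcalc b (extend0 (q_Gamma q \<union> {0}) g) X"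
        and h: "h \<in> C0 (q_Gamma q)" "is_fcalc a (extend0 (q_Gamma q) h) Y"
        unfolding \<A>_def by blast
      have "X \<in> closure (cs.span B)"
        by (rule b.fcalc_in_closure[OF g(2,1)]) (auto simp: B_def)
      moreover have "Y \<in> closure (cs.span A)"
      proof (rule a.fcalc_in_closure[OF h(2,1)])
        \<comment> \<open>The circles avoid 0, so functions of \<open>a\<close> contribute no
          tails.\<close>
        show "0 \<in> q_Gamma q \<Longrightarrow> range a.Q \<subseteq> A"
          using q unfolding q_Gamma_eq[OF q(1)] by (auto simp: q_circle_iff)
      qed (auto simp: A_def)
      moreover have "bclinear X" if "X \<in> B" for X
        using that S_unitary orth_projection_bclinear[OF b.R.proj] orth_projection_bclinear[OF b.Q_proj]
        by (auto simp: B_def powi_S unitary_op_def)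
      moreover have "X o\<^sub>L Y \<in> cs.span G" if "X \<in> B" "Y \<in> A" for X Y
      proof (rule cs.span_base)
        show "X o\<^sub>L Y \<in> G"
          using that unfolding B_def A_def G by (auto simp: matrix_unit_eq tail_unit_eq matrix_unitsI)
      qed
      ultimately show "Z \<in> closure (cs.span G)" unfolding Z by (intro closure_span_compose[of B A])
    qed
    then have "closure (cs.span \<A>) \<subseteq> closure (cs.span G)"
      by (intro closure_minimal span_subset_closure closed_closure)
    moreover have "G \<subseteq> \<A>"
    proof
      fix Z assume "Z \<in> G"
      then consider k l m n where "Z = S k l o\<^sub>L (a.R m o\<^sub>L b.R n)" | l m N where "Z = S 0 l o\<^sub>L (a.R m o\<^sub>L b.Q N)"
        unfolding G matrix_units_def by blast
      then show "Z \<in> \<A>"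
      proof cases
        case 1
        then have Z: "Z = (unitary_powi v k o\<^sub>L b.R (n - l)) o\<^sub>L (unitary_powi u l o\<^sub>L a.R m)"
          by (simp add: matrix_unit_eq)
        obtain g where "g \<in> C0 (q_Gamma q \<union> {0})"
          "is_fcalc b (extend0 (q_Gamma q \<union> {0}) g) (unitary_powi v k o\<^sub>L b.R (n - l))"
          using b.matrix_unit_fcalc[OF E(2), of "q_Gamma q \<union> {0}"] by blast
        moreover obtain h where "h \<in> C0 (q_Gamma q)"
          "is_fcalc a (extend0 (q_Gamma q) h) (unitary_powi u l o\<^sub>L a.R m)"
          using a.matrix_unit_fcalc[OF E(1), of "q_Gamma q"] by blast
        ultimately show ?thesis unfolding Z \<A>_def by blast
      next
        case 2
        then have Z: "Z = b.Q (N - l) o\<^sub>L (unitary_powi u l o\<^sub>L a.R m)"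
          by (simp add: tail_unit_eq)
        obtain g where "g \<in> C0 (q_Gamma q \<union> {0})" "is_fcalc b (extend0 (q_Gamma q \<union> {0}) g) (b.Q (N - l))"
          using b.tail_fcalc[OF E(2), of "q_Gamma q \<union> {0}"] by blast
        moreover obtain h where "h \<in> C0 (q_Gamma q)"
          "is_fcalc a (extend0 (q_Gamma q) h) (unitary_powi u l o\<^sub>L a.R m)"
          using a.matrix_unit_fcalc[OF E(1), of "q_Gamma q"] by blast
        ultimately show ?thesis unfolding Z \<A>_def by blast
      qed
    qed
    then have "closure (cs.span G) \<subseteq> closure (cs.span \<A>)"
      by (intro closure_mono cs.span_mono)
    ultimately show ?thesis unfolding alg by blast
  qed
qed

section \<open>Diagonal entries of the elements of \<open>A\<^sub>0\<close>\<close>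

lemma joint_fcalc_e:
  assumes X: "is_joint_fcalc p r f X" and fin: "finite {(s, t). f s t \<noteq> 0}"
    and supp: "{(s, t). f s t \<noteq> 0} \<subseteq> q_powers q \<times> q_powers q" and x: "x \<in> K"
  shows "X (e i x) = f (q powi fst i) (q powi snd i) *\<^sub>C e i x"
proof -
  let ?S = "{(s, t). f s t \<noteq> 0}"
  obtain E F where E: "spectral_measure_of p E" and F: "spectral_measure_of r F"
    and X: "X = (\<Sum>(s, t)\<in>?S. cscale (f s t) (E {complex_of_real s} o\<^sub>L F {complex_of_real t}))"
    using X by (auto simp: is_joint_fcalc_def)
  define st where "st = (q powi fst i, q powi snd i)"
  have "X (e i x) = (\<Sum>w\<in>?S. if w = st then f (fst st) (snd st) *\<^sub>C e i x else 0)"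
    unfolding X blinfun.sum_left
  proof (rule sum.cong[OF refl])
    fix w
    assume "w \<in> ?S"
    then have "w \<in> q_powers q \<times> q_powers q" using supp by blast
    then obtain m n where w: "w = (q powi m, q powi n)" by (auto simp: q_powers_def)
    have "E {complex_of_real (q powi m)} = a.R m" "F {complex_of_real (q powi n)} = b.R n"
      using a.R_unique[OF E, of m] b.R_unique[OF F, of n] by (simp_all add: a.pt_def b.pt_def)
    then show "blinfun_apply (case w of (s, t) \<Rightarrow> cscale (f s t) (E {complex_of_real s} o\<^sub>L F {complex_of_real t})) (e i x)
      = (if w = st then f (fst st) (snd st) *\<^sub>C e i x else 0)"
      using q_powi_inj[OF q] x
      by (auto simp: w st_def cscale.rep_eq R_e P_e scaleC.zero_right simp del: of_real_power_int)
  qed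
  also have "\<dots> = (if st \<in> ?S then f (fst st) (snd st) *\<^sub>C e i x else 0)"
    using fin by (rule sum.delta)
  also have "\<dots> = f (q powi fst i) (q powi snd i) *\<^sub>C e i x"
    by (auto simp: st_def)
  finally show ?thesis .
qed

text \<open>The term with indices \<open>k\<close>, \<open>l\<close> moves \<open>e i \<xi>\<close>
  to a multiple of the basis vector shifted by \<open>(k, - l)\<close>, so only
  \<open>k = l = 0\<close> meets the diagonal.\<close>

lemma A0_entry:
  assumes x: "A0_expansion q u p v r f x" and \<xi>: "\<xi> \<in> K" "norm \<xi> = 1"
    and e_cinner: "\<And>i j. cinner (e i \<xi>) (e j \<xi>) = (if i = j then 1 else 0)"
  shows "cinner (e i \<xi>) (x (e i \<xi>)) = f 0 0 (q powi fst i) (q powi snd i)"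
proof -
  let ?S = "{(k, l). f k l \<noteq> (\<lambda>s t. 0)}"
  obtain X where fin: "finite ?S"
    and f: "\<And>k l. finite {(s, t). f k l s t \<noteq> 0}" "\<And>k l. {(s, t). f k l s t \<noteq> 0} \<subseteq> q_powers q \<times> q_powers q"
    and X: "\<And>k l. is_joint_fcalc p r (f k l) (X k l)"
    and x_eq: "x = (\<Sum>(k, l)\<in>?S. X k l o\<^sub>L unitary_powi v k o\<^sub>L unitary_powi u l)"
    using x unfolding A0_expansion_def by blast
  have "cinner (e i \<xi>) (x (e i \<xi>)) = (\<Sum>w\<in>?S. if w = (0, 0) then f 0 0 (q powi fst i) (q powi snd i) else 0)"
    unfolding x_eq blinfun.sum_left cinner.sum_right
  proof (rule sum.cong[OF refl])
    fix w :: "int \<times> int"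
    obtain k l where w: "w = (k, l)" by (cases w)
    have "(X k l o\<^sub>L unitary_powi v k o\<^sub>L unitary_powi u l) (e i \<xi>) = X k l (S k l (e i \<xi>))"
      by (simp add: S_def)
    also have "\<dots> = f k l (q powi (fst i + k)) (q powi (snd i - l)) *\<^sub>C e (i + (k, - l)) \<xi>"
      unfolding S_e joint_fcalc_e[OF X f \<xi>(1)] by simp
    finally show "cinner (e i \<xi>) (blinfun_apply (case w of (k, l) \<Rightarrow> X k l o\<^sub>L unitary_powi v k o\<^sub>L unitary_powi u l) (e i \<xi>))
      = (if w = (0, 0) then f 0 0 (q powi fst i) (q powi snd i) else 0)"
      by (auto simp: w cinner_scaleC_right e_cinner prod_eq_iff)
  qed
  also have "\<dots> = (if (0, 0) \<in> ?S then f 0 0 (q powi fst i) (q powi snd i) else 0)"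
    using fin by (rule sum.delta)
  also have "\<dots> = f 0 0 (q powi fst i) (q powi snd i)"
    by auto
  finally show ?thesis .
qed

end

theorem proposition5p5:
  fixes q :: real and a b p r :: "('h::chilbert \<times> 'h) set" and u v :: "'h \<Rightarrow>\<^sub>L 'h"
  assumes "0 < q" and "q < 1"
    and "\<exists>\<xi>::'h. \<xi> \<noteq> 0"
    and "admissible_pair q a b u p v r"
  shows "\<exists>\<psi> :: ('h \<Rightarrow>\<^sub>L 'h) \<Rightarrow> ennreal.
    KMS_weight (azb_algebra q a b) \<psi>
    \<and> lsc_weight (azb_algebra q a b) \<psi>
    \<and> densely_defined_weight (azb_algebra q a b) \<psi>
    \<and> faithful_weight (azb_algebra q a b) \<psi>
    \<and> (\<forall>f x. A0_expansion q u p v r f x \<and> positive_op x \<longrightarrow>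
         \<psi> x < \<infinity> \<and>
         complex_of_real (enn2real (\<psi> x)) =
           (\<Sum>\<^sub>\<infinity>(i, j)\<in>(UNIV :: (int \<times> int) set).
              f 0 0 (q powi i) (q powi j) * complex_of_real (q powi (2 * j))))"
proof -
  obtain Ep Er where E: "spectral_measure_of p Ep" "spectral_measure_of r Er"
    "\<And>M N. M \<in> sets borel \<Longrightarrow> N \<in> sets borel \<Longrightarrow> Ep M o\<^sub>L Er N = Er N o\<^sub>L Ep M"
    using assms(4) unfolding admissible_pair_def strongly_commute_def by blast
  interpret azb q a b p r u v Ep Er
    by unfold_locales (use assms E in auto)
  obtain \<xi> where \<xi>: "\<xi> \<in> K" "norm \<xi> = 1" using unit_vector[OF assms(3)] by blast
  obtain D where "weighted_shifts q K \<xi> e J D cut G" using weighted_shifts[OF \<xi>] by blast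
  then interpret W: weighted_shifts q K \<xi> e J D cut G .
  have A: "azb_algebra q a b = W.A" by (simp add: azb_algebra_eq W.A_def)
  have A0: "W.\<psi> x < \<infinity> \<and> complex_of_real (enn2real (W.\<psi> x)) =
      (\<Sum>\<^sub>\<infinity>(i, j)\<in>UNIV. f 0 0 (q powi i) (q powi j) * complex_of_real (q powi (2 * j)))"
    if x: "A0_expansion q u p v r f x" "positive_op x" for f x
  proof -
    have "cinner (e i \<xi>) (e j \<xi>) = (if i = j then 1 else 0)" for i j
      using W.e_cinner[OF \<xi>(1) \<xi>(1), of i j] \<xi>(2) by (simp add: cinner_self)
    note entry = A0_entry[OF x(1) \<xi> this]
    define F where "F i = f 0 0 (q powi fst i) (q powi snd i)" for i
    define I where "I = {i. F i \<noteq> 0}"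
    \<comment> \<open>Positivity of \<open>x\<close> makes its diagonal entries nonnegative reals,
      so that the extended nonnegative sum and the complex one agree.\<close>
    have F: "F i = complex_of_real (Re (F i))" "0 \<le> Re (F i)" for i
      using x(2) unfolding F_def entry[symmetric] positive_op_def by (auto simp: complex_eq_iff)
    have "finite {(s, t). f 0 0 s t \<noteq> 0}" using x(1) unfolding A0_expansion_def by blast
    then have "finite ((\<lambda>i. (q powi fst i, q powi snd i)) ` I)"
      by (rule rev_finite_subset) (auto simp: I_def F_def)
    moreover have "inj_on (\<lambda>i. (q powi fst i, q powi snd i)) I"
      using q_powi_inj[OF q] by (auto simp: inj_on_def prod_eq_iff)
    ultimately have fin: "finite I" by (rule finite_imageD)
    have "W.\<psi> x = (\<integral>\<^sup>+i. ennreal (q powi (2 * snd i) * Re (F i)) \<partial>count_space UNIV)"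
      by (simp add: W.\<psi>_def entry F_def)
    also have "\<dots> = (\<Sum>i\<in>I. ennreal (q powi (2 * snd i) * Re (F i)))"
      using fin by (intro nn_integral_count_space') (auto simp: I_def)
    also have "\<dots> = ennreal (\<Sum>i\<in>I. q powi (2 * snd i) * Re (F i))"
      using q F(2) by (intro sum_ennreal) simp
    finally have \<psi>: "W.\<psi> x = ennreal (\<Sum>i\<in>I. q powi (2 * snd i) * Re (F i))" .
    have "(\<Sum>\<^sub>\<infinity>(i, j)\<in>UNIV. f 0 0 (q powi i) (q powi j) * complex_of_real (q powi (2 * j)))
      = (\<Sum>\<^sub>\<infinity>i\<in>UNIV. F i * complex_of_real (q powi (2 * snd i)))"
      by (simp add: F_def case_prod_unfold)
    also have "\<dots> = (\<Sum>\<^sub>\<infinity>i\<in>I. F i * complex_of_real (q powi (2 * snd i)))"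
      by (intro infsum_cong_neutral) (auto simp: I_def)
    also have "\<dots> = (\<Sum>i\<in>I. F i * complex_of_real (q powi (2 * snd i)))"
      using fin by (rule infsum_finite)
    also have "\<dots> = (\<Sum>i\<in>I. complex_of_real (q powi (2 * snd i) * Re (F i)))"
      by (rule sum.cong[OF refl]) (subst F(1), simp add: mult.commute)
    also have "\<dots> = complex_of_real (\<Sum>i\<in>I. q powi (2 * snd i) * Re (F i))"
      by simp
    also have "(\<Sum>i\<in>I. q powi (2 * snd i) * Re (F i)) = enn2real (W.\<psi> x)"
      unfolding \<psi> using q F(2) by (intro enn2real_ennreal[symmetric] sum_nonneg) simp
    finally show ?thesis using \<psi> by simp
  qed
  show ?thesis
    unfolding A using W.KMS W.lsc W.densely_defined W.faithful A0 by blast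
qed

end
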